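(* Let $n\in\mathbb{N}$, let $K$ be a field of characteristic $0$, let $W$ be the $n$-th Weyl algebra over $K$, let $L$ be a left ideal of $W$, and let $\nu\in\mathbb{N}_0^{2n}$. Then $$\kappa_\nu(W/L)\le\gamma_\nu(L),\qquad\text{where}\qquad \gamma_\nu(L)=\inf_U\ \sup_{u\in U\setminus\{0\}}\deg^\nu(u),$$ the infimum being taken over all universal Gröbner bases $U$ of $L$.
   Context: $\mathbb{N}=\{1,2,\dots\}$, $\mathbb{N}_0=\mathbb{N}\cup\{0\}$. $K[X,Y]=K[X_1,\dots,X_n,Y_1,\dots,Y_n]$. The $n$-th Weyl algebra $W$ is the $K$-subalgebra of $\mathrm{End}_K(K[X_1,\dots,X_n])$ generated by $\xi_i$ (multiplication by $X_i$) and $\partial_i=\partial/\partial X_i$, $1\le i\le n$. It has $K$-basis $\{\xi^\lambda\partial^\mu\mid\lambda,\mu\in\mathbb{N}_0^n\}$; for $w=\sum c_{\lambda\mu}\xi^\lambda\partial^\mu$ put $\mathrm{supp}(w)=\{(\lambda,\mu)\mid c_{\lambda\mu}\neq0\}$. Let $(\lambda|\mu)\in\mathbb{N}_0^{2n}$ denote concatenation and $\cdot$ the standard scalar product. For $\omega\in\mathbb{N}_0^{2n}$, $\deg^\omega(w)=\sup\{\omega\cdot(\lambda|\mu)\mid(\lambda,\mu)\in\mathrm{supp}(w)\}$ (so $\deg^\omega(0)=-\infty$). $\Omega=\{\omega\in\mathbb{N}_0^{2n}\mid\omega_i+\omega_{n+i}>0\text{ for }1\le i\le n\}$. In the definition of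 $\gamma_\nu(L)$ the supremum is taken in $\mathbb{N}_0$ (so the supremum of the empty set is $0$). Graded modules. For $\omega\in\Omega$, $W$ is filtered by $\mathrm{F}^\omega_iW=\{w\in W\mid\deg^\omega(w)\le i\}$, $i\in\mathbb{Z}$; the associated graded ring $\mathrm{G}^\omega W=\bigoplus_i\mathrm{F}^\omega_iW/\mathrm{F}^\omega_{i-1}W$ is commutative and is identified with $K[X,Y]$ by letting $X_i,Y_i$ correspond to the classes of $\xi_i,\partial_i$ in degrees $\omega_i,\omega_{n+i}$. For $\nu\in\mathbb{N}_0^{2n}$, $K[X,Y]$ is filtered by $\nu$-degree ($X^\lambda Y^\mu$ has $\nu$-degree $\nu\cdot(\lambda|\mu)$) and its associated graded ring is identified with $K[X,Y]$. A filtration $(\mathrm{F}_iM)_{i\in\mathbb{Z}}$ of a left module $M$ over a filtered ring $R$ is good if there are finitely many $m_j\in M$, $p_j\in\mathbb{Z}$ with $\mathrm{F}_iM=\sum_j\mathrm{F}_{i-p_j}R\,m_j$ for all $i$. For a finitely generated left $W$-module $M$, $\mathrm{G}^\omega M=\bigoplus_i\mathrm{F}_iM/\mathrm{F}_{i-1}M$ is the associated graded $K[X,Y]$-module with respect to some good filtration of $M$ over $W$ with the $\omega$-filtration; for a finitely generated $K[X,Y]$-module $N$, $\mathrm{G}^\nu N$ is defined likewise over $K[X,Y]$ with the $\nu$-filtration. The radicals of the annihilators $(0:\cdot)$ of these modules in $K[X,Y]$ do not depend on the good filtrations chosen. Definition of $\kappa_\nu$. For a finitely generated left $W$-module $M$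 and $\nu\in\mathbb{N}_0^{2n}$, $\kappa_\nu(M)$ is the least $s_0\in\mathbb{N}_0$ such that $\sqrt{(0:\mathrm{G}^\nu\mathrm{G}^\omega M)}=\sqrt{(0:\mathrm{G}^{\nu+s\omega}M)}$ in $K[X,Y]$ for all $\omega\in\Omega$ and all $s\in\mathbb{N}$ with $s>s_0$ (such an $s_0$ exists). Universal Gröbner bases. A normal ordering is a total ordering $\preceq$ on $\mathbb{N}_0^n\times\mathbb{N}_0^n$ with $(0,0)\preceq(\lambda,\mu)$ for all $(\lambda,\mu)$, and with $(\lambda,\mu)\preceq(\rho,\sigma)\Rightarrow(\lambda+\alpha,\mu+\beta)\preceq(\rho+\alpha,\sigma+\beta)$. For $w\in W\setminus\{0\}$ let $\mathrm{LM}_\preceq(w)=X^\lambda Y^\mu\in K[X,Y]$, where $(\lambda,\mu)$ is the $\preceq$-greatest element of $\mathrm{supp}(w)$. A finite subset $B\subseteq L$ is a $\preceq$-Gröbner basis of the left ideal $L$ if $L=\sum_{b\in B}Wb$ and the ideal of $K[X,Y]$ generated by all $\mathrm{LM}_\preceq(x)$, $x\in L\setminus\{0\}$, is generated by the $\mathrm{LM}_\preceq(b)$, $b\in B\setminus\{0\}$. A finite subset $U\subseteq L$ is a universal Gröbner basis of $L$ if it is a $\preceq$-Gröbner basis of $L$ for every normal ordering $\preceq$; every left ideal of $W$ admits one. *)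

theory Defs
  imports
    "HOL-Algebra.Ideal"
    "HOL-Algebra.Module"
    "HOL-Library.Poly_Mapping"
    "HOL-Library.Extended_Real"
begin

section \<open>Polynomials\<close>

text \<open>
  Polynomials in variables indexed by a finite type are finitely supported functions from
  exponents to coefficients, with the convolution ring structure of \<^theory>\<open>HOL-Library.Poly_Mapping\<close>.
  With \<open>n = CARD('n)\<close>, the ring \<open>K[X]\<close> is \<open>('k, 'n) mpoly\<close> and \<open>K[X,Y]\<close> is
  \<open>('k, 'n + 'n) mpoly\<close>, where \<open>Inl i\<close> indexes \<open>X\<^sub>i\<close> and \<open>Inr i\<close> indexes \<open>Y\<^sub>i\<close>.
  Thus an exponent over \<open>'n + 'n\<close> is the concatenation \<open>(\<lambda>|\<mu>)\<close>, and weights in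
  \<open>\<nat>\<^sub>0\<^sup>2\<^sup>n\<close> are functions \<open>'n + 'n \<Rightarrow> nat\<close>.
\<close>

type_synonym 'v expo = "'v \<Rightarrow>\<^sub>0 nat"
type_synonym ('k, 'v) mpoly = "'v expo \<Rightarrow>\<^sub>0 'k"
type_synonym ('k, 'n) endo = "('k, 'n) mpoly \<Rightarrow> ('k, 'n) mpoly"

definition Const :: "'k::field_char_0 \<Rightarrow> ('k, 'v) mpoly" where
  "Const c = Poly_Mapping.single 0 c"

definition Var :: "'v \<Rightarrow> ('k::field_char_0, 'v) mpoly" where
  "Var i = Poly_Mapping.single (Poly_Mapping.single i 1) 1"

definition poly_ring :: "('k::field_char_0, 'v) mpoly ring" where
  "poly_ring = \<lparr>carrier = UNIV, mult = (*), one = 1, zero = 0, add = (+)\<rparr>"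

section \<open>The Weyl algebra\<close>

definition xi :: "'n \<Rightarrow> ('k::field_char_0, 'n) endo" where
  "xi i p = Var i * p"

definition partial :: "'n \<Rightarrow> ('k::field_char_0, 'n) endo" where
  "partial i p = (\<Sum>m\<in>Poly_Mapping.keys p.
     Poly_Mapping.single (m - Poly_Mapping.single i 1)
       (of_nat (Poly_Mapping.lookup m i) * Poly_Mapping.lookup p m))"

inductive_set weyl_set :: "('k::field_char_0, 'n) endo set" where
  id: "id \<in> weyl_set"
| xi: "xi i \<in> weyl_set"
| partial: "partial i \<in> weyl_set"
| add: "v \<in> weyl_set \<Longrightarrow> w \<in> weyl_set \<Longrightarrow> (\<lambda>p. v p + w p) \<in> weyl_set"
| comp: "v \<in> weyl_set \<Longrightarrow> w \<in> weyl_set \<Longrightarrow> v \<circ> w \<in> weyl_set"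
| scale: "w \<in> weyl_set \<Longrightarrow> (\<lambda>p. Const c * w p) \<in> weyl_set"

definition weyl :: "('k::field_char_0, 'n) endo ring" where
  "weyl = \<lparr>carrier = weyl_set, mult = (\<circ>), one = id, zero = (\<lambda>_. 0), add = (\<lambda>v w p. v p + w p)\<rparr>"

text \<open>
  The operators \<open>\<xi>\<^sup>\<lambda> \<partial>\<^sup>\<mu>\<close>. The \<open>\<xi>\<^sub>i\<close> commute, and so do the \<open>\<partial>\<^sub>i\<close>, hence the folds below do
  not depend on the order of the variables.
\<close>

definition weyl_monom :: "('n::finite + 'n) expo \<Rightarrow> ('k::field_char_0, 'n) endo" where
  "weyl_monom e =
     Finite_Set.fold (\<lambda>i f. (xi i ^^ Poly_Mapping.lookup e (Inl i)) \<circ> f) id UNIV \<circ>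
     Finite_Set.fold (\<lambda>i f. (partial i ^^ Poly_Mapping.lookup e (Inr i)) \<circ> f) id UNIV"

definition weyl_coeffs :: "('k::field_char_0, 'n::finite) endo \<Rightarrow> ('k, 'n + 'n) mpoly" where
  "weyl_coeffs w = (THE c. w = (\<lambda>p. \<Sum>e\<in>Poly_Mapping.keys c.
     Const (Poly_Mapping.lookup c e) * weyl_monom e p))"

definition supp :: "('k::field_char_0, 'n::finite) endo \<Rightarrow> ('n + 'n) expo set" where
  "supp w = Poly_Mapping.keys (weyl_coeffs w)"

section \<open>Degrees and the induced filtrations\<close>

definition wdot :: "('v::finite \<Rightarrow> nat) \<Rightarrow> 'v expo \<Rightarrow> nat" where
  "wdot \<omega> e = (\<Sum>v\<in>UNIV. \<omega> v * Poly_Mapping.lookup e v)"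

text \<open>The supremum of the empty set in \<^typ>\<open>ereal\<close> is \<open>-\<infinity>\<close>.\<close>

definition weyl_deg :: "('n::finite + 'n \<Rightarrow> nat) \<Rightarrow> ('k::field_char_0, 'n) endo \<Rightarrow> ereal" where
  "weyl_deg \<omega> w = (SUP e\<in>supp w. ereal (real (wdot \<omega> e)))"

definition poly_deg :: "('v::finite \<Rightarrow> nat) \<Rightarrow> ('k::field_char_0, 'v) mpoly \<Rightarrow> ereal" where
  "poly_deg \<nu> p = (SUP e\<in>Poly_Mapping.keys p. ereal (real (wdot \<nu> e)))"

definition weyl_fil :: "('n::finite + 'n \<Rightarrow> nat) \<Rightarrow> int \<Rightarrow> ('k::field_char_0, 'n) endo set" where
  "weyl_fil \<omega> i = {w \<in> carrier weyl. weyl_deg \<omega> w \<le> ereal (real_of_int i)}"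

definition poly_fil :: "('v::finite \<Rightarrow> nat) \<Rightarrow> int \<Rightarrow> ('k::field_char_0, 'v) mpoly set" where
  "poly_fil \<nu> i = {p. poly_deg \<nu> p \<le> ereal (real_of_int i)}"

definition Omega :: "('n + 'n \<Rightarrow> nat) set" where
  "Omega = {\<omega>. \<forall>i. \<omega> (Inl i) + \<omega> (Inr i) > 0}"

section \<open>Good filtrations and associated graded objects\<close>

definition filtration ::
  "(int \<Rightarrow> 'r set) \<Rightarrow> ('r, 'm) module \<Rightarrow> (int \<Rightarrow> 'm set) \<Rightarrow> bool" where
  "filtration FR M F \<longleftrightarrow>
     (\<forall>i. additive_subgroup (F i) M) \<and> mono F \<and> (\<Union>i. F i) = carrier M \<and>
     (\<forall>i j. \<forall>r\<in>FR i. \<forall>m\<in>F j. r \<odot>\<^bsub>M\<^esub> m \<in> F (i + j))"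

definition good_filtration ::
  "(int \<Rightarrow> 'r set) \<Rightarrow> ('r, 'm) module \<Rightarrow> (int \<Rightarrow> 'm set) \<Rightarrow> bool" where
  "good_filtration FR M F \<longleftrightarrow> filtration FR M F \<and>
     (\<exists>(k::nat) (m :: nat \<Rightarrow> 'm) (p :: nat \<Rightarrow> int). (\<forall>j<k. m j \<in> carrier M) \<and>
        (\<forall>i. F i = {(\<Oplus>\<^bsub>M\<^esub>j\<in>{..<k}. r j \<odot>\<^bsub>M\<^esub> m j) | r. \<forall>j<k. r j \<in> FR (i - p j)}))"

text \<open>
  Elements of \<open>\<Oplus>\<^sub>i F\<^sub>i / F\<^sub>i\<^sub>-\<^sub>1\<close> are families of cosets that are trivial in almost all degrees.
\<close>

definition gr_carrier :: "('m, 'z) ring_scheme \<Rightarrow> (int \<Rightarrow> 'm set) \<Rightarrow> (int \<Rightarrow> 'm set) set" where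
  "gr_carrier M F = {x. (\<forall>i. x i \<in> (\<lambda>a. F (i - 1) +>\<^bsub>M\<^esub> a) ` F i) \<and> finite {i. x i \<noteq> F (i - 1)}}"

definition gr_class ::
  "('m, 'z) ring_scheme \<Rightarrow> (int \<Rightarrow> 'm set) \<Rightarrow> int \<Rightarrow> 'm \<Rightarrow> int \<Rightarrow> 'm set" where
  "gr_class M F d a = (\<lambda>i. if i = d then F (i - 1) +>\<^bsub>M\<^esub> a else F (i - 1))"

text \<open>
  The product of \<open>x = (x\<^sub>i)\<close> and \<open>y = (y\<^sub>j)\<close> has in degree \<open>k\<close> the class of \<open>\<Sum>\<^sub>i a\<^sub>i b\<^sub>k\<^sub>-\<^sub>i\<close>, where
  \<open>a\<^sub>i \<in> x\<^sub>i\<close> and \<open>b\<^sub>j \<in> y\<^sub>j\<close> are representatives; the union over all choices of representatives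
  is a union of equal cosets. It serves both as ring multiplication and as module action.
\<close>

definition gr_prod ::
  "(int \<Rightarrow> 'r set) \<Rightarrow> ('m, 'z) ring_scheme \<Rightarrow> (int \<Rightarrow> 'm set) \<Rightarrow> ('r \<Rightarrow> 'm \<Rightarrow> 'm) \<Rightarrow>
   (int \<Rightarrow> 'r set) \<Rightarrow> (int \<Rightarrow> 'm set) \<Rightarrow> int \<Rightarrow> 'm set" where
  "gr_prod FR M F f x y = (\<lambda>k. \<Union>a\<in>Pi UNIV x. \<Union>b\<in>Pi UNIV y.
     F (k - 1) +>\<^bsub>M\<^esub> (\<Oplus>\<^bsub>M\<^esub>i\<in>{i. x i \<noteq> FR (i - 1)}. f (a i) (b (k - i))))"

definition gr_ring :: "'r ring \<Rightarrow> (int \<Rightarrow> 'r set) \<Rightarrow> (int \<Rightarrow> 'r set) ring" where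
  "gr_ring R FR = \<lparr>
     carrier = gr_carrier R FR,
     mult = gr_prod FR R FR (mult R),
     one = gr_class R FR 0 \<one>\<^bsub>R\<^esub>,
     zero = (\<lambda>i. FR (i - 1)),
     add = (\<lambda>x y i. x i <+>\<^bsub>R\<^esub> y i)\<rparr>"

text \<open>The fields \<open>mult\<close> and \<open>one\<close> of a module record play no role.\<close>

definition gr_module ::
  "(int \<Rightarrow> 'r set) \<Rightarrow> ('r, 'm) module \<Rightarrow> (int \<Rightarrow> 'm set) \<Rightarrow> (int \<Rightarrow> 'r set, int \<Rightarrow> 'm set) module" where
  "gr_module FR M F = \<lparr>
     carrier = gr_carrier M F,
     mult = undefined,
     one = undefined,
     zero = (\<lambda>i. F (i - 1)),
     add = (\<lambda>x y i. x i <+>\<^bsub>M\<^esub> y i),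
     smult = gr_prod FR M F (smult M)\<rparr>"

definition restrict_scalars :: "('a \<Rightarrow> 'r) \<Rightarrow> ('r, 'm) module \<Rightarrow> ('a, 'm) module" where
  "restrict_scalars h M = \<lparr>
     carrier = carrier M, mult = mult M, one = one M, zero = zero M, add = add M,
     smult = (\<lambda>a. smult M (h a))\<rparr>"

text \<open>
  The identifications of \<open>K[X,Y]\<close> with \<open>G\<^sup>\<omega>W\<close>, for \<open>\<omega> \<in> \<Omega>\<close>, and with \<open>G\<^sup>\<nu>K[X,Y]\<close>, as the
  \<open>K\<close>-algebra homomorphisms determined by the images of the variables.
\<close>

definition weyl_gr_iso ::
  "('n::finite + 'n \<Rightarrow> nat) \<Rightarrow> ('k::field_char_0, 'n + 'n) mpoly \<Rightarrow> int \<Rightarrow> ('k, 'n) endo set" where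
  "weyl_gr_iso \<omega> = (THE h. h \<in> ring_hom poly_ring (gr_ring weyl (weyl_fil \<omega>)) \<and>
     (\<forall>c. h (Const c) = gr_class weyl (weyl_fil \<omega>) 0 (\<lambda>p. Const c * p)) \<and>
     (\<forall>i. h (Var (Inl i)) = gr_class weyl (weyl_fil \<omega>) (int (\<omega> (Inl i))) (xi i)) \<and>
     (\<forall>i. h (Var (Inr i)) = gr_class weyl (weyl_fil \<omega>) (int (\<omega> (Inr i))) (partial i)))"

definition poly_gr_iso ::
  "('v::finite \<Rightarrow> nat) \<Rightarrow> ('k::field_char_0, 'v) mpoly \<Rightarrow> int \<Rightarrow> ('k, 'v) mpoly set" where
  "poly_gr_iso \<nu> = (THE h. h \<in> ring_hom poly_ring (gr_ring poly_ring (poly_fil \<nu>)) \<and>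
     (\<forall>c. h (Const c) = gr_class poly_ring (poly_fil \<nu>) 0 (Const c)) \<and>
     (\<forall>v. h (Var v) = gr_class poly_ring (poly_fil \<nu>) (int (\<nu> v)) (Var v)))"

text \<open>
  \<open>G\<^sup>\<omega>M\<close> and \<open>G\<^sup>\<nu>N\<close> as \<open>K[X,Y]\<close>-modules, with respect to a given filtration \<open>F\<close>.
\<close>

definition weyl_gr ::
  "('n::finite + 'n \<Rightarrow> nat) \<Rightarrow> (('k::field_char_0, 'n) endo, 'm) module \<Rightarrow> (int \<Rightarrow> 'm set) \<Rightarrow>
   (('k, 'n + 'n) mpoly, int \<Rightarrow> 'm set) module" where
  "weyl_gr \<omega> M F = restrict_scalars (weyl_gr_iso \<omega>) (gr_module (weyl_fil \<omega>) M F)"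

definition poly_gr ::
  "('v::finite \<Rightarrow> nat) \<Rightarrow> (('k::field_char_0, 'v) mpoly, 'm) module \<Rightarrow> (int \<Rightarrow> 'm set) \<Rightarrow>
   (('k, 'v) mpoly, int \<Rightarrow> 'm set) module" where
  "poly_gr \<nu> N F = restrict_scalars (poly_gr_iso \<nu>) (gr_module (poly_fil \<nu>) N F)"

definition annihilator :: "('k::field_char_0, 'v) mpoly ring \<Rightarrow> (('k, 'v) mpoly, 'm) module \<Rightarrow> ('k, 'v) mpoly set" where
  "annihilator R N = {p \<in> carrier R. \<forall>x\<in>carrier N. p \<odot>\<^bsub>N\<^esub> x = \<zero>\<^bsub>N\<^esub>}"

definition rad :: "('k::field_char_0, 'v) mpoly set \<Rightarrow> ('k, 'v) mpoly set" where
  "rad I = {p. \<exists>k::nat. p ^ k \<in> I}"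

text \<open>
  The radicals do not depend on the good filtrations; the equality is therefore required for all
  good filtrations \<open>F\<close> and \<open>F''\<close> of \<open>M\<close> and \<open>F'\<close> of \<open>G\<^sup>\<omega>M\<close>. For finitely generated \<open>M\<close> these exist.
\<close>

definition kappa ::
  "('n::finite + 'n \<Rightarrow> nat) \<Rightarrow> (('k::field_char_0, 'n) endo, 'm) module \<Rightarrow> nat" where
  "kappa \<nu> M = (LEAST s0. \<forall>\<omega>\<in>Omega. \<forall>s>s0. \<forall>F F' F''.
     good_filtration (weyl_fil \<omega>) M F \<longrightarrow>
     good_filtration (poly_fil \<nu>) (weyl_gr \<omega> M F) F' \<longrightarrow>
     good_filtration (weyl_fil (\<lambda>i. \<nu> i + s * \<omega> i)) M F'' \<longrightarrow>
       rad (annihilator poly_ring (poly_gr \<nu> (weyl_gr \<omega> M F) F')) =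
       rad (annihilator poly_ring (weyl_gr (\<lambda>i. \<nu> i + s * \<omega> i) M F'')))"

section \<open>Left ideals and universal Groebner bases\<close>

definition left_ideal :: "'r set \<Rightarrow> 'r ring \<Rightarrow> bool" where
  "left_ideal L R \<longleftrightarrow> additive_subgroup L R \<and> (\<forall>r\<in>carrier R. \<forall>x\<in>L. r \<otimes>\<^bsub>R\<^esub> x \<in> L)"

definition quot_module :: "'r ring \<Rightarrow> 'r set \<Rightarrow> ('r, 'r set) module" where
  "quot_module R L = \<lparr>
     carrier = a_rcosets\<^bsub>R\<^esub> L,
     mult = undefined,
     one = undefined,
     zero = L,
     add = set_add R,
     smult = (\<lambda>r A. \<Union>a\<in>A. L +>\<^bsub>R\<^esub> (r \<otimes>\<^bsub>R\<^esub> a))\<rparr>"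

definition normal_ordering :: "('v expo \<times> 'v expo) set \<Rightarrow> bool" where
  "normal_ordering r \<longleftrightarrow> linear_order r \<and> (\<forall>e. (0, e) \<in> r) \<and>
     (\<forall>a b c. (a, b) \<in> r \<longrightarrow> (a + c, b + c) \<in> r)"

definition LM ::
  "(('n::finite + 'n) expo \<times> ('n + 'n) expo) set \<Rightarrow> ('k::field_char_0, 'n) endo \<Rightarrow> ('k, 'n + 'n) mpoly" where
  "LM r w = Poly_Mapping.single (THE e. e \<in> supp w \<and> (\<forall>e'\<in>supp w. (e', e) \<in> r)) 1"

definition groebner_basis ::
  "(('n::finite + 'n) expo \<times> ('n + 'n) expo) set \<Rightarrow> ('k::field_char_0, 'n) endo set \<Rightarrow>
   ('k, 'n) endo set \<Rightarrow> bool" where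
  "groebner_basis r L B \<longleftrightarrow> finite B \<and> B \<subseteq> L \<and>
     L = {(\<Oplus>\<^bsub>weyl\<^esub>b\<in>B. a b \<otimes>\<^bsub>weyl\<^esub> b) | a. \<forall>b\<in>B. a b \<in> carrier weyl} \<and>
     Idl\<^bsub>poly_ring\<^esub> (LM r ` (L - {\<zero>\<^bsub>weyl\<^esub>})) = Idl\<^bsub>poly_ring\<^esub> (LM r ` (B - {\<zero>\<^bsub>weyl\<^esub>}))"

definition universal_groebner_basis ::
  "('k::field_char_0, 'n::finite) endo set \<Rightarrow> ('k, 'n) endo set \<Rightarrow> bool" where
  "universal_groebner_basis L U \<longleftrightarrow> finite U \<and> U \<subseteq> L \<and>
     (\<forall>r. normal_ordering r \<longrightarrow> groebner_basis r L U)"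

text \<open>Infimum and supremum are taken in \<^typ>\<open>nat\<close>, where the supremum of the empty set is \<open>0\<close>.\<close>

definition gamma ::
  "('n::finite + 'n \<Rightarrow> nat) \<Rightarrow> ('k::field_char_0, 'n) endo set \<Rightarrow> nat" where
  "gamma \<nu> L = (INF U\<in>{U. universal_groebner_basis L U}.
     Sup {d::nat. \<exists>u\<in>U - {\<zero>\<^bsub>weyl\<^esub>}. weyl_deg \<nu> u = ereal (real d)})"

end

theory Submission
  imports Defs "HOL-Library.List_Lexorder"
begin

text \<open>
  Write \<open>A\<close> for \<open>K[X,Y]\<close> and, for a weight \<open>\<omega>\<close>, write \<open>in\<^sub>\<omega>\<close> for the passage to \<open>\<omega>\<close>-leading forms. If \<open>M = W/L\<close>
  carries the filtration induced from \<open>W\<close>, then the annihilator of \<open>G\<^sup>\<omega>M\<close> is the ideal \<open>in\<^sub>\<omega>(L)\<close> of \<open>A\<close>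
  (\<open>annihilator_std_fil\<close>). Up to the choice of filtrations, the two radicals in the definition of
  \<open>\<kappa>\<^sub>\<nu>\<close> are therefore those of \<open>in\<^sub>\<nu>(in\<^sub>\<omega>(L))\<close> and of \<open>in\<^sub>\<tau>(L)\<close> with \<open>\<tau> = \<nu> + s\<omega>\<close>. These two ideals are
  equal as soon as \<open>s\<close> exceeds the \<open>\<nu>\<close>-degrees of a universal Groebner basis \<open>U\<close>
  (\<open>ini_ini_weights\<close>): on the support of an element of \<open>U\<close> the \<open>\<nu>\<close>-degree is a digit in base \<open>s\<close>, so
  \<open>\<tau>\<close>-degrees are compared like pairs of \<open>\<omega>\<close>- and \<open>\<nu>\<close>-degrees, and each \<open>u \<in> U\<close> has the same leading form
  in both procedures; division by \<open>U\<close>, with respect to orderings that refine the weights, shows that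
  these leading forms generate both ideals (\<open>initial_transfer\<close>). A basis \<open>U\<close> that realises
  \<open>\<gamma>\<^sub>\<nu>(L)\<close> exists because there is a universal Groebner basis at all
  (\<open>universal_groebner_basis_exists\<close>).

  The choice of good filtrations is harmless for \<open>G\<^sup>\<omega>M\<close>: two of them differ by a bounded shift of
  degrees, and a high power of an operator that raises degrees by less than its own degree overcomes
  the shift
  (\<open>rad_annihilator_gr_indep\<close>). For \<open>G\<^sup>\<nu>G\<^sup>\<omega>M\<close> this does not suffice, since another filtration of \<open>M\<close>
  changes the module \<open>N = G\<^sup>\<omega>M\<close> itself. Instead, \<open>\<surd>(0 : G\<^sup>\<nu>N)\<close> is shown to equal
  \<open>\<surd>(in\<^sub>\<nu>(0 : N))\<close> (\<open>rad_annihilator_poly_gr\<close>), which depends only on \<open>\<surd>(0 : N)\<close>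
  (\<open>rad_ini_mono\<close>), hence only on \<open>\<surd>(in\<^sub>\<omega>(L))\<close>.

  All computations in \<open>W\<close> go through the linear bijection \<open>Phi\<close> from \<open>A\<close> to \<open>W\<close> given by the basis
  \<open>\<xi>\<^sup>\<lambda>\<partial>\<^sup>\<mu>\<close>. Up to terms whose exponents are smaller by a nonzero vector of the form \<open>(\<rho>|\<rho>)\<close> it turns the
  product of \<open>A\<close> into the product of \<open>W\<close> (\<open>Phi_mult\<close>); such terms are smaller in every normal ordering,
  and of smaller degree for every weight in \<open>\<Omega>\<close>.
\<close>

abbreviation keys where "keys \<equiv> Poly_Mapping.keys"
abbreviation lookup where "lookup \<equiv> Poly_Mapping.lookup"
abbreviation single where "single \<equiv> Poly_Mapping.single"

lemma poly_add_induct: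
  fixes p :: "'a \<Rightarrow>\<^sub>0 'b::comm_monoid_add"
  assumes "\<And>e c. P (single e c)" and "\<And>p q. P p \<Longrightarrow> P q \<Longrightarrow> P (p + q)"
  shows "P p"
proof (induction p rule: Poly_Mapping.update_induct)
  case const
  then show ?case using assms(1)[of _ 0] by simp
next
  case (update f a b)
  have "Poly_Mapping.update a b f = f + single a b"
    using update by (intro poly_mapping_eqI) (auto simp: lookup_update lookup_add lookup_single when_def in_keys_iff)
  then show ?case using update assms by simp
qed

section \<open>Weighted degrees of polynomials\<close>

lemma wdot_zero [simp]: "wdot \<omega> 0 = 0"
  by (simp add: wdot_def)

lemma wdot_add: "wdot \<omega> (e + f) = wdot \<omega> e + wdot \<omega> f"
  by (simp add: wdot_def lookup_add sum.distrib algebra_simps)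

lemma wdot_single [simp]: "wdot \<omega> (single v k) = \<omega> v * k"
proof -
  have "wdot \<omega> (single v k) = (\<Sum>u\<in>UNIV. if u = v then \<omega> v * k else 0)"
    unfolding wdot_def by (intro sum.cong) (auto simp: lookup_single when_def)
  then show ?thesis by simp
qed

lemma wdot_comb: "wdot (\<lambda>i. \<nu> i + s * \<omega> i) e = wdot \<nu> e + s * wdot \<omega> e"
  by (simp add: wdot_def sum.distrib sum_distrib_left algebra_simps)

lemma mem_poly_fil: "p \<in> poly_fil \<omega> i \<longleftrightarrow> (\<forall>e\<in>keys p. int (wdot \<omega> e) \<le> i)"
proof -
  have "ereal (real n) \<le> ereal (real_of_int i) \<longleftrightarrow> int n \<le> i" for n
    by simp linarith
  then show ?thesis by (simp add: poly_fil_def poly_deg_def SUP_le_iff)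
qed

lemma poly_fil_zero [simp]: "0 \<in> poly_fil \<omega> i"
  by (simp add: mem_poly_fil)

lemma poly_fil_add: "p \<in> poly_fil \<omega> i \<Longrightarrow> q \<in> poly_fil \<omega> i \<Longrightarrow> p + q \<in> poly_fil \<omega> i"
  using keys_add[of p q] by (auto simp: mem_poly_fil)

lemma keys_minus' [simp]: "keys (- p) = keys (p :: 'a \<Rightarrow>\<^sub>0 'b::ab_group_add)"
  by (auto simp: in_keys_iff)

lemma keys_diff': "keys (p - q) \<subseteq> keys p \<union> keys (q :: 'a \<Rightarrow>\<^sub>0 'b::ab_group_add)"
  by (auto simp: in_keys_iff lookup_minus)

lemma poly_fil_uminus [simp]: "- p \<in> poly_fil \<omega> i \<longleftrightarrow> p \<in> poly_fil \<omega> i"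
  by (simp add: mem_poly_fil)

lemma poly_fil_diff: "p \<in> poly_fil \<omega> i \<Longrightarrow> q \<in> poly_fil \<omega> i \<Longrightarrow> p - q \<in> poly_fil \<omega> i"
  using keys_diff'[of p q] by (auto simp: mem_poly_fil)

lemma poly_fil_mono: "i \<le> j \<Longrightarrow> poly_fil \<omega> i \<subseteq> poly_fil \<omega> j"
  by (force simp: mem_poly_fil)

lemma poly_fil_mult:
  assumes "p \<in> poly_fil \<omega> i" "q \<in> poly_fil \<omega> j"
  shows "p * q \<in> poly_fil \<omega> (i + j)"
  using assms keys_mult[of p q] unfolding mem_poly_fil
  by (force simp: wdot_add intro: add_mono)

lemma poly_fil_one: "1 \<in> poly_fil \<omega> 0"
  by (simp add: mem_poly_fil)

lemma poly_fil_power: "p \<in> poly_fil \<omega> i \<Longrightarrow> p ^ k \<in> poly_fil \<omega> (int k * i)"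
  by (induction k) (auto simp: poly_fil_one algebra_simps intro: poly_fil_mult[of _ _ i, simplified add.commute])

lemma poly_fil_exhaustive: "\<exists>i. p \<in> poly_fil \<omega> i"
proof
  show "p \<in> poly_fil \<omega> (int (\<Sum>e\<in>keys p. wdot \<omega> e))"
    unfolding mem_poly_fil using member_le_sum[of _ "keys p" "wdot \<omega>"] by (simp del: of_nat_sum)
qed

lemma poly_fil_single: "single e c \<in> poly_fil \<omega> (int (wdot \<omega> e))"
  by (simp add: mem_poly_fil)

definition filter_poly :: "('a \<Rightarrow> bool) \<Rightarrow> ('a \<Rightarrow>\<^sub>0 'b::zero) \<Rightarrow> 'a \<Rightarrow>\<^sub>0 'b" where
  "filter_poly P p = Abs_poly_mapping (\<lambda>e. lookup p e when P e)"

lemma lookup_filter: "lookup (filter_poly P p) e = (lookup p e when P e)"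
proof -
  have "finite {e. (lookup p e when P e) \<noteq> 0}"
    by (rule finite_subset[OF _ finite_keys[of p]]) (auto simp: in_keys_iff)
  then show ?thesis by (simp add: filter_poly_def)
qed

lemma keys_filter [simp]: "keys (filter_poly P p) = {e \<in> keys p. P e}"
  by (auto simp: in_keys_iff lookup_filter)

lemma filter_add: "filter_poly P (p + q) = filter_poly P p + filter_poly P q"
  by (rule poly_mapping_eqI) (simp add: lookup_filter lookup_add when_def)

lemma filter_diff: "filter_poly P (p - q) = filter_poly P p - filter_poly P (q :: 'a \<Rightarrow>\<^sub>0 'b::ab_group_add)"
  by (rule poly_mapping_eqI) (simp add: lookup_filter lookup_minus when_def)

lemma filter_eq_self: "(\<forall>e\<in>keys p. P e) \<Longrightarrow> filter_poly P p = p"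
  by (rule poly_mapping_eqI) (auto simp: lookup_filter when_def in_keys_iff)

lemma filter_eq_0: "(\<forall>e\<in>keys p. \<not> P e) \<Longrightarrow> filter_poly P p = 0"
  by (rule poly_mapping_eqI) (auto simp: lookup_filter when_def in_keys_iff)

lemma filter_single: "filter_poly P (single e c) = (if P e then single e c else 0)"
  by (rule poly_mapping_eqI) (auto simp: lookup_filter when_def lookup_single)

definition hpart :: "('v::finite \<Rightarrow> nat) \<Rightarrow> int \<Rightarrow> ('k::field_char_0, 'v) mpoly \<Rightarrow> ('k, 'v) mpoly" where
  "hpart \<omega> d p = filter_poly (\<lambda>e. int (wdot \<omega> e) = d) p"

lemma keys_hpart [simp]: "keys (hpart \<omega> d p) = {e \<in> keys p. int (wdot \<omega> e) = d}"
  by (simp add: hpart_def)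

lemma hpart_add: "hpart \<omega> d (p + q) = hpart \<omega> d p + hpart \<omega> d q"
  by (simp add: hpart_def filter_add)

lemma hpart_diff: "hpart \<omega> d (p - q) = hpart \<omega> d p - hpart \<omega> d q"
  by (simp add: hpart_def filter_diff)

lemma hpart_zero [simp]: "hpart \<omega> d 0 = 0"
  by (simp add: hpart_def filter_eq_0)

lemma hpart_single: "hpart \<omega> d (single e c) = (if int (wdot \<omega> e) = d then single e c else 0)"
  by (simp add: hpart_def filter_single)

lemma hpart_in_fil: "hpart \<omega> d p \<in> poly_fil \<omega> d"
  by (simp add: mem_poly_fil)

lemma hpart_fil: "p \<in> poly_fil \<omega>' i \<Longrightarrow> hpart \<omega> d p \<in> poly_fil \<omega>' i"
  by (simp add: mem_poly_fil)

lemma hpart_eq_0: "p \<in> poly_fil \<omega> i \<Longrightarrow> i < d \<Longrightarrow> hpart \<omega> d p = 0"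
  unfolding hpart_def by (rule filter_eq_0) (auto simp: mem_poly_fil)

lemma hpart_eq_self: "(\<forall>e\<in>keys p. int (wdot \<omega> e) = d) \<Longrightarrow> hpart \<omega> d p = p"
  unfolding hpart_def by (rule filter_eq_self)

lemma hpart_hpart: "hpart \<omega> d (hpart \<omega> i p) = (if d = i then hpart \<omega> i p else 0)"
  by (auto simp: hpart_def intro!: filter_eq_self filter_eq_0)

lemma diff_hpart_fil: "p \<in> poly_fil \<omega> d \<Longrightarrow> p - hpart \<omega> d p \<in> poly_fil \<omega> (d - 1)"
proof -
  assume p: "p \<in> poly_fil \<omega> d"
  have "keys (p - hpart \<omega> d p) \<subseteq> {e\<in>keys p. int (wdot \<omega> e) \<noteq> d}"
    by (auto simp: in_keys_iff lookup_minus hpart_def lookup_filter when_def split: if_splits)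
  then show ?thesis using p by (force simp: mem_poly_fil)
qed

lemma hpart_mult_single:
  "hpart \<omega> d (single m c * p) = single m c * hpart \<omega> (d - int (wdot \<omega> m)) p"
proof (induction p rule: poly_add_induct)
  case (1 e a)
  then show ?case by (auto simp: mult_single hpart_single wdot_add)
next
  case (2 p q)
  then show ?case by (simp add: hpart_add distrib_left)
qed

lemma hpart_mult_top:
  assumes "p \<in> poly_fil \<omega> i" "q \<in> poly_fil \<omega> j"
  shows "hpart \<omega> (i + j) (p * q) = hpart \<omega> i p * hpart \<omega> j q"
proof -
  let ?p = "hpart \<omega> i p" and ?q = "hpart \<omega> j q"
  have "(p - ?p) * q \<in> poly_fil \<omega> (i - 1 + j)" "?p * (q - ?q) \<in> poly_fil \<omega> (i + (j - 1))"
    by (intro poly_fil_mult assms diff_hpart_fil hpart_in_fil)+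
  then have "hpart \<omega> (i + j) ((p - ?p) * q) = 0" "hpart \<omega> (i + j) (?p * (q - ?q)) = 0"
    by (auto elim!: hpart_eq_0)
  moreover have "p * q = (p - ?p) * q + ?p * (q - ?q) + ?p * ?q"
    by (simp add: algebra_simps)
  moreover have "hpart \<omega> (i + j) (?p * ?q) = ?p * ?q"
    using keys_mult[of ?p ?q] by (intro hpart_eq_self) (force simp: wdot_add)
  ultimately show ?thesis by (metis add_0 hpart_add)
qed

lemma hpart_power:
  assumes "hpart \<omega> d q = q"
  shows "hpart \<omega> (int l * d) (q ^ l) = q ^ l"
proof (induction l)
  case 0
  then show ?case by (simp add: hpart_eq_self)
next
  case (Suc l)
  have q: "q \<in> poly_fil \<omega> d" using hpart_in_fil[of \<omega> d q] assms by simp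
  have "hpart \<omega> (d + int l * d) (q * q ^ l) = hpart \<omega> d q * hpart \<omega> (int l * d) (q ^ l)"
    by (intro hpart_mult_top q poly_fil_power)
  then show ?case using Suc assms by (simp add: algebra_simps)
qed

lemma poly_fil_power_diff:
  assumes "x - p \<in> poly_fil \<omega> (d - 1)" "p \<in> poly_fil \<omega> d"
  shows "x ^ k - p ^ k \<in> poly_fil \<omega> (int k * d - 1)"
proof (induction k)
  case (Suc k)
  have x: "x \<in> poly_fil \<omega> d"
    using poly_fil_add[OF _ assms(2), of "x - p"] assms(1) poly_fil_mono[of "d-1" d \<omega>] by auto
  have "x * (x ^ k - p ^ k) \<in> poly_fil \<omega> (d + (int k * d - 1))"
    "(x - p) * p ^ k \<in> poly_fil \<omega> ((d - 1) + int k * d)"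
    by (intro poly_fil_mult Suc x assms poly_fil_power)+
  then have "x * (x ^ k - p ^ k) + (x - p) * p ^ k \<in> poly_fil \<omega> (int (Suc k) * d - 1)"
    by (intro poly_fil_add) (simp_all add: algebra_simps)
  then show ?case by (simp add: algebra_simps)
qed simp

text \<open>Used with \<open>P\<close> membership in an additively closed set: it suffices to look at homogeneous parts.\<close>

lemma hpart_decomp:
  assumes "P 0" "\<And>x y. P x \<Longrightarrow> P y \<Longrightarrow> P (x + y)" "\<And>d. P (hpart \<omega> d p)"
  shows "P p"
proof -
  let ?D = "(\<lambda>e. int (wdot \<omega> e)) ` keys p"
  have "P (\<Sum>d\<in>D. hpart \<omega> d p)" for D
    by (induction D rule: infinite_finite_induct) (auto intro: assms)
  moreover have "(\<Sum>d\<in>?D. hpart \<omega> d p) = p"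
  proof (rule poly_mapping_eqI)
    fix e
    have "lookup (\<Sum>d\<in>?D. hpart \<omega> d p) e = (\<Sum>d\<in>?D. if int (wdot \<omega> e) = d then lookup p e else 0)"
      unfolding lookup_sum by (intro sum.cong) (auto simp: hpart_def lookup_filter when_def)
    also have "\<dots> = lookup p e"
      by (cases "e \<in> keys p") (auto simp: in_keys_iff)
    finally show "lookup (\<Sum>d\<in>?D. hpart \<omega> d p) e = lookup p e" .
  qed
  ultimately show ?thesis by metis
qed

section \<open>Ideals, radicals and leading forms\<close>

text \<open>
  Ideals as plain sets of polynomials; this is convenient because annihilators, radicals and
  initial ideals are computed with the type class operations.
\<close>

definition poly_ideal :: "('k::field_char_0, 'v) mpoly set \<Rightarrow> bool" where
  "poly_ideal I \<longleftrightarrow> 0 \<in> I \<and> (\<forall>p\<in>I. \<forall>q\<in>I. p + q \<in> I) \<and> (\<forall>p\<in>I. \<forall>q. q * p \<in> I)"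

lemma rad_add:
  assumes I: "poly_ideal I" and "p \<in> rad I" "q \<in> rad I"
  shows "p + q \<in> rad I"
proof -
  obtain a b where ab: "p ^ a \<in> I" "q ^ b \<in> I" using assms by (auto simp: rad_def)
  have t: "of_nat ((a + b) choose k) * p ^ k * q ^ (a + b - k) \<in> I" if "k \<le> a + b" for k
  proof (cases "a \<le> k")
    case True
    then have "p ^ k = p ^ (k - a) * p ^ a" by (simp flip: power_add)
    then have "of_nat ((a + b) choose k) * p ^ k * q ^ (a + b - k) =
        (of_nat ((a + b) choose k) * p ^ (k - a) * q ^ (a + b - k)) * p ^ a"
      by (simp add: algebra_simps)
    then show ?thesis using I ab by (auto simp: poly_ideal_def)
  next
    case False
    then have "q ^ (a + b - k) = q ^ (a - k) * q ^ b" by (simp flip: power_add)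
    then have "of_nat ((a + b) choose k) * p ^ k * q ^ (a + b - k) =
        (of_nat ((a + b) choose k) * p ^ k * q ^ (a - k)) * q ^ b"
      by (simp add: algebra_simps)
    then show ?thesis using I ab by (auto simp: poly_ideal_def)
  qed
  have "sum f A \<in> I" if "\<And>k. k \<in> A \<Longrightarrow> f k \<in> I" for f and A :: "nat set"
    using that I by (induction A rule: infinite_finite_induct) (auto simp: poly_ideal_def)
  then have "(p + q) ^ (a + b) \<in> I" unfolding binomial_ring by (rule) (use t in auto)
  then show ?thesis by (auto simp: rad_def)
qed

lemma rad_power: "p ^ k \<in> rad I \<Longrightarrow> p \<in> rad I"
  by (auto simp: rad_def simp flip: power_mult)

lemma rad_superset: "p \<in> I \<Longrightarrow> p \<in> rad I"
  by (auto simp: rad_def intro: exI[of _ 1])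

text \<open>A polynomial is the sum of its homogeneous parts, and radicals are closed under sums.\<close>

lemma rad_hom:
  assumes "poly_ideal I" "\<And>d. hpart \<omega> d p \<in> rad I"
  shows "p \<in> rad I"
proof (rule hpart_decomp[where P = "\<lambda>p. p \<in> rad I", OF _ _ assms(2)])
  show "0 \<in> rad I" using assms(1) by (auto simp: poly_ideal_def intro: rad_superset)
qed (use assms(1) rad_add in auto)

text \<open>
  For an additive group \<open>J\<close>, these are the sums of \<open>\<omega>\<close>-leading forms of elements of \<open>J\<close>. The definition applies to
  ideals of \<open>A\<close> as well as to the set of coefficient polynomials of a left ideal of \<open>W\<close>.
\<close>

definition ini :: "('v::finite \<Rightarrow> nat) \<Rightarrow> ('k::field_char_0, 'v) mpoly set \<Rightarrow> ('k, 'v) mpoly set" where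
  "ini \<omega> J = {p. \<forall>d. \<exists>x\<in>J. x - hpart \<omega> d p \<in> poly_fil \<omega> (d - 1)}"

lemma ini_homI:
  assumes "0 \<in> J" "x \<in> J" "x - p \<in> poly_fil \<omega> (d - 1)" "hpart \<omega> d p = p"
  shows "p \<in> ini \<omega> J"
proof -
  have "\<exists>y\<in>J. y - hpart \<omega> i p \<in> poly_fil \<omega> (i - 1)" for i
  proof (cases "i = d")
    case False
    then have "hpart \<omega> i p = 0" using assms(4) by (metis hpart_hpart)
    then show ?thesis using assms(1) by force
  qed (use assms in auto)
  then show ?thesis by (simp add: ini_def)
qed

lemma ini_ideal:
  assumes "poly_ideal J"
  shows "poly_ideal (ini \<omega> J)"
proof -
  have add: "p + q \<in> ini \<omega> J" if p: "p \<in> ini \<omega> J" and q: "q \<in> ini \<omega> J" for p q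
  proof -
    have "\<exists>z\<in>J. z - hpart \<omega> d (p + q) \<in> poly_fil \<omega> (d - 1)" for d
    proof -
      obtain x y where xy: "x \<in> J" "y \<in> J" "x - hpart \<omega> d p \<in> poly_fil \<omega> (d - 1)" "y - hpart \<omega> d q \<in> poly_fil \<omega> (d - 1)"
        using p q unfolding ini_def by blast
      show ?thesis
      proof (intro bexI)
        show "x + y - hpart \<omega> d (p + q) \<in> poly_fil \<omega> (d - 1)"
          using poly_fil_add[OF xy(3,4)] by (simp add: hpart_add algebra_simps)
      qed (use assms xy in \<open>auto simp: poly_ideal_def\<close>)
    qed
    then show ?thesis by (simp add: ini_def)
  qed
  have zero: "0 \<in> ini \<omega> J" using assms by (force simp: ini_def poly_ideal_def)
  have "q * p \<in> ini \<omega> J" if p: "p \<in> ini \<omega> J" for p q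
  proof (induction q rule: poly_add_induct)
    case (1 e c)
    have "\<exists>z\<in>J. z - hpart \<omega> d (single e c * p) \<in> poly_fil \<omega> (d - 1)" for d
    proof -
      let ?d = "d - int (wdot \<omega> e)"
      obtain x where x: "x \<in> J" "x - hpart \<omega> ?d p \<in> poly_fil \<omega> (?d - 1)"
        using p unfolding ini_def by blast
      show ?thesis
      proof (intro bexI)
        have "single e c * x - hpart \<omega> d (single e c * p) = single e c * (x - hpart \<omega> ?d p)"
          by (simp only: hpart_mult_single right_diff_distrib)
        then show "single e c * x - hpart \<omega> d (single e c * p) \<in> poly_fil \<omega> (d - 1)"
          using poly_fil_mult[OF poly_fil_single[of e c \<omega>] x(2)] by simp
      qed (use assms x in \<open>auto simp: poly_ideal_def\<close>)
    qed
    then show ?case by (simp add: ini_def)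
  next
    case (2 a b)
    then show ?case by (auto simp: distrib_right intro: add)
  qed
  with add zero show ?thesis by (auto simp: poly_ideal_def)
qed

text \<open>
  If \<open>q\<close> is the leading form of \<open>x \<in> J\<close> and \<open>x ^ l \<in> J0\<close>, then \<open>q ^ l\<close> is the leading form of \<open>x ^ l\<close>. Applied in
  both directions, this shows that \<open>\<surd>(in\<^sub>\<nu>(J))\<close> depends only on \<open>\<surd>J\<close>.
\<close>

lemma rad_ini_mono:
  assumes J: "poly_ideal J" and J0: "poly_ideal J0" and sub: "J \<subseteq> rad J0"
  shows "rad (ini \<nu> J) \<subseteq> rad (ini \<nu> J0)"
proof
  fix p assume "p \<in> rad (ini \<nu> J)"
  then obtain k where k: "p ^ k \<in> ini \<nu> J" by (auto simp: rad_def)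
  have "hpart \<nu> d (p ^ k) \<in> rad (ini \<nu> J0)" for d
  proof -
    let ?q = "hpart \<nu> d (p ^ k)"
    obtain x where x: "x \<in> J" "x - ?q \<in> poly_fil \<nu> (d - 1)" using k unfolding ini_def by blast
    obtain l where l: "x ^ l \<in> J0" using x sub by (auto simp: rad_def)
    have "x ^ l - ?q ^ l \<in> poly_fil \<nu> (int l * d - 1)"
      by (intro poly_fil_power_diff x hpart_in_fil)
    moreover have "hpart \<nu> (int l * d) (?q ^ l) = ?q ^ l" by (rule hpart_power) (simp add: hpart_hpart)
    ultimately have "?q ^ l \<in> ini \<nu> J0"
      using l J0 by (intro ini_homI[of _ "x ^ l"]) (auto simp: poly_ideal_def)
    then show ?thesis by (auto simp: rad_def)
  qed
  then have "p ^ k \<in> rad (ini \<nu> J0)" by (rule rad_hom[OF ini_ideal[OF J0]])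
  then show "p \<in> rad (ini \<nu> J0)" by (rule rad_power)
qed

section \<open>Dickson's lemma\<close>

text \<open>
  One variable at a time, the sequence is thinned out to a subsequence on which all coordinates
  are monotone.
\<close>

lemma dickson_seq:
  fixes e :: "nat \<Rightarrow> 'v::finite expo"
  shows "\<exists>i j h. i < j \<and> e j = e i + h"
proof -
  have "\<exists>g::nat \<Rightarrow> nat. strict_mono g \<and> (\<forall>v\<in>A. mono (\<lambda>i. lookup (e (g i)) v))" if "finite A" for A
    using that
  proof (induction A rule: finite_induct)
    case empty
    show ?case by (auto intro: exI[of _ id] strict_monoI)
  next
    case (insert v A)
    then obtain g :: "nat \<Rightarrow> nat" where g: "strict_mono g" "\<forall>v\<in>A. mono (\<lambda>i. lookup (e (g i)) v)" by blast
    obtain f :: "nat \<Rightarrow> nat" where f: "strict_mono f" "mono (\<lambda>i. lookup (e (g (f i))) v)"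
    proof -
      define s where "s i = lookup (e (g i)) v" for i
      \<comment> \<open>jump each time to a position where \<open>s\<close> is minimal among all later positions\<close>
      have ex: "\<exists>m>n. \<forall>k>n. s m \<le> s k" for n
      proof -
        have "\<exists>m. m > n \<and> (\<forall>k. k > n \<longrightarrow> s m \<le> s k)"
          using ex_has_least_nat[of "\<lambda>m. m > n" "Suc n" s] by auto
        then show ?thesis by blast
      qed
      define nxt where "nxt n = (SOME m. m > n \<and> (\<forall>k>n. s m \<le> s k))" for n
      have nxt: "nxt n > n" "\<And>k. k > n \<Longrightarrow> s (nxt n) \<le> s k" for n
        using someI_ex[OF ex[of n]] unfolding nxt_def by auto
      define f where "f i = (nxt ^^ Suc i) 0" for i
      have fs: "f (Suc i) = nxt (f i)" for i by (simp add: f_def)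
      have sm: "strict_mono f" by (simp add: strict_mono_Suc_iff fs nxt)
      have "s (f i) \<le> s (f (Suc i))" for i
      proof -
        have "f i = nxt ((nxt ^^ i) 0)" "f (Suc i) > (nxt ^^ i) 0"
          using nxt(1)[of "(nxt ^^ i) 0"] nxt(1)[of "f i"] by (auto simp: f_def)
        then show ?thesis using nxt(2) by metis
      qed
      then have "mono (\<lambda>i. s (f i))" by (intro mono_iff_le_Suc[THEN iffD2]) auto
      with sm show ?thesis using that by (auto simp: s_def)
    qed
    have "mono (\<lambda>i. lookup (e (g (f i))) u)" if "u \<in> A" for u
      using g(2) that f(1) by (auto simp: mono_def strict_mono_less_eq)
    then show ?case using g f
      by (intro exI[of _ "g \<circ> f"]) (auto simp: strict_mono_def)
  qed
  from this[of UNIV] obtain g :: "nat \<Rightarrow> nat" where g: "strict_mono g" "\<And>v. mono (\<lambda>i. lookup (e (g i)) v)" by auto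
  have "e (g 1) = e (g 0) + (e (g 1) - e (g 0))"
  proof (rule poly_mapping_eqI)
    fix v
    show "lookup (e (g 1)) v = lookup (e (g 0) + (e (g 1) - e (g 0))) v"
      using monoD[OF g(2)[of v], of 0 1] by (simp add: lookup_add lookup_minus)
  qed
  moreover have "g 0 < g 1" using g(1) by (simp add: strict_mono_def)
  ultimately show ?thesis by blast
qed

section \<open>The basis theorem for the Weyl algebra\<close>

text \<open>Exponents of variables are written with \<open>1\<close>, and should not be rewritten to \<open>Suc 0\<close>.\<close>

declare One_nat_def [simp del]

lemma poly_disj_induct [case_names zero add]:
  fixes p :: "'a \<Rightarrow>\<^sub>0 'b::comm_monoid_add"
  assumes "P 0" and "\<And>p e c. e \<notin> keys p \<Longrightarrow> c \<noteq> 0 \<Longrightarrow> keys (p + single e c) = insert e (keys p) \<Longrightarrow> P p \<Longrightarrow> P (p + single e c)"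
  shows "P p"
proof (induction p rule: Poly_Mapping.update_induct)
  case const
  then show ?case using assms(1) by simp
next
  case (update f a b)
  have eq: "Poly_Mapping.update a b f = f + single a b"
    using update by (intro poly_mapping_eqI) (auto simp: lookup_update lookup_add lookup_single when_def in_keys_iff)
  have "keys (f + single a b) = insert a (keys f)"
    using update keys_update[of a b f] eq by simp
  then show ?case using update assms eq by simp
qed

lemma expo_split:
  fixes e :: "'v expo"
  assumes "lookup e v > 0"
  shows "e = (e - single v 1) + single v 1"
  using assms by (intro poly_mapping_eqI) (auto simp: lookup_add lookup_minus lookup_single when_def)

text \<open>
  Exponents are built up in the order in which \<open>\<xi>\<^sup>\<lambda>\<partial>\<^sup>\<mu>\<close> is composed: in a step for some \<open>\<partial>\<^sub>i\<close> there is no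
  \<open>\<xi>\<close> yet, so that the new operator can be put on the left.
\<close>

lemma sum_expo_induct [case_names zero Y X]:
  fixes e :: "('n::finite + 'n) expo"
  assumes "P 0"
    and Y: "\<And>e i. (\<And>j. lookup e (Inl j) = 0) \<Longrightarrow> P e \<Longrightarrow> P (e + single (Inr i) 1)"
    and X: "\<And>e i. P e \<Longrightarrow> P (e + single (Inl i) 1)"
  shows "P e"
proof (induction "wdot (\<lambda>_. 1) e" arbitrary: e rule: less_induct)
  case less
  have sz: "wdot (\<lambda>_. 1) (e - single v 1) < wdot (\<lambda>_. 1) e" if "lookup e v > 0" for v
    using arg_cong[OF expo_split[OF that], of "wdot (\<lambda>_. 1)"] by (simp add: wdot_add)
  consider i where "lookup e (Inl i) > 0" | i where "\<And>j. lookup e (Inl j) = 0" "lookup e (Inr i) > 0"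
    | "\<And>v. lookup e v = 0"
    by (metis gr0I sum.exhaust)
  then show ?case
  proof cases
    case (1 i)
    then show ?thesis using X[OF less[OF sz[OF 1]], of i] expo_split[OF 1] by simp
  next
    case (2 i)
    have "lookup (e - single (Inr i) 1) (Inl j) = 0" for j
      using 2 by (simp add: lookup_minus)
    then show ?thesis using Y[OF _ less[OF sz[OF 2(2)]], of i] expo_split[OF 2(2)] by simp
  next
    case 3
    then have "e = 0" by (intro poly_mapping_eqI) simp
    then show ?thesis using assms(1) by simp
  qed
qed

definition commuting_powers :: "('n::finite \<Rightarrow> 'a \<Rightarrow> 'a) \<Rightarrow> ('n \<Rightarrow> nat) \<Rightarrow> 'a \<Rightarrow> 'a" where
  "commuting_powers g a = Finite_Set.fold (\<lambda>i f. (g i ^^ a i) \<circ> f) id UNIV"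

lemma commuting_powers_zero: "commuting_powers (g :: 'n::finite \<Rightarrow> 'a \<Rightarrow> 'a) (\<lambda>_. 0) = id"
proof -
  have eq: "(\<lambda>i f. (g i ^^ 0) \<circ> f) = (\<lambda>i f. f)" by (simp add: fun_eq_iff)
  interpret comp_fun_commute_on UNIV "\<lambda>(i::'n) (f::'a \<Rightarrow> 'a). f"
    by unfold_locales auto
  have "Finite_Set.fold (\<lambda>(i::'n) (f::'a \<Rightarrow> 'a). f) id S = id" if "finite S" for S
    using that by (induction S rule: finite_induct) (auto simp: fold_insert)
  then show ?thesis unfolding commuting_powers_def eq by simp
qed

lemma commuting_powers_Suc:
  assumes comm: "\<And>i j. g i \<circ> g j = g j \<circ> g i"
  shows "commuting_powers g (\<lambda>j. a j + (if j = i then 1 else 0)) = g i \<circ> commuting_powers g a"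
proof -
  have c1: "(g i ^^ k) \<circ> g j = g j \<circ> (g i ^^ k)" for i j k
    using comm by (induction k) (auto simp: fun_eq_iff)
  have c2: "(g i ^^ k) \<circ> (g j ^^ l) = (g j ^^ l) \<circ> (g i ^^ k)" for i j k l
    using c1 by (induction l) (auto simp: fun_eq_iff)
  have lc: "comp_fun_commute_on UNIV (\<lambda>i f. (g i ^^ a i) \<circ> f)" for a
    by unfold_locales (use c2 in \<open>auto simp: fun_eq_iff\<close>)
  have split: "commuting_powers g a = (g i ^^ a i) \<circ> Finite_Set.fold (\<lambda>i f. (g i ^^ a i) \<circ> f) id (UNIV - {i})" for a
    unfolding commuting_powers_def by (rule comp_fun_commute_on.fold_rec[OF lc]) auto
  let ?b = "\<lambda>j. a j + (if j = i then 1 else 0)"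
  have "Finite_Set.fold (\<lambda>j f. (g j ^^ ?b j) \<circ> f) id (UNIV - {i}) = Finite_Set.fold (\<lambda>j f. (g j ^^ a j) \<circ> f) id (UNIV - {i})"
    by (rule Finite_Set.fold_cong[OF lc lc]) auto
  then show ?thesis
    unfolding split[of a] split[of ?b] by (simp add: o_assoc One_nat_def)
qed

definition x_expo :: "('n + 'n) expo \<Rightarrow> 'n expo" where "x_expo e = Poly_Mapping.map_key Inl e"
definition y_expo :: "('n + 'n) expo \<Rightarrow> 'n expo" where "y_expo e = Poly_Mapping.map_key Inr e"

lemma lookup_x_expo [simp]: "lookup (x_expo e) i = lookup e (Inl i)"
  by (simp add: x_expo_def map_key.rep_eq)

lemma lookup_y_expo [simp]: "lookup (y_expo e) i = lookup e (Inr i)"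
  by (simp add: y_expo_def map_key.rep_eq)

lemma x_expo_add: "x_expo (e + f) = x_expo e + x_expo f" and y_expo_add: "y_expo (e + f) = y_expo e + y_expo f"
  by (auto intro!: poly_mapping_eqI simp: lookup_add)

lemma x_expo_single: "x_expo (single (Inl i) k) = single i k" "x_expo (single (Inr i) k) = 0"
  and y_expo_single: "y_expo (single (Inl i) k) = 0" "y_expo (single (Inr i) k) = single i k"
  by (auto intro!: poly_mapping_eqI simp: lookup_single when_def)

lemma x_expo_zero [simp]: "x_expo 0 = 0" and y_expo_zero [simp]: "y_expo 0 = 0"
  by (auto intro!: poly_mapping_eqI)

lemma expo_eqI: "x_expo e = x_expo f \<Longrightarrow> y_expo e = y_expo f \<Longrightarrow> e = f"
  by (rule poly_mapping_eqI) (metis lookup_x_expo lookup_y_expo sum.exhaust)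

lemma partial_superset:
  assumes "finite S" "keys p \<subseteq> S"
  shows "partial i p = (\<Sum>m\<in>S. single (m - single i 1) (of_nat (lookup m i) * lookup p m))"
  unfolding partial_def by (rule sum.mono_neutral_left) (use assms in \<open>auto simp: in_keys_iff\<close>)

lemma partial_add: "partial i (p + q) = partial i p + partial i q"
  using keys_add[of p q]
  by (simp add: partial_superset[of "keys p \<union> keys q"] lookup_add distrib_left single_add sum.distrib)

lemma partial_single: "partial i (single m c) = single (m - single i 1) (of_nat (lookup m i) * c)"
  by (simp add: partial_superset[of "{m}"])

lemma partial_zero [simp]: "partial i 0 = 0"
  by (simp add: partial_def)

lemma Const_mult_single [simp]: "Const c * single m a = single m (c * a)"
  by (simp add: Const_def mult_single)

lemma Const_zero [simp]: "Const 0 = 0" and Const_one [simp]: "Const 1 = 1"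
  by (simp_all add: Const_def)

lemma Const_add: "Const (a + b) = Const a + Const b"
  and Const_mult: "Const (a * b) = Const a * Const b"
  by (simp_all add: Const_def single_add mult_single)

lemma partial_scale: "partial i (Const c * p) = Const c * partial i p"
proof (induction p rule: poly_add_induct)
  case (1 e a)
  then show ?case by (simp add: partial_single algebra_simps)
next
  case (2 p q)
  then show ?case by (simp add: partial_add distrib_left)
qed

lemma partial_commute: "partial i \<circ> partial j = (partial j \<circ> partial i :: ('k::field_char_0, 'n) endo)"
proof
  fix p :: "('k, 'n) mpoly"
  show "(partial i \<circ> partial j) p = (partial j \<circ> partial i) p"
  proof (induction p rule: poly_add_induct)
    case (1 e a)
    then show ?case
      by (cases "i = j") (auto simp: partial_single lookup_minus lookup_single when_def algebra_simps diff_diff_eq)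
  next
    case (2 p q)
    then show ?case by (simp add: partial_add)
  qed
qed

lemma xi_commute: "xi i \<circ> xi j = xi j \<circ> xi i"
  by (auto simp: fun_eq_iff xi_def algebra_simps)

definition xi_power :: "('n::finite + 'n) expo \<Rightarrow> ('k::field_char_0, 'n) endo" where
  "xi_power e = commuting_powers xi (\<lambda>i. lookup e (Inl i))"
definition partial_power :: "('n::finite + 'n) expo \<Rightarrow> ('k::field_char_0, 'n) endo" where
  "partial_power e = commuting_powers partial (\<lambda>i. lookup e (Inr i))"

lemma xi_partial_power_simps:
  "xi_power 0 = id" "partial_power 0 = id"
  "xi_power (e + single (Inl i) 1) = xi i \<circ> xi_power e" "xi_power (e + single (Inr i) 1) = xi_power e"
  "partial_power (e + single (Inr i) 1) = partial i \<circ> partial_power e" "partial_power (e + single (Inl i) 1) = partial_power e"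
  using commuting_powers_Suc[of xi, OF xi_commute, of "\<lambda>j. lookup e (Inl j)" i]
    commuting_powers_Suc[of partial, OF partial_commute, of "\<lambda>j. lookup e (Inr j)" i]
  by (simp_all add: xi_power_def partial_power_def commuting_powers_zero lookup_add lookup_single when_def eq_commute cong: if_cong)

lemma xi_power_apply: "xi_power e p = single (x_expo e) 1 * p"
proof (induction e rule: sum_expo_induct)
  case (X e i)
  have "xi_power (e + single (Inl i) 1) p = Var i * (single (x_expo e) 1 * p)"
    by (simp only: xi_partial_power_simps o_apply X xi_def)
  then show ?case by (simp add: x_expo_add x_expo_single Var_def mult_single add.commute flip: mult.assoc)
qed (simp_all only: xi_partial_power_simps x_expo_add x_expo_single, simp_all)

lemma weyl_monom_apply: "weyl_monom e p = single (x_expo e) 1 * partial_power e p"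
  by (simp add: weyl_monom_def xi_power_def[unfolded commuting_powers_def, symmetric] partial_power_def[unfolded commuting_powers_def, symmetric] xi_power_apply)

text \<open>
  The factor \<open>k\<close> is a product of falling factorials. That it vanishes exactly if some
  \<open>\<partial>\<^sub>i\<close> is applied too often is what the linear independence of the monomials rests on.
\<close>

lemma partial_power_single:
  "\<exists>k::nat. (\<forall>c::'k::field_char_0. partial_power e (single m c) = single (m - y_expo e) (of_nat k * c)) \<and> (k \<noteq> 0 \<longleftrightarrow> (\<forall>i. lookup e (Inr i) \<le> lookup m i))"
proof (induction e rule: sum_expo_induct)
  case zero
  then show ?case by (intro exI[of _ 1]) (simp add: xi_partial_power_simps)
next
  case (Y e i)
  then obtain k where k: "\<And>c::'k. partial_power e (single m c) = single (m - y_expo e) (of_nat k * c)"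
    "k \<noteq> 0 \<longleftrightarrow> (\<forall>i. lookup e (Inr i) \<le> lookup m i)" by blast
  show ?case
  proof (intro exI conjI allI)
    fix c :: 'k
    show "partial_power (e + single (Inr i) 1) (single m c) = single (m - y_expo (e + single (Inr i) 1)) (of_nat ((lookup m i - lookup e (Inr i)) * k) * c)"
      by (simp only: xi_partial_power_simps o_apply k partial_single) (simp add: lookup_minus y_expo_add y_expo_single diff_diff_eq ac_simps)
    show "((lookup m i - lookup e (Inr i)) * k \<noteq> 0) = (\<forall>j. lookup (e + single (Inr i) 1) (Inr j) \<le> lookup m j)"
    proof -
      have "(\<forall>j. lookup (e + single (Inr i) 1) (Inr j) \<le> lookup m j) \<longleftrightarrow>
          (\<forall>j. lookup e (Inr j) \<le> lookup m j) \<and> lookup e (Inr i) + 1 \<le> lookup m i" (is "?l \<longleftrightarrow> ?r")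
      proof
        assume l: ?l
        have "lookup e (Inr j) \<le> lookup m j" for j using l[rule_format, of j] by (simp add: lookup_add)
        then show ?r using l[rule_format, of i] by (simp add: lookup_add)
      qed (auto simp: lookup_add lookup_single when_def)
      then show ?thesis using k(2) by auto
    qed
  qed
next
  case (X e i)
  then show ?case by (simp only: xi_partial_power_simps y_expo_add y_expo_single lookup_add) (simp add: lookup_single)
qed

lemma leibniz: "partial i (single a 1 * q) = single a 1 * partial i q + single (a - single i 1) (of_nat (lookup a i)) * q"
proof (induction q rule: poly_add_induct)
  case (1 m c)
  have a: "a - single i 1 + m = a + m - single i 1" if "lookup a i \<noteq> 0"
    using that by (intro poly_mapping_eqI) (auto simp: lookup_add lookup_minus lookup_single when_def)
  have m: "a + (m - single i 1) = a + m - single i 1" if "lookup m i \<noteq> 0"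
    using that by (intro poly_mapping_eqI) (auto simp: lookup_add lookup_minus lookup_single when_def)
  show ?case
    by (cases "lookup a i = 0"; cases "lookup m i = 0")
      (auto simp: partial_single mult_single a m lookup_add distrib_right add.commute[of "of_nat (lookup a i) * c"] simp flip: single_add)
next
  case (2 p q)
  then show ?case by (simp add: partial_add algebra_simps)
qed

text \<open>The operator with prescribed coefficients; \<open>weyl_coeffs\<close> turns out to be its inverse.\<close>

definition Phi :: "('k::field_char_0, 'n::finite + 'n) mpoly \<Rightarrow> ('k, 'n) endo" where
  "Phi c = (\<lambda>p. \<Sum>e\<in>keys c. Const (lookup c e) * weyl_monom e p)"

lemma Phi_superset:
  assumes "finite S" "keys c \<subseteq> S"
  shows "Phi c p = (\<Sum>e\<in>S. Const (lookup c e) * weyl_monom e p)"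
  unfolding Phi_def by (rule sum.mono_neutral_left) (use assms in \<open>auto simp: in_keys_iff\<close>)

lemma Phi_add: "Phi (c + d) p = Phi c p + Phi d p"
  using keys_add[of c d]
  by (simp add: Phi_superset[of "keys c \<union> keys d"] lookup_add Const_add distrib_right sum.distrib)

lemma Phi_zero [simp]: "Phi 0 p = 0"
  by (simp add: Phi_def)

lemma Phi_single: "Phi (single e a) p = Const a * weyl_monom e p"
  by (simp add: Phi_superset[of "{e}"])

lemma Phi_scale: "Phi (Const a * c) p = Const a * Phi c p"
proof (induction c rule: poly_add_induct)
  case (1 e b)
  then show ?case by (simp add: Phi_single Const_mult algebra_simps)
next
  case (2 c d)
  then show ?case by (simp add: Phi_add distrib_left)
qed

lemma Phi_diff: "Phi (c - d) p = Phi c p - Phi d p"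
  using Phi_add[of "c - d" d p] by (simp add: algebra_simps)

text \<open>
  Commuting \<open>\<partial>\<^sub>i\<close> past \<open>\<xi>\<^sub>i\<close> removes both; these are the exponents that arise from \<open>e\<close> by at least one
  such cancellation.
\<close>

definition below :: "('n + 'n) expo \<Rightarrow> ('n + 'n) expo \<Rightarrow> bool" where
  "below g e \<longleftrightarrow> (\<exists>h. h \<noteq> 0 \<and> (\<forall>i. lookup h (Inl i) = lookup h (Inr i)) \<and> e = g + h)"

lemma below_add: "below g e \<Longrightarrow> below (g + f) (e + f)"
  by (auto simp: below_def algebra_simps)

lemma below_trans:
  assumes "below f g" "below g e"
  shows "below f e"
proof -
  obtain h k where hk: "h \<noteq> 0" "\<forall>i. lookup h (Inl i) = lookup h (Inr i)" "g = f + h"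
     "\<forall>i. lookup k (Inl i) = lookup k (Inr i)" "e = g + k"
    using assms by (auto simp: below_def)
  have "h + k \<noteq> 0" 
  proof
    assume "h + k = 0"
    then have "lookup h v + lookup k v = 0" for v by (metis lookup_add lookup_zero)
    then have "h = 0" by (intro poly_mapping_eqI) simp
    with hk(1) show False by simp
  qed
  then show ?thesis unfolding below_def using hk
    by (intro exI[of _ "h + k"]) (simp add: lookup_add add.assoc)
qed

lemma xi_Phi: "xi i (Phi c p) = Phi (single (single (Inl i) 1) 1 * c) p"
proof (induction c rule: poly_add_induct)
  case (1 e b)
  have "xi i (Phi (single e b) p) = Const b * xi i (xi_power e (partial_power e p))"
    by (simp add: Phi_single weyl_monom_apply xi_power_apply xi_def algebra_simps)
  also have "xi i (xi_power e (partial_power e p)) = weyl_monom (e + single (Inl i) 1) p"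
    unfolding weyl_monom_apply xi_power_apply[symmetric] xi_partial_power_simps o_apply ..
  finally show ?case by (simp add: Phi_single mult_single add.commute)
next
  case (2 c d)
  then show ?case by (simp add: Phi_add xi_def distrib_left)
qed

lemma partial_monom:
  "partial i (weyl_monom e p) = weyl_monom (e + single (Inr i) 1) p +
     Const (of_nat (lookup e (Inl i))) * weyl_monom (e - single (Inl i) 1) p"
proof -
  have "partial_power (e - single (Inl i) 1) p = partial_power e p"
    by (simp add: partial_power_def lookup_minus lookup_single)
  moreover have "x_expo (e - single (Inl i) 1) = x_expo e - single i 1"
    by (rule poly_mapping_eqI) (simp add: lookup_minus lookup_single when_def)
  moreover have "partial_power (e + single (Inr i) 1) p = partial i (partial_power e p)" by (simp add: xi_partial_power_simps)
  moreover have "x_expo (e + single (Inr i) 1) = x_expo e" by (simp add: x_expo_add x_expo_single)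
  ultimately show ?thesis
    unfolding weyl_monom_apply leibniz by (simp flip: mult.assoc)
qed

lemma partial_Phi:
  "\<exists>d. (\<forall>p. partial i (Phi c p) = Phi (single (single (Inr i) 1) 1 * c + d) p) \<and>
     (\<forall>g\<in>keys d. \<exists>e\<in>keys c. below g (single (Inr i) 1 + e))"
proof (induction c rule: poly_disj_induct)
  case zero
  then show ?case by (intro exI[of _ 0]) simp
next
  case (add c e b)
  then obtain d where d: "\<And>p. partial i (Phi c p) = Phi (single (single (Inr i) 1) 1 * c + d) p"
     "\<forall>g\<in>keys d. \<exists>e\<in>keys c. below g (single (Inr i) 1 + e)" by blast
  let ?d = "single (e - single (Inl i) 1) (b * of_nat (lookup e (Inl i)))"
  have bel: "below (e - single (Inl i) 1) (single (Inr i) 1 + e)" if "lookup e (Inl i) \<noteq> 0"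
    unfolding below_def
  proof (intro exI conjI allI)
    let ?h = "single (Inl i) 1 + single (Inr i) 1 :: ('a + 'a) expo"
    show "?h \<noteq> 0" by (metis add_is_0 lookup_add lookup_single_eq lookup_zero one_neq_zero)
    show "lookup ?h (Inl j) = lookup ?h (Inr j)" for j by (simp add: lookup_add lookup_single when_def)
    show "single (Inr i) 1 + e = e - single (Inl i) 1 + ?h"
    proof -
      have "e = (e - single (Inl i) 1) + single (Inl i) 1" by (rule expo_split) (use that in simp)
      then show ?thesis by (metis add.assoc add.commute)
    qed
  qed
  have "\<forall>g\<in>keys (d + ?d). \<exists>e'\<in>keys (c + single e b). below g (single (Inr i) 1 + e')"
  proof (intro ballI)
    fix g assume "g \<in> keys (d + ?d)"
    then consider "g \<in> keys d" | "g \<in> keys ?d" using keys_add[of d ?d] by blast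
    then show "\<exists>e'\<in>keys (c + single e b). below g (single (Inr i) 1 + e')"
    proof cases
      case 2
      then have "g = e - single (Inl i) 1" "lookup e (Inl i) \<noteq> 0" by (auto split: if_splits)
      then show ?thesis using bel add(3) by blast
    qed (use d(2) add(3) in blast)
  qed
  moreover have "partial i (Phi (c + single e b) p) = Phi (single (single (Inr i) 1) 1 * (c + single e b) + (d + ?d)) p" for p
  proof -
    have "partial i (Phi (single e b) p) = Phi (single (single (Inr i) 1) 1 * single e b) p + Phi ?d p"
      by (simp only: Phi_single partial_scale partial_monom mult_single Const_mult distrib_left mult.assoc)
        (simp add: add.commute)
    then have "partial i (Phi (c + single e b) p) = Phi (single (single (Inr i) 1) 1 * c + d) p +
        (Phi (single (single (Inr i) 1) 1 * single e b) p + Phi ?d p)"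
      by (simp only: Phi_add partial_add d)
    moreover have "Phi (single (single (Inr i) 1) 1 * (c + single e b) + (d + ?d)) p =
        Phi (single (single (Inr i) 1) 1 * c + d) p + (Phi (single (single (Inr i) 1) 1 * single e b) p + Phi ?d p)"
      unfolding distrib_left Phi_add by (simp only: ac_simps)
    ultimately show ?thesis by (simp only:)
  qed
  ultimately show ?case by blast
qed

lemma monom_Phi:
  "\<exists>d. (\<forall>p. weyl_monom e (Phi c p) = Phi (single e 1 * c + d) p) \<and>
     (\<forall>g\<in>keys d. \<exists>f\<in>keys c. below g (e + f))"
proof (induction e rule: sum_expo_induct)
  case zero
  then show ?case by (intro exI[of _ 0]) (simp add: weyl_monom_apply xi_partial_power_simps)
next
  case (Y e i)
  then obtain d where d: "\<And>p. weyl_monom e (Phi c p) = Phi (single e 1 * c + d) p"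
     "\<forall>g\<in>keys d. \<exists>f\<in>keys c. below g (e + f)" by blast
  let ?i = "single (Inr i) 1 :: ('a + 'a) expo"
  obtain d' where d': "\<And>p. partial i (Phi (single e 1 * c + d) p) = Phi (single ?i 1 * (single e 1 * c + d) + d') p"
     "\<forall>g\<in>keys d'. \<exists>f\<in>keys (single e 1 * c + d). below g (?i + f)"
    using partial_Phi[of i "single e 1 * c + d"] by blast
  have xe: "x_expo e = 0" using Y(1) by (intro poly_mapping_eqI) simp
  have "weyl_monom (e + ?i) p = partial i (weyl_monom e p)" for p :: "('b, 'a) mpoly"
  proof -
    have "partial_power (e + ?i) p = partial i (partial_power e p)" by (simp add: xi_partial_power_simps)
    then show ?thesis by (simp add: weyl_monom_apply xe x_expo_add x_expo_single)
  qed
  then have "weyl_monom (e + ?i) (Phi c p) = Phi (single ?i 1 * (single e 1 * c + d) + d') p" for p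
    by (simp add: d d')
  moreover have "single ?i 1 * (single e 1 * c + d) + d' = single (e + ?i) 1 * c + (single ?i 1 * d + d')"
    by (simp add: distrib_left mult_single add.commute flip: mult.assoc)
  moreover have "\<exists>f\<in>keys c. below g (e + ?i + f)" if g: "g \<in> keys (single ?i 1 * d + d')" for g
  proof -
    have *: "\<exists>f\<in>keys c. below (?i + g') (e + ?i + f)" if "g' \<in> keys d" for g'
    proof -
      obtain f where f: "f \<in> keys c" "below g' (e + f)" using d(2) \<open>g' \<in> keys d\<close> by blast
      then have "below (?i + g') (e + ?i + f)" using below_add[of g' "e + f" ?i] by (simp add: ac_simps)
      then show ?thesis using f(1) by blast
    qed
    consider "g \<in> keys (single ?i 1 * d)" | "g \<in> keys d'" using g keys_add[of "single ?i 1 * d" d'] by blast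
    then show ?thesis
    proof cases
      case 1
      then obtain g' where "g' \<in> keys d" "g = ?i + g'" using keys_mult[of "single ?i (1::'b)" d] by auto
      then show ?thesis using * by simp
    next
      case 2
      then obtain f where f: "f \<in> keys (single e 1 * c + d)" "below g (?i + f)" using d' by blast
      then consider "f \<in> keys (single e 1 * c)" | "f \<in> keys d" using keys_add[of "single e 1 * c" d] by blast
      then show ?thesis
      proof cases
        case 1
        then obtain f' where "f' \<in> keys c" "f = e + f'" using keys_mult[of "single e (1::'b)" c] by auto
        then show ?thesis using f by (auto simp: ac_simps)
      next
        case 2
        then show ?thesis using *[OF 2] f below_trans by blast
      qed
    qed
  qed
  ultimately show ?case by (intro exI[of _ "single ?i 1 * d + d'"]) simp
next
  case (X e i)
  then obtain d where d: "\<And>p. weyl_monom e (Phi c p) = Phi (single e 1 * c + d) p"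
     "\<forall>g\<in>keys d. \<exists>f\<in>keys c. below g (e + f)" by blast
  let ?i = "single (Inl i) 1 :: ('a + 'a) expo"
  have "weyl_monom (e + ?i) p = xi i (weyl_monom e p)" for p :: "('b, 'a) mpoly"
    unfolding weyl_monom_apply xi_power_apply[symmetric] xi_partial_power_simps o_apply ..
  then have "weyl_monom (e + ?i) (Phi c p) = Phi (single ?i 1 * (single e 1 * c + d)) p" for p
    by (simp add: d xi_Phi)
  moreover have "single ?i 1 * (single e 1 * c + d) = single (e + ?i) 1 * c + single ?i 1 * d"
    by (simp add: distrib_left mult_single add.commute flip: mult.assoc)
  moreover have "\<exists>f\<in>keys c. below g (e + ?i + f)" if g: "g \<in> keys (single ?i 1 * d)" for g
  proof -
    obtain g' where "g' \<in> keys d" "g = ?i + g'" using g keys_mult[of "single ?i (1::'b)" d] by auto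
    then obtain f where f: "f \<in> keys c" "below g' (e + f)" using d(2) by blast
    then have "below g (e + ?i + f)" using below_add[of g' "e + f" ?i] \<open>g = _\<close> by (simp add: ac_simps)
    then show ?thesis using f(1) by blast
  qed
  ultimately show ?case by (intro exI[of _ "single ?i 1 * d"]) simp
qed

lemma Phi_mult:
  "\<exists>r. (\<forall>p. Phi c (Phi d p) = Phi (c * d + r) p) \<and>
     (\<forall>g\<in>keys r. \<exists>e\<in>keys c. \<exists>f\<in>keys d. below g (e + f))"
proof (induction c rule: poly_disj_induct)
  case zero
  then show ?case by (intro exI[of _ 0]) simp
next
  case (add c e b)
  then obtain r where r: "\<And>p. Phi c (Phi d p) = Phi (c * d + r) p"
     "\<forall>g\<in>keys r. \<exists>e\<in>keys c. \<exists>f\<in>keys d. below g (e + f)" by blast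
  obtain r' where r': "\<And>p. weyl_monom e (Phi d p) = Phi (single e 1 * d + r') p"
     "\<forall>g\<in>keys r'. \<exists>f\<in>keys d. below g (e + f)" using monom_Phi by blast
  have eq: "Phi (c + single e b) (Phi d p) = Phi ((c + single e b) * d + (r + Const b * r')) p" for p
  proof -
    have "Phi (c + single e b) (Phi d p) = Phi (c * d + r) p + Phi (Const b * (single e 1 * d + r')) p"
      by (simp only: Phi_add[of c] Phi_single r r' Phi_scale)
    also have "\<dots> = Phi ((c * d + r) + Const b * (single e 1 * d + r')) p" by (simp only: Phi_add)
    also have "(c * d + r) + Const b * (single e 1 * d + r') = (c + single e b) * d + (r + Const b * r')"
    proof -
      have "Const b * (single e 1 * d) = single e b * d" by (simp flip: mult.assoc)
      then show ?thesis by (simp only: distrib_left distrib_right add_ac)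
    qed
    finally show ?thesis .
  qed
  moreover have "\<exists>e'\<in>keys (c + single e b). \<exists>f\<in>keys d. below g (e' + f)" if g: "g \<in> keys (r + Const b * r')" for g
  proof -
    consider "g \<in> keys r" | "g \<in> keys (Const b * r')" using g keys_add[of r "Const b * r'"] by blast
    then show ?thesis
    proof cases
      case 2
      then have "g \<in> keys r'" using keys_mult[of "Const b" r'] by (auto simp: Const_def split: if_splits)
      then show ?thesis using r'(2) add(3) by auto
    next
      case 1
      then show ?thesis using r(2) add(3) by auto
    qed
  qed
  ultimately show ?case by (intro exI[of _ "r + Const b * r'"] conjI allI ballI)
qed

text \<open>
  Among the exponents \<open>(\<lambda>|\<mu>)\<close> of \<open>c\<close> choose one with \<open>\<mu>\<close> of least total degree, and apply the operator to
  \<open>X\<^sup>\<mu>\<close>. A term with another \<open>\<mu>\<close> differentiates some variable too often, so only the terms with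
  this \<open>\<mu>\<close> survive, and they give different monomials. The resulting coefficients contain \<open>\<mu>!\<close>, which is
  nonzero in characteristic \<open>0\<close>.
\<close>

lemma Phi_nonzero:
  fixes c :: "('k::field_char_0, 'n::finite + 'n) mpoly"
  assumes "c \<noteq> 0"
  shows "\<exists>p. Phi c p \<noteq> 0"
proof -
  let ?w = "\<lambda>e. wdot (\<lambda>v. case v of Inl _ \<Rightarrow> 0 | Inr _ \<Rightarrow> 1) (e :: ('n + 'n) expo)"
  obtain e0 where e0: "e0 \<in> keys c" "\<And>e. e \<in> keys c \<Longrightarrow> ?w e0 \<le> ?w e"
  proof -
    obtain e where "e \<in> keys c" using assms keys_eq_empty[of c] by blast
    then show thesis using ex_has_least_nat[of "\<lambda>e. e \<in> keys c" e ?w] that by blast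
  qed
  have w: "?w e = (\<Sum>i\<in>UNIV. lookup e (Inr i))" for e
    unfolding wdot_def UNIV_Plus_UNIV[symmetric] by (subst sum.Plus) simp_all
  obtain k where k: "\<And>e c. partial_power e (single (y_expo e0) c) = single (y_expo e0 - y_expo e) (of_nat (k e) * (c::'k))"
    "\<And>e. k e \<noteq> (0::nat) \<longleftrightarrow> (\<forall>i. lookup e (Inr i) \<le> lookup e0 (Inr i))"
  proof -
    have "\<forall>e. \<exists>k::nat. (\<forall>c::'k. partial_power e (single (y_expo e0) c) = single (y_expo e0 - y_expo e) (of_nat k * c)) \<and>
        (k \<noteq> 0 \<longleftrightarrow> (\<forall>i. lookup e (Inr i) \<le> lookup e0 (Inr i)))"
      using partial_power_single[where m = "y_expo e0"] unfolding lookup_y_expo by (rule allI)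
    then have "\<exists>k. \<forall>e. (\<forall>c::'k. partial_power e (single (y_expo e0) c) = single (y_expo e0 - y_expo e) (of_nat (k e) * c)) \<and>
        (k e \<noteq> (0::nat) \<longleftrightarrow> (\<forall>i. lookup e (Inr i) \<le> lookup e0 (Inr i)))"
      by (rule choice)
    then show thesis using that by blast
  qed
  have yeq: "y_expo e = y_expo e0" if "e \<in> keys c" "k e \<noteq> 0" for e
  proof -
    have le: "lookup e (Inr i) \<le> lookup e0 (Inr i)" for i using that k(2) by blast
    have "(\<Sum>i\<in>UNIV. lookup e (Inr i)) = (\<Sum>i\<in>UNIV. lookup e0 (Inr i))"
    proof (rule antisym)
      show "(\<Sum>i\<in>UNIV. lookup e (Inr i)) \<le> (\<Sum>i\<in>UNIV. lookup e0 (Inr i))" by (rule sum_mono) (rule le)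
    qed (use e0(2)[OF that(1)] w in simp)
    then have "lookup e (Inr i) = lookup e0 (Inr i)" for i
      using sum_mono_inv[of "\<lambda>i. lookup e (Inr i)" UNIV "\<lambda>i. lookup e0 (Inr i)"] le by auto
    then show ?thesis by (intro poly_mapping_eqI) simp
  qed
  have "lookup (Phi c (single (y_expo e0) 1)) (x_expo e0) = (\<Sum>e\<in>keys c. if e = e0 then lookup c e * of_nat (k e) else 0)"
    unfolding Phi_def lookup_sum
  proof (rule sum.cong[OF refl])
    fix e assume e: "e \<in> keys c"
    have eq: "Const (lookup c e) * weyl_monom e (single (y_expo e0) 1) =
        single (x_expo e + (y_expo e0 - y_expo e)) (lookup c e * of_nat (k e))"
      by (simp add: weyl_monom_apply k(1) mult_single)
    show "lookup (Const (lookup c e) * weyl_monom e (single (y_expo e0) 1)) (x_expo e0) =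
        (if e = e0 then lookup c e * of_nat (k e) else 0)"
    proof (cases "k e = 0")
      case False
      then show ?thesis using yeq[OF e False] unfolding eq
        by (cases "e = e0") (use expo_eqI[of e e0] in \<open>auto simp: lookup_single when_def\<close>)
    qed (auto simp: eq)
  qed
  also have "\<dots> = lookup c e0 * of_nat (k e0)" using e0(1) by simp
  also have "\<dots> \<noteq> 0" using e0(1) k(2)[of e0] by (simp add: in_keys_iff)
  finally show ?thesis by (metis lookup_zero)
qed

lemma inj_Phi: "inj (Phi :: ('k::field_char_0, 'n::finite + 'n) mpoly \<Rightarrow> ('k, 'n) endo)"
proof (rule injI)
  fix c d :: "('k, 'n + 'n) mpoly"
  assume "Phi c = Phi d"
  then have "Phi (c - d) p = 0" for p by (simp only: Phi_diff diff_self)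
  then have "c - d = 0" using Phi_nonzero by blast
  then show "c = d" by simp
qed

lemma weyl_set_monom: "(weyl_monom e :: ('k::field_char_0, 'n::finite) endo) \<in> weyl_set"
proof -
  have X: "(xi_power e :: ('k, 'n) endo) \<in> weyl_set"
  proof (induction e rule: sum_expo_induct)
    case zero
    show ?case unfolding xi_partial_power_simps by (rule weyl_set.id)
  next
    case (Y e i)
    show ?case unfolding xi_partial_power_simps by (rule Y(2))
  next
    case (X e i)
    show ?case unfolding xi_partial_power_simps by (rule weyl_set.comp[OF weyl_set.xi X])
  qed
  have D: "(partial_power e :: ('k, 'n) endo) \<in> weyl_set"
  proof (induction e rule: sum_expo_induct)
    case zero
    show ?case unfolding xi_partial_power_simps by (rule weyl_set.id)
  next
    case (Y e i)
    show ?case unfolding xi_partial_power_simps by (rule weyl_set.comp[OF weyl_set.partial Y(2)])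
  next
    case (X e i)
    show ?case unfolding xi_partial_power_simps by (rule X)
  qed
  have "(weyl_monom e :: ('k, 'n) endo) = xi_power e \<circ> partial_power e" by (rule ext) (simp only: weyl_monom_apply xi_power_apply o_apply)
  then show ?thesis by (simp only: weyl_set.comp[OF X D])
qed

lemma weyl_set_Phi: "Phi c \<in> weyl_set"
proof (induction c rule: poly_add_induct)
  case (1 e b)
  have "Phi (single e b) = (\<lambda>p. Const b * weyl_monom e p)" by (simp add: fun_eq_iff Phi_single)
  then show ?case using weyl_set.scale[OF weyl_set_monom] by metis
next
  case (2 c d)
  have "Phi (c + d) = (\<lambda>p. Phi c p + Phi d p)" by (simp add: fun_eq_iff Phi_add)
  then show ?case using weyl_set.add[OF 2] by metis
qed

lemma Phi_one: "Phi 1 = id"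
proof
  fix p
  show "Phi 1 p = id p"
    using Phi_single[of 0 1 p] by (simp add: weyl_monom_apply xi_partial_power_simps)
qed

lemma Phi_xi: "Phi (Var (Inl i)) = xi i"
proof
  fix p
  show "Phi (Var (Inl i)) p = xi i p"
    using xi_Phi[of i 1 p] by (simp add: Phi_one Var_def)
qed

lemma Phi_partial: "Phi (Var (Inr i)) = (partial i :: ('k::field_char_0, 'n::finite) endo)"
proof
  fix p :: "('k, 'n) mpoly"
  have "weyl_monom 0 p = p" by (simp add: weyl_monom_apply xi_partial_power_simps)
  then show "Phi (Var (Inr i)) p = partial i p"
    using partial_monom[of i 0 p] by (simp add: Var_def Phi_single)
qed

lemma Phi_Const: "Phi (Const a) = (\<lambda>p. Const a * p)"
proof
  fix p
  show "Phi (Const a) p = Const a * p"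
    using Phi_scale[of a 1 p] by (simp add: Phi_one)
qed

lemma weyl_set_eq: "(weyl_set :: ('k::field_char_0, 'n::finite) endo set) = range Phi"
proof
  show "(weyl_set :: ('k, 'n) endo set) \<subseteq> range Phi"
  proof
    fix w :: "('k, 'n) endo" assume "w \<in> weyl_set"
    then show "w \<in> range Phi"
    proof induction
      case id then show ?case by (metis Phi_one rangeI)
    next
      case (xi i) then show ?case by (metis Phi_xi rangeI)
    next
      case (partial i) then show ?case by (metis Phi_partial rangeI)
    next
      case (add v w)
      then obtain c d where "v = Phi c" "w = Phi d" by auto
      then have "(\<lambda>p. v p + w p) = Phi (c + d)" by (simp add: fun_eq_iff Phi_add)
      then show ?case by simp
    next
      case (comp v w)
      then obtain c d where "v = Phi c" "w = Phi d" by auto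
      then have "\<exists>r. v \<circ> w = Phi (c * d + r)" using Phi_mult[of c d] by (auto simp: fun_eq_iff)
      then show ?case by (metis rangeI)
    next
      case (scale w a)
      then obtain c where "w = Phi c" by auto
      then have "(\<lambda>p. Const a * w p) = Phi (Const a * c)" by (simp add: fun_eq_iff Phi_scale)
      then show ?case by simp
    qed
  qed
qed (auto simp: weyl_set_Phi)

lemma weyl_coeffs_Phi [simp]: "weyl_coeffs (Phi c) = (c :: ('k::field_char_0, 'n::finite + 'n) mpoly)"
proof -
  have "weyl_coeffs (Phi c) = (THE d :: ('k, 'n + 'n) mpoly. Phi c = Phi d)"
    unfolding weyl_coeffs_def Phi_def ..
  also have "\<dots> = c" using injD[OF inj_Phi] by (intro the_equality) auto
  finally show ?thesis .
qed

lemma weyl_fil_eq: "(weyl_fil \<omega> i :: ('k::field_char_0, 'n::finite) endo set) = Phi ` poly_fil \<omega> i"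
proof -
  have "weyl_deg \<omega> (Phi c) = poly_deg \<omega> c" for c :: "('k, 'n + 'n) mpoly"
    by (simp add: weyl_deg_def poly_deg_def supp_def)
  then show ?thesis unfolding weyl_fil_def poly_fil_def weyl_def by (auto simp: weyl_set_eq)
qed

lemma endo_additive: "w \<in> weyl_set \<Longrightarrow> w (p + q) = w p + w q"
proof (induction w arbitrary: p q rule: weyl_set.induct)
  case (add v w)
  show ?case by (simp only: add.IH ac_simps)
next
  case (comp v w)
  show ?case by (simp only: comp.IH o_apply)
next
  case (scale w c)
  show ?case by (simp only: scale.IH distrib_left)
qed (simp_all add: xi_def partial_add distrib_left)

lemma weyl_simps [simp]:
  "carrier weyl = weyl_set" "v \<otimes>\<^bsub>weyl\<^esub> w = v \<circ> w" "\<one>\<^bsub>weyl\<^esub> = id" "\<zero>\<^bsub>weyl\<^esub> = (\<lambda>_. 0)"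
  "v \<oplus>\<^bsub>weyl\<^esub> w = (\<lambda>p. v p + w p)"
  by (simp_all add: weyl_def)

lemma ring_weyl: "ring (weyl :: ('k::field_char_0, 'n::finite) endo ring)"
proof (rule ringI)
  show "abelian_group (weyl :: ('k, 'n) endo ring)"
  proof (rule abelian_groupI)
    fix w :: "('k, 'n) endo" assume w: "w \<in> carrier weyl"
    have "(\<lambda>p. Const (-1) * w p) \<in> weyl_set" by (rule weyl_set.scale) (use w in simp)
    moreover have "Const (-1) * w p + w p = 0" for p
    proof -
      have "Const (-1) * w p + w p = Const (-1 + 1) * w p" by (simp only: Const_add Const_one distrib_right mult_1)
      then show ?thesis by simp
    qed
    ultimately show "\<exists>v\<in>carrier weyl. v \<oplus>\<^bsub>weyl\<^esub> w = \<zero>\<^bsub>weyl\<^esub>"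
      by (intro bexI[of _ "\<lambda>p. Const (-1) * w p"]) simp_all
  next
    have "(\<lambda>p::('k,'n) mpoly. Const 0 * id p) \<in> weyl_set" by (rule weyl_set.scale[OF weyl_set.id])
    then show "\<zero>\<^bsub>weyl\<^esub> \<in> carrier (weyl :: ('k, 'n) endo ring)" by simp
  qed (simp_all add: weyl_set.add add_ac)
  show "monoid (weyl :: ('k, 'n) endo ring)"
    by (rule monoidI) (simp_all add: weyl_set.comp weyl_set.id o_assoc)
qed (simp_all add: endo_additive fun_eq_iff)

section \<open>Associated graded groups and their products\<close>

text \<open>
  The products on associated graded objects are defined as unions over all representatives. The
  point of this part is to replace them by formulas in one chosen family of representatives.
\<close>

locale filtered_group = M: abelian_group M for M :: "('m, 'z) ring_scheme" (structure) +
  fixes F :: "int \<Rightarrow> 'm set"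
  assumes sub: "additive_subgroup (F i) M"
    and F_mono: "i \<le> j \<Longrightarrow> F i \<subseteq> F j"
begin

abbreviation cls :: "int \<Rightarrow> 'm \<Rightarrow> 'm set" where "cls i u \<equiv> F (i - 1) +> u"

lemma absub: "abelian_subgroup (F i) M"
  using sub M.abelian_group_axioms by (rule abelian_subgroupI3)

lemma F_carrier: "u \<in> F i \<Longrightarrow> u \<in> carrier M"
  using additive_subgroup.a_subset[OF sub] by blast

lemma F_add: "u \<in> F i \<Longrightarrow> v \<in> F i \<Longrightarrow> u \<oplus> v \<in> F i"
  using additive_subgroup.a_closed[OF sub] by blast

lemma F_zero: "\<zero> \<in> F i"
  using additive_subgroup.zero_closed[OF sub] by blast

lemma F_uminus: "u \<in> F i \<Longrightarrow> \<ominus> u \<in> F i"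
  using additive_subgroup.a_inv_closed[OF sub] M.abelian_group_axioms by blast

lemma F_pred: "u \<in> F (i - 1) \<Longrightarrow> u \<in> F i"
  using F_mono[of "i - 1" i] by auto

lemma cls_self: "u \<in> carrier M \<Longrightarrow> u \<in> cls i u"
  using abelian_subgroup.a_rcos_self[OF absub] by blast

lemma mem_cls: "v \<in> cls i u \<Longrightarrow> \<exists>h\<in>F (i - 1). v = h \<oplus> u"
  by (simp add: a_r_coset_def')

lemma cls_add: "u \<in> carrier M \<Longrightarrow> v \<in> carrier M \<Longrightarrow> cls i u <+> cls i v = cls i (u \<oplus> v)"
  using abelian_subgroup.a_rcos_sum[OF absub] by blast

lemma cls_zero: "h \<in> F (i - 1) \<Longrightarrow> cls i h = F (i - 1)"
  using additive_subgroup.a_subgroup[OF sub] F_carrier by (intro M.a_coset_join2) auto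

lemma cls_zero_iff: "u \<in> carrier M \<Longrightarrow> cls i u = F (i - 1) \<longleftrightarrow> u \<in> F (i - 1)"
  using cls_zero cls_self by blast

lemma cls_absorb: "h \<in> F (i - 1) \<Longrightarrow> u \<in> carrier M \<Longrightarrow> cls i (h \<oplus> u) = cls i u"
  using cls_add[of h u i] cls_add[of \<zero> u i] cls_zero[of h i] cls_zero[OF F_zero] F_carrier[of h]
  by simp

lemma finsum_F:
  assumes "finite I" "\<And>i. i \<in> I \<Longrightarrow> s i \<in> F k"
  shows "(\<Oplus>i\<in>I. s i) \<in> F k"
  using assms
proof (induction I rule: finite_induct)
  case empty
  then show ?case by (simp add: F_zero)
next
  case (insert x I)
  then have "(\<Oplus>i\<in>insert x I. s i) = s x \<oplus> (\<Oplus>i\<in>I. s i)"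
    by (intro M.finsum_insert) (auto intro: F_carrier)
  then show ?case using insert F_add by simp
qed

lemma finsum_cls:
  assumes "finite I" "\<And>i. i \<in> I \<Longrightarrow> s i \<in> carrier M" "\<And>i. i \<in> I \<Longrightarrow> t i \<in> carrier M"
    "\<And>i. i \<in> I \<Longrightarrow> cls k (s i) = cls k (t i)"
  shows "cls k (\<Oplus>i\<in>I. s i) = cls k (\<Oplus>i\<in>I. t i)"
  using assms
proof (induction I rule: finite_induct)
  case (insert x I)
  have "(\<Oplus>i\<in>insert x I. s i) = s x \<oplus> (\<Oplus>i\<in>I. s i)" "(\<Oplus>i\<in>insert x I. t i) = t x \<oplus> (\<Oplus>i\<in>I. t i)"
    using insert by (auto intro!: M.finsum_insert)
  moreover have "(\<Oplus>i\<in>I. s i) \<in> carrier M" "(\<Oplus>i\<in>I. t i) \<in> carrier M"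
    using insert by (auto intro!: M.finsum_closed)
  ultimately show ?case using insert cls_add[of "s x" "\<Oplus>i\<in>I. s i"] cls_add[of "t x" "\<Oplus>i\<in>I. t i"]
    by (metis insertCI)
qed simp

text \<open>\<open>u\<close> is a family of representatives for the element \<open>x\<close> of the associated graded group.\<close>

definition gr_rep :: "(int \<Rightarrow> 'm set) \<Rightarrow> (int \<Rightarrow> 'm) \<Rightarrow> bool" where
  "gr_rep x u \<longleftrightarrow> (\<forall>i. u i \<in> F i) \<and> x = (\<lambda>i. cls i (u i)) \<and> finite {i. u i \<notin> F (i - 1)}"

lemma gr_carrier_iff: "x \<in> gr_carrier M F \<longleftrightarrow> (\<exists>u. gr_rep x u)"
proof
  assume x: "x \<in> gr_carrier M F"
  then have "\<forall>i. \<exists>u. u \<in> F i \<and> x i = cls i u" by (fastforce simp: gr_carrier_def)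
  then obtain u where u: "\<And>i. u i \<in> F i \<and> x i = cls i (u i)" by metis
  have "{i. u i \<notin> F (i - 1)} = {i. x i \<noteq> F (i - 1)}"
    using u cls_zero_iff F_carrier by metis
  then have "finite {i. u i \<notin> F (i - 1)}" using x by (simp add: gr_carrier_def)
  then have "gr_rep x u" unfolding gr_rep_def using u by auto
  then show "\<exists>u. gr_rep x u" by blast
next
  assume "\<exists>u. gr_rep x u"
  then obtain u where u: "gr_rep x u" ..
  have "{i. x i \<noteq> F (i - 1)} \<subseteq> {i. u i \<notin> F (i - 1)}"
    using u cls_zero unfolding gr_rep_def by blast
  then show "x \<in> gr_carrier M F"
    using u finite_subset unfolding gr_rep_def gr_carrier_def by blast
qed

lemma gr_rep_F: "gr_rep x u \<Longrightarrow> u i \<in> F i"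
  by (simp add: gr_rep_def)

lemma gr_rep_carrier: "gr_rep x u \<Longrightarrow> u i \<in> carrier M"
  using gr_rep_F F_carrier by blast

lemma gr_rep_add:
  assumes "gr_rep x u" "gr_rep y v"
  shows "gr_rep (\<lambda>i. x i <+> y i) (\<lambda>i. u i \<oplus> v i)"
  unfolding gr_rep_def
proof (intro conjI allI)
  show "(\<lambda>i. x i <+> y i) = (\<lambda>i. cls i (u i \<oplus> v i))"
  proof
    fix i
    have "x i = cls i (u i)" "y i = cls i (v i)" using assms by (auto simp: gr_rep_def)
    then show "x i <+> y i = cls i (u i \<oplus> v i)"
      using cls_add gr_rep_carrier[OF assms(1)] gr_rep_carrier[OF assms(2)] by simp
  qed
  show "u i \<oplus> v i \<in> F i" for i using assms F_add by (simp add: gr_rep_def)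
  have "{i. u i \<oplus> v i \<notin> F (i - 1)} \<subseteq> {i. u i \<notin> F (i - 1)} \<union> {i. v i \<notin> F (i - 1)}"
    using F_add by blast
  then show "finite {i. u i \<oplus> v i \<notin> F (i - 1)}"
    using assms unfolding gr_rep_def by (metis (no_types, lifting) finite_UnI finite_subset)
qed

lemma gr_rep_zero: "gr_rep (\<lambda>i. F (i - 1)) (\<lambda>i. \<zero>)"
  by (simp add: gr_rep_def F_zero cls_zero)

lemma gr_rep_class: "a \<in> F d \<Longrightarrow> gr_rep (gr_class M F d a) (\<lambda>i. if i = d then a else \<zero>)"
proof -
  assume a: "a \<in> F d"
  have "{i. (if i = d then a else \<zero>) \<notin> F (i - 1)} \<subseteq> {d}" by (auto simp: F_zero split: if_splits)
  then have "finite {i. (if i = d then a else \<zero>) \<notin> F (i - 1)}" using finite_subset by blast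
  then show ?thesis using a by (auto simp: gr_rep_def gr_class_def F_zero cls_zero fun_eq_iff)
qed

lemma gr_rep_uminus: "gr_rep x u \<Longrightarrow> gr_rep (\<lambda>i. cls i (\<ominus> u i)) (\<lambda>i. \<ominus> u i)"
proof -
  assume u: "gr_rep x u"
  have "{i. \<ominus> u i \<notin> F (i - 1)} \<subseteq> {i. u i \<notin> F (i - 1)}" using F_uminus by blast
  then show ?thesis using u F_uminus finite_subset by (auto simp: gr_rep_def)
qed

lemma gr_eqI:
  assumes "gr_rep x u" "gr_rep y v" "\<And>i. u i = v i"
  shows "x = y"
  using assms by (auto simp: gr_rep_def)

lemma gr_abelian_group:
  fixes G :: "(int \<Rightarrow> 'm set, 'y) ring_scheme"
  assumes G: "carrier G = gr_carrier M F" "add G = (\<lambda>x y i. x i <+> y i)" "zero G = (\<lambda>i. F (i - 1))"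
  shows "abelian_group G"
proof (rule abelian_groupI)
  fix x y z assume "x \<in> carrier G" "y \<in> carrier G" "z \<in> carrier G"
  then obtain u v w where u: "gr_rep x u" "gr_rep y v" "gr_rep z w" by (auto simp: G gr_carrier_iff)
  show "x \<oplus>\<^bsub>G\<^esub> y \<oplus>\<^bsub>G\<^esub> z = x \<oplus>\<^bsub>G\<^esub> (y \<oplus>\<^bsub>G\<^esub> z)"
    
    unfolding G by (rule gr_eqI[OF gr_rep_add[OF gr_rep_add[OF u(1,2)] u(3)] gr_rep_add[OF u(1) gr_rep_add[OF u(2,3)]]])
      (use gr_rep_carrier[OF u(1)] gr_rep_carrier[OF u(2)] gr_rep_carrier[OF u(3)] in \<open>simp add: M.a_assoc\<close>)
  show "x \<oplus>\<^bsub>G\<^esub> y = y \<oplus>\<^bsub>G\<^esub> x"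
    
    unfolding G by (rule gr_eqI[OF gr_rep_add[OF u(1,2)] gr_rep_add[OF u(2,1)]])
      (use gr_rep_carrier[OF u(1)] gr_rep_carrier[OF u(2)] in \<open>simp add: M.a_comm\<close>)
  show "\<zero>\<^bsub>G\<^esub> \<oplus>\<^bsub>G\<^esub> x = x"
    
    unfolding G by (rule gr_eqI[OF gr_rep_add[OF gr_rep_zero u(1)] u(1)])
      (use gr_rep_carrier[OF u(1)] in \<open>simp\<close>)
  show "x \<oplus>\<^bsub>G\<^esub> y \<in> carrier G"
    unfolding G gr_carrier_iff using gr_rep_add[OF u(1,2)] by blast
  have "(\<lambda>i. cls i (\<ominus> u i)) \<oplus>\<^bsub>G\<^esub> x = \<zero>\<^bsub>G\<^esub>"
    
    unfolding G by (rule gr_eqI[OF gr_rep_add[OF gr_rep_uminus[OF u(1)] u(1)] gr_rep_zero])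
      (use gr_rep_carrier[OF u(1)] in \<open>simp add: M.l_neg\<close>)
  moreover have "(\<lambda>i. cls i (\<ominus> u i)) \<in> carrier G"
    unfolding G gr_carrier_iff by (rule exI, rule gr_rep_uminus[OF u(1)])
  ultimately show "\<exists>y\<in>carrier G. y \<oplus>\<^bsub>G\<^esub> x = \<zero>\<^bsub>G\<^esub>" by (rule bexI)
next
  show "\<zero>\<^bsub>G\<^esub> \<in> carrier G" unfolding G gr_carrier_iff using gr_rep_zero by blast
qed

end

text \<open>Covers both the multiplication of a filtered ring and the action of the ring on a filtered module.\<close>

locale graded_action = R: filtered_group R FR + M: filtered_group M F
  for R :: "('r, 'x) ring_scheme" and FR and M :: "('m, 'z) ring_scheme" (structure) and F +
  fixes f :: "'r \<Rightarrow> 'm \<Rightarrow> 'm"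
  assumes f_closed: "a \<in> carrier R \<Longrightarrow> b \<in> carrier M \<Longrightarrow> f a b \<in> carrier M"
    and f_add_l: "a \<in> carrier R \<Longrightarrow> a' \<in> carrier R \<Longrightarrow> b \<in> carrier M \<Longrightarrow> f (a \<oplus>\<^bsub>R\<^esub> a') b = f a b \<oplus> f a' b"
    and f_add_r: "a \<in> carrier R \<Longrightarrow> b \<in> carrier M \<Longrightarrow> b' \<in> carrier M \<Longrightarrow> f a (b \<oplus> b') = f a b \<oplus> f a b'"
    and f_fil: "a \<in> FR i \<Longrightarrow> b \<in> F j \<Longrightarrow> f a b \<in> F (i + j)"
begin

lemma f_fil': "a \<in> FR i \<Longrightarrow> b \<in> F (k - i) \<Longrightarrow> f a b \<in> F k"
  using f_fil[of a i b "k - i"] by simp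

lemma f_zero_r: "a \<in> carrier R \<Longrightarrow> f a \<zero> = \<zero>"
proof -
  assume a: "a \<in> carrier R"
  then have "f a \<zero> \<oplus> f a \<zero> = f a \<zero>" using f_add_r[of a "\<zero>" "\<zero>"] by simp
  then show ?thesis using f_closed[OF a, of "\<zero>"] by (metis M.M.add.r_cancel_one' M.M.zero_closed)
qed

lemma f_cls:
  assumes "a \<in> FR i" "b \<in> F (k - i)" "a' \<in> R.cls i a" "b' \<in> M.cls (k - i) b"
  shows "M.cls k (f a' b') = M.cls k (f a b)" "f a' b' \<in> F k"
proof -
  obtain g h where gh: "g \<in> FR (i - 1)" "a' = g \<oplus>\<^bsub>R\<^esub> a" "h \<in> F (k - i - 1)" "b' = h \<oplus> b"
    using assms R.mem_cls M.mem_cls by meson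
  have c: "g \<in> carrier R" "a \<in> carrier R" "a' \<in> carrier R" "h \<in> carrier M" "b \<in> carrier M" "b' \<in> carrier M"
    using gh assms R.F_carrier M.F_carrier by auto
  have F: "a' \<in> FR i" "b' \<in> F (k - i)"
    using gh assms R.F_add M.F_add R.F_pred M.F_pred by auto
  then show "f a' b' \<in> F k" by (rule f_fil')
  have 1: "f g b' \<in> F (k - 1)" using f_fil[OF gh(1) F(2)] by (simp add: algebra_simps)
  have 2: "f a h \<in> F (k - 1)" using f_fil[OF assms(1) gh(3)] by (simp add: algebra_simps)
  have "f a' b' = f g b' \<oplus> (f a h \<oplus> f a b)"
    using f_add_l[OF c(1,2,6)] f_add_r[OF c(2,4,5)] unfolding gh(2) gh(4) by simp
  then show "M.cls k (f a' b') = M.cls k (f a b)"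
    using M.cls_absorb[OF 1] M.cls_absorb[OF 2] c f_closed by simp
qed

text \<open>
  All choices of representatives give the same coset, and the index set of the sum may be enlarged,
  because the additional summands lie in \<open>F (k - 1)\<close>.
\<close>

lemma gr_prod_eval:
  assumes x: "R.gr_rep x a" and y: "M.gr_rep y b" and I: "finite I" "{i. a i \<notin> FR (i - 1)} \<subseteq> I"
  shows "gr_prod FR M F f x y k = M.cls k (\<Oplus>i\<in>I. f (a i) (b (k - i)))"
proof -
  have aF: "a i \<in> FR i" and xi: "x i = R.cls i (a i)" for i using x by (auto simp: R.gr_rep_def)
  have bF: "b i \<in> F i" and yi: "y i = M.cls i (b i)" for i using y by (auto simp: M.gr_rep_def)
  have I0: "{i. x i \<noteq> FR (i - 1)} = {i. a i \<notin> FR (i - 1)}" (is "?I = _")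
    using R.cls_zero_iff R.F_carrier[OF aF] by (simp add: xi)
  have eq: "M.cls k (\<Oplus>i\<in>?I. f (a' i) (b' (k - i))) = M.cls k (\<Oplus>i\<in>I. f (a i) (b (k - i)))"
    if a': "a' \<in> Pi UNIV x" and b': "b' \<in> Pi UNIV y" for a' b'
  proof -
    have a'c: "a' i \<in> R.cls i (a i)" and b'c: "b' i \<in> M.cls i (b i)" for i using a' b' xi yi by (auto simp: Pi_def)
    note fc = f_cls[OF aF bF a'c b'c]
    let ?t = "\<lambda>i. if i \<in> ?I then f (a' i) (b' (k - i)) else \<zero>"
    have "(\<Oplus>i\<in>?I. f (a' i) (b' (k - i))) = (\<Oplus>i\<in>I. ?t i)"
    proof (rule M.M.add.finprod_mono_neutral_cong_left)
      show "?t \<in> I \<rightarrow> carrier M" using M.F_carrier[OF fc(2)] by simp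
      show "?I \<subseteq> I" using I I0 by simp
    qed (use I in simp_all)
    moreover have "M.cls k (\<Oplus>i\<in>I. ?t i) = M.cls k (\<Oplus>i\<in>I. f (a i) (b (k - i)))"
    proof (rule M.finsum_cls[OF I(1)])
      fix i
      have fF: "f (a i) (b (k - i)) \<in> F k" using f_fil'[OF aF bF] .
      then show "f (a i) (b (k - i)) \<in> carrier M" by (rule M.F_carrier)
      show "?t i \<in> carrier M" using M.F_carrier[OF fc(2)] by simp
      show "M.cls k (?t i) = M.cls k (f (a i) (b (k - i)))"
      proof (cases "i \<in> ?I")
        case True
        then show ?thesis using fc(1) by simp
      next
        case False
        then have "a i \<in> FR (i - 1)" using I0 by blast
        then have "f (a i) (b (k - i)) \<in> F (k - 1)"
          using f_fil[OF _ bF, of "a i" "i - 1" "k - i"] by (simp add: algebra_simps)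
        then show ?thesis using M.cls_zero M.F_zero False by simp
      qed
    qed
    ultimately show ?thesis by simp
  qed
  have ne: "a \<in> Pi UNIV x" "b \<in> Pi UNIV y"
    using R.cls_self[OF R.F_carrier[OF aF]] M.cls_self[OF M.F_carrier[OF bF]] xi yi by auto
  have "gr_prod FR M F f x y k = (\<Union>a'\<in>Pi UNIV x. \<Union>b'\<in>Pi UNIV y. M.cls k (\<Oplus>i\<in>I. f (a i) (b (k - i))))"
    unfolding gr_prod_def by (intro SUP_cong refl eq)
  then show ?thesis using ne by auto
qed

lemma gr_prod_rep:
  assumes x: "R.gr_rep x a" and y: "M.gr_rep y b" and I: "finite I" "{i. a i \<notin> FR (i - 1)} \<subseteq> I"
  shows "M.gr_rep (gr_prod FR M F f x y) (\<lambda>k. \<Oplus>i\<in>I. f (a i) (b (k - i)))"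
  unfolding M.gr_rep_def
proof (intro conjI allI ext)
  have aF: "a i \<in> FR i" for i using x by (auto simp: R.gr_rep_def)
  have bF: "b i \<in> F i" for i using y by (auto simp: M.gr_rep_def)
  show "(\<Oplus>i\<in>I. f (a i) (b (k - i))) \<in> F k" for k
    using I f_fil'[OF aF bF] by (intro M.finsum_F)
  show "gr_prod FR M F f x y k = M.cls k (\<Oplus>i\<in>I. f (a i) (b (k - i)))" for k
    by (rule gr_prod_eval[OF assms])
  let ?S = "(\<lambda>(i, j). i + j) ` (I \<times> {j. b j \<notin> F (j - 1)})"
  have "{k. (\<Oplus>i\<in>I. f (a i) (b (k - i))) \<notin> F (k - 1)} \<subseteq> ?S"
  proof
    fix k assume "k \<in> {k. (\<Oplus>i\<in>I. f (a i) (b (k - i))) \<notin> F (k - 1)}"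
    then obtain i where i: "i \<in> I" "f (a i) (b (k - i)) \<notin> F (k - 1)" 
      using M.finsum_F[OF I(1), of "\<lambda>i. f (a i) (b (k - i))" "k - 1"] by auto
    have "b (k - i) \<notin> F (k - i - 1)"
    proof
      assume "b (k - i) \<in> F (k - i - 1)"
      then have "b (k - i) \<in> F (k - 1 - i)" by (simp only: diff_right_commute)
      then show False using f_fil'[OF aF] i by blast
    qed
    then show "k \<in> ?S" using i by (intro image_eqI[of _ _ "(i, k - i)"]) auto
  qed
  moreover have "finite ?S" using I y by (auto simp: M.gr_rep_def)
  ultimately show "finite {k. (\<Oplus>i\<in>I. f (a i) (b (k - i))) \<notin> F (k - 1)}" using finite_subset by blast
qed

lemma gr_prod_class:
  assumes a: "a \<in> FR d" and y: "M.gr_rep y b"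
  shows "M.gr_rep (gr_prod FR M F f (gr_class R FR d a) y) (\<lambda>k. f a (b (k - d)))"
proof -
  have "{i. (if i = d then a else \<zero>\<^bsub>R\<^esub>) \<notin> FR (i - 1)} \<subseteq> {d}" by (auto simp: R.F_zero split: if_splits)
  from gr_prod_rep[OF R.gr_rep_class[OF a] y _ this]
  have "M.gr_rep (gr_prod FR M F f (gr_class R FR d a) y) (\<lambda>k. \<Oplus>i\<in>{d}. f (if i = d then a else \<zero>\<^bsub>R\<^esub>) (b (k - i)))" by simp
  moreover have "(\<Oplus>i\<in>{d}. f (if i = d then a else \<zero>\<^bsub>R\<^esub>) (b (k - i))) = f a (b (k - d))" for k
    using f_closed[OF R.F_carrier[OF a] M.gr_rep_carrier[OF y]] by (simp add: M.M.finsum_insert)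
  ultimately show ?thesis by simp
qed

lemma gr_prod_add_l:
  assumes "x \<in> gr_carrier R FR" "x' \<in> gr_carrier R FR" "y \<in> gr_carrier M F"
  shows "gr_prod FR M F f (\<lambda>i. x i <+>\<^bsub>R\<^esub> x' i) y =
    (\<lambda>i. gr_prod FR M F f x y i <+> gr_prod FR M F f x' y i)"
proof -
  obtain a a' b where r: "R.gr_rep x a" "R.gr_rep x' a'" "M.gr_rep y b"
    using assms by (auto simp: R.gr_carrier_iff M.gr_carrier_iff)
  let ?I = "{i. a i \<notin> FR (i - 1)} \<union> {i. a' i \<notin> FR (i - 1)}"
  have I: "finite ?I" using r by (auto simp: R.gr_rep_def)
  have I': "{i. a i \<oplus>\<^bsub>R\<^esub> a' i \<notin> FR (i - 1)} \<subseteq> ?I" using R.F_add by blast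
  note c = R.gr_rep_carrier[OF r(1)] R.gr_rep_carrier[OF r(2)] M.gr_rep_carrier[OF r(3)]
  show ?thesis
  proof (rule M.gr_eqI)
    show "M.gr_rep (gr_prod FR M F f (\<lambda>i. x i <+>\<^bsub>R\<^esub> x' i) y) (\<lambda>k. \<Oplus>i\<in>?I. f (a i \<oplus>\<^bsub>R\<^esub> a' i) (b (k - i)))"
      by (rule gr_prod_rep[OF R.gr_rep_add[OF r(1,2)] r(3) I I'])
    show "M.gr_rep (\<lambda>i. gr_prod FR M F f x y i <+> gr_prod FR M F f x' y i)
       (\<lambda>k. (\<Oplus>i\<in>?I. f (a i) (b (k - i))) \<oplus> (\<Oplus>i\<in>?I. f (a' i) (b (k - i))))"
      by (intro M.gr_rep_add gr_prod_rep r I) auto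
    show "(\<Oplus>i\<in>?I. f (a i \<oplus>\<^bsub>R\<^esub> a' i) (b (k - i))) =
      (\<Oplus>i\<in>?I. f (a i) (b (k - i))) \<oplus> (\<Oplus>i\<in>?I. f (a' i) (b (k - i)))" for k
      using c f_closed f_add_l by (simp add: M.M.finsum_addf flip: M.M.finsum_addf)
  qed
qed

lemma gr_prod_add_r:
  assumes "x \<in> gr_carrier R FR" "y \<in> gr_carrier M F" "y' \<in> gr_carrier M F"
  shows "gr_prod FR M F f x (\<lambda>i. y i <+> y' i) =
    (\<lambda>i. gr_prod FR M F f x y i <+> gr_prod FR M F f x y' i)"
proof -
  obtain a b b' where r: "R.gr_rep x a" "M.gr_rep y b" "M.gr_rep y' b'"
    using assms by (auto simp: R.gr_carrier_iff M.gr_carrier_iff)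
  let ?I = "{i. a i \<notin> FR (i - 1)}"
  have I: "finite ?I" using r by (auto simp: R.gr_rep_def)
  note c = R.gr_rep_carrier[OF r(1)] M.gr_rep_carrier[OF r(2)] M.gr_rep_carrier[OF r(3)]
  show ?thesis
  proof (rule M.gr_eqI)
    show "M.gr_rep (gr_prod FR M F f x (\<lambda>i. y i <+> y' i)) (\<lambda>k. \<Oplus>i\<in>?I. f (a i) (b (k - i) \<oplus> b' (k - i)))"
      by (rule gr_prod_rep[OF r(1) M.gr_rep_add[OF r(2,3)] I order_refl])
    show "M.gr_rep (\<lambda>i. gr_prod FR M F f x y i <+> gr_prod FR M F f x y' i)
       (\<lambda>k. (\<Oplus>i\<in>?I. f (a i) (b (k - i))) \<oplus> (\<Oplus>i\<in>?I. f (a i) (b' (k - i))))"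
      by (intro M.gr_rep_add gr_prod_rep r I) auto
    show "(\<Oplus>i\<in>?I. f (a i) (b (k - i) \<oplus> b' (k - i))) =
      (\<Oplus>i\<in>?I. f (a i) (b (k - i))) \<oplus> (\<Oplus>i\<in>?I. f (a i) (b' (k - i)))" for k
      using c f_closed f_add_r by (simp add: M.M.finsum_addf flip: M.M.finsum_addf)
  qed
qed

lemma gr_prod_closed:
  assumes "x \<in> gr_carrier R FR" "y \<in> gr_carrier M F"
  shows "gr_prod FR M F f x y \<in> gr_carrier M F"
proof -
  obtain a b where r: "R.gr_rep x a" "M.gr_rep y b"
    using assms by (auto simp: R.gr_carrier_iff M.gr_carrier_iff)
  then have "finite {i. a i \<notin> FR (i - 1)}" by (auto simp: R.gr_rep_def)
  then show ?thesis using gr_prod_rep[OF r _ order_refl] M.gr_carrier_iff by blast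
qed

end

section \<open>Filtered rings whose associated graded ring is a polynomial ring\<close>

lemma expo_induct [case_names zero add]:
  fixes e :: "'v::finite expo"
  assumes "P 0" and step: "\<And>e v. P e \<Longrightarrow> P (e + single v 1)"
  shows "P e"
proof (induction "wdot (\<lambda>_. 1) e" arbitrary: e rule: less_induct)
  case less
  show ?case
  proof (cases "e = 0")
    case False
    then obtain v where v: "lookup e v > 0" by (metis gr0I lookup_zero poly_mapping_eqI)
    have "wdot (\<lambda>_. 1) (e - single v 1) < wdot (\<lambda>_. 1) e"
      using arg_cong[OF expo_split[OF v], of "wdot (\<lambda>_. 1)"] by (simp add: wdot_add)
    then show ?thesis using step[OF less, of "e - single v 1" v] expo_split[OF v] by simp
  qed (use assms(1) in simp)
qed

lemma poly_ring_simps [simp]: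
  "carrier poly_ring = UNIV" "p \<otimes>\<^bsub>poly_ring\<^esub> q = p * q" "\<one>\<^bsub>poly_ring\<^esub> = 1" "\<zero>\<^bsub>poly_ring\<^esub> = 0"
  "p \<oplus>\<^bsub>poly_ring\<^esub> q = p + q"
  by (simp_all add: poly_ring_def)

lemma ring_poly: "ring (poly_ring :: ('k::field_char_0, 'v) mpoly ring)"
proof (rule ringI)
  show "abelian_group (poly_ring :: ('k, 'v) mpoly ring)"
  proof (rule abelian_groupI)
    fix p :: "('k, 'v) mpoly"
    show "\<exists>q\<in>carrier poly_ring. q \<oplus>\<^bsub>poly_ring\<^esub> p = \<zero>\<^bsub>poly_ring\<^esub>"
      by (intro bexI[of _ "- p"]) simp_all
  qed (simp_all add: add_ac)
  show "monoid (poly_ring :: ('k, 'v) mpoly ring)"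
    by (rule monoidI) (simp_all add: mult_ac)
qed (simp_all add: distrib_left distrib_right)

text \<open>
  A common frame for \<open>W\<close> with \<open>\<Phi> = Phi\<close> and for \<open>A\<close> itself with the identity: a ring that is linearly
  identified with a polynomial ring, such that the two products agree in the highest degree.
\<close>

locale quantization = R: ring R
  for R :: "'r ring" (structure) and \<Phi> :: "('k::field_char_0, 'v::finite) mpoly \<Rightarrow> 'r"
    and \<omega> :: "'v \<Rightarrow> nat" and FR :: "int \<Rightarrow> 'r set" +
  assumes Phi_range: "range \<Phi> = carrier R" and Phi_inj: "inj \<Phi>"
    and Phi_add: "\<Phi> (p + q) = \<Phi> p \<oplus> \<Phi> q" and Phi_one: "\<Phi> 1 = \<one>"
    and Phi_mult: "p \<in> poly_fil \<omega> i \<Longrightarrow> q \<in> poly_fil \<omega> j \<Longrightarrow>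
      \<exists>r\<in>poly_fil \<omega> (i + j - 1). \<Phi> p \<otimes> \<Phi> q = \<Phi> (p * q) \<oplus> \<Phi> r"
    and FR_eq: "FR i = \<Phi> ` poly_fil \<omega> i"
begin

lemma Phi_closed [simp]: "\<Phi> p \<in> carrier R"
  using Phi_range by blast

lemma Phi_zero: "\<Phi> 0 = \<zero>"
proof -
  have "\<Phi> 0 \<oplus> \<Phi> 0 = \<Phi> 0" using Phi_add[of 0 0] by simp
  then show ?thesis using Phi_closed by (metis R.add.r_cancel_one' R.zero_closed)
qed

lemma Phi_uminus: "\<Phi> (- p) = \<ominus> \<Phi> p"
proof -
  have "\<Phi> (- p) \<oplus> \<Phi> p = \<zero>" using Phi_add[of "- p" p] by (simp add: Phi_zero)
  then show ?thesis using Phi_closed by (simp add: R.minus_equality)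
qed

lemma Phi_mem: "\<Phi> p \<in> FR i \<longleftrightarrow> p \<in> poly_fil \<omega> i"
  using Phi_inj unfolding FR_eq by (auto dest: injD)

lemma FR_E: "a \<in> FR i \<Longrightarrow> \<exists>p\<in>poly_fil \<omega> i. a = \<Phi> p"
  unfolding FR_eq by blast

lemma FR_mult: "a \<in> FR i \<Longrightarrow> b \<in> FR j \<Longrightarrow> a \<otimes> b \<in> FR (i + j)"
proof -
  assume "a \<in> FR i" "b \<in> FR j"
  then obtain p q where pq: "p \<in> poly_fil \<omega> i" "q \<in> poly_fil \<omega> j" "a = \<Phi> p" "b = \<Phi> q"
    using FR_E by meson
  then obtain r where r: "r \<in> poly_fil \<omega> (i + j - 1)" "a \<otimes> b = \<Phi> (p * q) \<oplus> \<Phi> r" using Phi_mult by blast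
  have "p * q + r \<in> poly_fil \<omega> (i + j)"
    using poly_fil_mult[OF pq(1,2)] r(1) poly_fil_mono[of "i + j - 1" "i + j" \<omega>] by (intro poly_fil_add) auto
  then show ?thesis using r(2) Phi_mem[of "p * q + r"] by (simp add: Phi_add)
qed

sublocale G: filtered_group R FR
proof (intro filtered_group.intro filtered_group_axioms.intro R.abelian_group_axioms)
  fix i j :: int
  show "additive_subgroup (FR i) R"
  proof (rule additive_subgroupI, rule group.subgroupI[OF R.a_group])
    show "FR i \<subseteq> carrier (add_monoid R)" unfolding FR_eq by auto
    show "FR i \<noteq> {}" unfolding FR_eq using poly_fil_zero by blast
  next
    fix a assume "a \<in> FR i"
    then obtain p where "p \<in> poly_fil \<omega> i" "a = \<Phi> p" using FR_E by blast
    then show "inv\<^bsub>add_monoid R\<^esub> a \<in> FR i"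
      using Phi_mem[of "- p" i] by (simp add: Phi_uminus a_inv_def)
  next
    fix a b assume "a \<in> FR i" "b \<in> FR i"
    then obtain p q where pq: "p \<in> poly_fil \<omega> i" "a = \<Phi> p" "q \<in> poly_fil \<omega> i" "b = \<Phi> q"
      using FR_E by meson
    have "\<Phi> (p + q) \<in> FR i" unfolding Phi_mem by (rule poly_fil_add[OF pq(1,3)])
    then show "a \<otimes>\<^bsub>add_monoid R\<^esub> b \<in> FR i" by (simp add: Phi_add pq)
  qed
  show "i \<le> j \<Longrightarrow> FR i \<subseteq> FR j"
    unfolding FR_eq using poly_fil_mono by blast
qed

sublocale A: graded_action R FR R FR "mult R"
  by unfold_locales (simp_all add: R.l_distr R.r_distr FR_mult)

text \<open>The identification of the polynomial ring with the associated graded ring.\<close>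

definition symbol :: "('k, 'v) mpoly \<Rightarrow> int \<Rightarrow> 'r set" where
  "symbol p = (\<lambda>d. FR (d - 1) +> \<Phi> (hpart \<omega> d p))"

lemma finite_degrees: "finite {d. hpart \<omega> d p \<noteq> 0}"
proof (rule finite_subset)
  show "{d. hpart \<omega> d p \<noteq> 0} \<subseteq> (\<lambda>e. int (wdot \<omega> e)) ` keys p"
  proof
    fix d assume "d \<in> {d. hpart \<omega> d p \<noteq> 0}"
    then have "keys (hpart \<omega> d p) \<noteq> {}" by (simp del: keys_hpart)
    then obtain e where "e \<in> keys (hpart \<omega> d p)" by blast
    then show "d \<in> (\<lambda>e. int (wdot \<omega> e)) ` keys p" by auto
  qed
qed simp

lemma finite_symbol: "finite {d. \<Phi> (hpart \<omega> d p) \<notin> FR (d - 1)}"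
proof (rule finite_subset[OF _ finite_degrees[of p]])
  show "{d. \<Phi> (hpart \<omega> d p) \<notin> FR (d - 1)} \<subseteq> {d. hpart \<omega> d p \<noteq> 0}" using Phi_mem by force
qed

lemma symbol_rep: "G.gr_rep (symbol p) (\<lambda>d. \<Phi> (hpart \<omega> d p))"
  unfolding G.gr_rep_def by (simp add: Phi_mem hpart_in_fil symbol_def finite_symbol[unfolded Phi_mem])

lemma symbol_closed: "symbol p \<in> gr_carrier R FR"
  using symbol_rep G.gr_carrier_iff by blast

lemma symbol_add: "symbol (p + q) = (\<lambda>i. symbol p i <+> symbol q i)"
  by (rule G.gr_eqI[OF symbol_rep G.gr_rep_add[OF symbol_rep symbol_rep]]) (simp add: hpart_add Phi_add)

lemma symbol_homogeneous:
  assumes "hpart \<omega> d p = p"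
  shows "symbol p = gr_class R FR d (\<Phi> p)"
proof (rule G.gr_eqI[OF symbol_rep G.gr_rep_class])
  show "\<Phi> p \<in> FR d" using hpart_in_fil[of \<omega> d p] by (simp add: Phi_mem assms)
  show "\<Phi> (hpart \<omega> i p) = (if i = d then \<Phi> p else \<zero>)" for i
    using hpart_hpart[of \<omega> i d p] assms Phi_zero by auto
qed

lemma symbol_single: "symbol (single e c) = gr_class R FR (int (wdot \<omega> e)) (\<Phi> (single e c))"
  by (rule symbol_homogeneous) (simp add: hpart_single)

lemma gr_eq_clsI:
  assumes "G.gr_rep x u" "G.gr_rep y v" "\<And>i. G.cls i (u i) = G.cls i (v i)"
  shows "x = y"
  using assms by (auto simp: G.gr_rep_def)

text \<open>Both sides are additive in \<open>p\<close> and in \<open>q\<close>, so that only monomials have to be multiplied.\<close>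

lemma symbol_mult: "symbol (p * q) = gr_prod FR R FR (mult R) (symbol p) (symbol q)"
proof (induction p rule: poly_add_induct)
  case (1 e c)
  show ?case
  proof (induction q rule: poly_add_induct)
    case (1 f d)
    let ?s = "single e c" and ?t = "single f d"
    have sm: "?s \<in> poly_fil \<omega> (int (wdot \<omega> e))" "?t \<in> poly_fil \<omega> (int (wdot \<omega> f))" by (rule poly_fil_single)+
    obtain r where r: "r \<in> poly_fil \<omega> (int (wdot \<omega> e) + int (wdot \<omega> f) - 1)"
      "\<Phi> ?s \<otimes> \<Phi> ?t = \<Phi> (?s * ?t) \<oplus> \<Phi> r" using Phi_mult[OF sm] by blast
    have "\<Phi> ?s \<in> FR (int (wdot \<omega> e))" using sm Phi_mem by blast
    from A.gr_prod_class[OF this symbol_rep[of ?t]]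
    have rep: "G.gr_rep (gr_prod FR R FR (mult R) (symbol ?s) (symbol ?t))
      (\<lambda>k. \<Phi> ?s \<otimes> \<Phi> (hpart \<omega> (k - int (wdot \<omega> e)) ?t))" by (simp add: symbol_single)
    show ?case
    proof (rule gr_eq_clsI[OF symbol_rep rep])
      fix k
      show "G.cls k (\<Phi> (hpart \<omega> k (?s * ?t))) = G.cls k (\<Phi> ?s \<otimes> \<Phi> (hpart \<omega> (k - int (wdot \<omega> e)) ?t))"
      proof (cases "k = int (wdot \<omega> e) + int (wdot \<omega> f)")
        case True
        have "\<Phi> r \<in> FR (k - 1)" using r True by (simp add: Phi_mem)
        then have "G.cls k (\<Phi> r \<oplus> \<Phi> (?s * ?t)) = G.cls k (\<Phi> (?s * ?t))" by (rule G.cls_absorb) simp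
        then show ?thesis using True r(2) by (simp add: hpart_single mult_single wdot_add R.a_comm)
      next
        case False
        then show ?thesis by (auto simp: hpart_single mult_single wdot_add Phi_zero)
      qed
    qed
  next
    case (2 p q)
    then show ?case by (simp only: distrib_left symbol_add A.gr_prod_add_r[OF symbol_closed symbol_closed symbol_closed])
  qed
next
  case (2 a b)
  then show ?case by (simp only: distrib_right symbol_add A.gr_prod_add_l[OF symbol_closed symbol_closed symbol_closed])
qed

lemma symbol_one: "symbol 1 = gr_class R FR 0 \<one>"
  using symbol_homogeneous[of 0 1] hpart_single[of \<omega> 0 0 1] by (simp add: Phi_one)

lemma symbol_Const: "symbol (Const c) = gr_class R FR 0 (\<Phi> (Const c))"
  using symbol_single[of 0 c] by (simp add: Const_def)

lemma symbol_Var: "symbol (Var v) = gr_class R FR (int (\<omega> v)) (\<Phi> (Var v))"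
  using symbol_single[of "single v 1" 1] by (simp add: Var_def)

lemma symbol_ring_hom: "symbol \<in> ring_hom poly_ring (gr_ring R FR)"
  by (rule ring_hom_memI) (simp_all add: gr_ring_def symbol_closed symbol_add symbol_mult symbol_one)

text \<open>This identifies the homomorphisms that are introduced by definite descriptions in the definitions.\<close>

lemma symbol_unique:
  assumes h: "h \<in> ring_hom poly_ring (gr_ring R FR)"
    and c: "\<And>c. h (Const c) = symbol (Const c)" and v: "\<And>v. h (Var v) = symbol (Var v)"
  shows "h = symbol"
proof
  fix p
  have mult: "h (p * q) = h p \<otimes>\<^bsub>gr_ring R FR\<^esub> h q" for p q using ring_hom_mult[OF h, of p q] by simp
  have add: "h (p + q) = h p \<oplus>\<^bsub>gr_ring R FR\<^esub> h q" for p q using ring_hom_add[OF h, of p q] by simp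
  show "h p = symbol p"
  proof (induction p rule: poly_add_induct)
    case (1 e c)
    show ?case
    proof (induction e rule: expo_induct)
      case zero
      then show ?case using c[of c] by (simp add: Const_def)
    next
      case (add e v)
      have "single (e + single v 1) c = single e c * Var v" by (simp add: Var_def mult_single)
      then show ?case using add assms(3) by (simp add: mult symbol_mult gr_ring_def)
    qed
  next
    case (2 p q)
    then show ?case by (simp add: add symbol_add gr_ring_def)
  qed
qed

end

section \<open>Associated graded modules and their annihilators\<close>

text \<open>Modules over a ring that need not be commutative.\<close>

locale left_mod = R: ring R + M: abelian_group M for R :: "'r ring" and M :: "('r, 'm) module" (structure) +
  assumes smult_closed [simp]: "a \<in> carrier R \<Longrightarrow> x \<in> carrier M \<Longrightarrow> a \<odot> x \<in> carrier M"
    and smult_l_distr: "a \<in> carrier R \<Longrightarrow> b \<in> carrier R \<Longrightarrow> x \<in> carrier M \<Longrightarrow>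
      (a \<oplus>\<^bsub>R\<^esub> b) \<odot> x = a \<odot> x \<oplus> b \<odot> x"
    and smult_r_distr: "a \<in> carrier R \<Longrightarrow> x \<in> carrier M \<Longrightarrow> y \<in> carrier M \<Longrightarrow>
      a \<odot> (x \<oplus> y) = a \<odot> x \<oplus> a \<odot> y"
    and smult_assoc: "a \<in> carrier R \<Longrightarrow> b \<in> carrier R \<Longrightarrow> x \<in> carrier M \<Longrightarrow>
      (a \<otimes>\<^bsub>R\<^esub> b) \<odot> x = a \<odot> (b \<odot> x)"
    and smult_one [simp]: "x \<in> carrier M \<Longrightarrow> \<one>\<^bsub>R\<^esub> \<odot> x = x"

locale quant_module = quantization R \<Phi> \<omega> FR + left_mod R M
  for R :: "'r ring" and \<Phi> :: "('k::field_char_0, 'v::finite) mpoly \<Rightarrow> 'r"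
    and \<omega> :: "'v \<Rightarrow> nat" and FR :: "int \<Rightarrow> 'r set" and M :: "('r, 'm) module" (structure) +
  fixes F :: "int \<Rightarrow> 'm set"
  assumes fil: "filtration FR M F"
begin

sublocale B: graded_action R FR M F "smult M"
proof (intro graded_action.intro graded_action_axioms.intro filtered_group.intro[of M]
    filtered_group_axioms.intro G.filtered_group_axioms M.abelian_group_axioms)
  show "additive_subgroup (F i) M" for i using fil by (simp add: filtration_def)
  show "i \<le> j \<Longrightarrow> F i \<subseteq> F j" for i j using fil by (auto simp: filtration_def mono_def)
  show "a \<in> FR i \<Longrightarrow> b \<in> F j \<Longrightarrow> a \<odot> b \<in> F (i + j)" for a b i j using fil by (simp add: filtration_def)
qed (simp_all add: smult_l_distr smult_r_distr)

abbreviation gr :: "(('k, 'v) mpoly, int \<Rightarrow> 'm set) module" where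
  "gr \<equiv> restrict_scalars symbol (gr_module FR M F)"

lemma gr_simps [simp]:
  "carrier gr = gr_carrier M F" "add gr = (\<lambda>x y i. x i <+> y i)" "zero gr = (\<lambda>i. F (i - 1))"
  "smult gr = (\<lambda>p. gr_prod FR M F (smult M) (symbol p))"
  by (simp_all add: restrict_scalars_def gr_module_def)

lemma gr_single:
  assumes "B.M.gr_rep y b"
  shows "B.M.gr_rep (single e c \<odot>\<^bsub>gr\<^esub> y) (\<lambda>k. \<Phi> (single e c) \<odot> b (k - int (wdot \<omega> e)))"
  using B.gr_prod_class[OF Phi_mem[THEN iffD2, OF poly_fil_single] assms] by (simp add: symbol_single)

lemma gr_assoc:
  assumes x: "x \<in> gr_carrier M F"
  shows "(p * q) \<odot>\<^bsub>gr\<^esub> x = p \<odot>\<^bsub>gr\<^esub> (q \<odot>\<^bsub>gr\<^esub> x)"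
proof (induction p rule: poly_add_induct)
  case (1 e c)
  show ?case
  proof (induction q rule: poly_add_induct)
    case (1 f d)
    obtain b where b: "B.M.gr_rep x b" using x B.M.gr_carrier_iff by blast
    let ?s = "single e c" and ?t = "single f d"
    have sm: "?s \<in> poly_fil \<omega> (int (wdot \<omega> e))" "?t \<in> poly_fil \<omega> (int (wdot \<omega> f))" by (rule poly_fil_single)+
    obtain r where r: "r \<in> poly_fil \<omega> (int (wdot \<omega> e) + int (wdot \<omega> f) - 1)"
      "\<Phi> ?s \<otimes>\<^bsub>R\<^esub> \<Phi> ?t = \<Phi> (?s * ?t) \<oplus>\<^bsub>R\<^esub> \<Phi> r" using Phi_mult[OF sm] by blast
    let ?k = "\<lambda>k. k - int (wdot \<omega> e) - int (wdot \<omega> f)"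
    have 1: "B.M.gr_rep ((?s * ?t) \<odot>\<^bsub>gr\<^esub> x) (\<lambda>k. \<Phi> (?s * ?t) \<odot> b (?k k))"
      using gr_single[OF b, of "e + f" "c * d"] by (simp add: mult_single wdot_add diff_diff_eq)
    have 2: "B.M.gr_rep (?s \<odot>\<^bsub>gr\<^esub> (?t \<odot>\<^bsub>gr\<^esub> x)) (\<lambda>k. \<Phi> ?s \<odot> (\<Phi> ?t \<odot> b (?k k)))"
      using gr_single[OF gr_single[OF b]] by simp
    have "B.M.cls k (\<Phi> (?s * ?t) \<odot> b (?k k)) = B.M.cls k (\<Phi> ?s \<odot> (\<Phi> ?t \<odot> b (?k k)))" for k
    proof -
      have bc: "b (?k k) \<in> carrier M" using b B.M.gr_rep_carrier by blast
      have "\<Phi> ?s \<odot> (\<Phi> ?t \<odot> b (?k k)) = \<Phi> r \<odot> b (?k k) \<oplus> \<Phi> (?s * ?t) \<odot> b (?k k)"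
        using bc by (simp add: r(2) smult_l_distr M.a_comm flip: smult_assoc)
      moreover have "\<Phi> r \<odot> b (?k k) \<in> F (k - 1)"
        using B.f_fil[of "\<Phi> r" "int (wdot \<omega> e) + int (wdot \<omega> f) - 1" "b (?k k)" "?k k"] r(1) B.M.gr_rep_F[OF b]
        by (simp add: Phi_mem)
      ultimately show ?thesis using B.M.cls_absorb bc by simp
    qed
    then show ?case using 1 2 by (auto simp: B.M.gr_rep_def)
  next
    case (2 p q)
    have "q \<odot>\<^bsub>gr\<^esub> x \<in> gr_carrier M F" for q using B.gr_prod_closed[OF symbol_closed x] by simp
    with 2 show ?case
      by (simp add: distrib_left symbol_add B.gr_prod_add_l[OF symbol_closed symbol_closed x] B.gr_prod_add_r[OF symbol_closed])
  qed
next
  case (2 a b)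
  have "q \<odot>\<^bsub>gr\<^esub> x \<in> gr_carrier M F" for q using B.gr_prod_closed[OF symbol_closed x] by simp
  with 2 show ?case
    by (simp add: distrib_right symbol_add B.gr_prod_add_l[OF symbol_closed symbol_closed x] B.gr_prod_add_l[OF symbol_closed symbol_closed])
qed

lemma gr_left_mod: "left_mod poly_ring gr"
proof -
  have ag: "abelian_group gr" by (rule B.M.gr_abelian_group) simp_all
  have one: "1 \<odot>\<^bsub>gr\<^esub> x = x" if x: "x \<in> gr_carrier M F" for x
  proof -
    obtain b where b: "B.M.gr_rep x b" using x B.M.gr_carrier_iff by blast
    show ?thesis
      by (rule B.M.gr_eqI[OF gr_single[OF b, of 0 1, unfolded single_one] b])
        (simp add: Phi_one B.M.gr_rep_carrier[OF b])
  qed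
  show ?thesis
    by (intro left_mod.intro left_mod_axioms.intro ag ring_poly)
      (simp_all add: B.gr_prod_closed symbol_closed symbol_add B.gr_prod_add_l B.gr_prod_add_r gr_assoc[simplified] one[simplified])
qed

text \<open>
  A homogeneous polynomial of degree \<open>d\<close> is in the annihilator iff its operator raises degrees by less
  than \<open>d\<close>. Testing on classes of single elements of \<open>M\<close> is enough, as these generate the graded module,
  and yields the criterion for each homogeneous part of \<open>p\<close> separately.
\<close>

theorem annihilator_gr:
  "p \<in> annihilator poly_ring gr \<longleftrightarrow> (\<forall>d i. \<forall>m\<in>F i. \<Phi> (hpart \<omega> d p) \<odot> m \<in> F (i + d - 1))"
proof
  assume p: "p \<in> annihilator poly_ring gr"
  show "\<forall>d i. \<forall>m\<in>F i. \<Phi> (hpart \<omega> d p) \<odot> m \<in> F (i + d - 1)"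
  proof (intro allI ballI)
    fix d i m assume m: "m \<in> F i"
    let ?I = "insert d {d. \<Phi> (hpart \<omega> d p) \<notin> FR (d - 1)}"
    let ?b = "\<lambda>j. if j = i then m else \<zero>"
    have mc: "m \<in> carrier M" using m B.M.F_carrier by blast
    have "gr_class M F i m \<in> gr_carrier M F" using B.M.gr_rep_class[OF m] B.M.gr_carrier_iff by blast
    then have z: "gr_prod FR M F (smult M) (symbol p) (gr_class M F i m) = (\<lambda>i. F (i - 1))"
      using p by (simp add: annihilator_def)
    have "gr_prod FR M F (smult M) (symbol p) (gr_class M F i m) (i + d) =
      B.M.cls (i + d) (\<Oplus>j\<in>?I. \<Phi> (hpart \<omega> j p) \<odot> ?b (i + d - j))"
      by (rule B.gr_prod_eval[OF symbol_rep B.M.gr_rep_class[OF m]]) (simp add: finite_symbol, blast)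
    moreover have "(\<Oplus>j\<in>?I. \<Phi> (hpart \<omega> j p) \<odot> ?b (i + d - j)) =
        (\<Oplus>j\<in>?I. if d = j then \<Phi> (hpart \<omega> j p) \<odot> m else \<zero>)"
    proof (rule M.finsum_cong'[OF refl])
      show "(\<lambda>j. if d = j then \<Phi> (hpart \<omega> j p) \<odot> m else \<zero>) \<in> ?I \<rightarrow> carrier M" using mc by simp
      show "\<Phi> (hpart \<omega> j p) \<odot> ?b (i + d - j) = (if d = j then \<Phi> (hpart \<omega> j p) \<odot> m else \<zero>)" for j
        using B.f_zero_r[OF Phi_closed] by simp
    qed
    moreover have "\<dots> = \<Phi> (hpart \<omega> d p) \<odot> m"
      by (rule M.finsum_singleton) (use mc finite_symbol in simp_all)
    ultimately have "B.M.cls (i + d) (\<Phi> (hpart \<omega> d p) \<odot> m) = F (i + d - 1)" using z by simp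
    then show "\<Phi> (hpart \<omega> d p) \<odot> m \<in> F (i + d - 1)" using B.M.cls_zero_iff mc by simp
  qed
next
  assume p: "\<forall>d i. \<forall>m\<in>F i. \<Phi> (hpart \<omega> d p) \<odot> m \<in> F (i + d - 1)"
  have "gr_prod FR M F (smult M) (symbol p) x = (\<lambda>i. F (i - 1))" if x: "x \<in> gr_carrier M F" for x
  proof
    fix k
    obtain b where b: "B.M.gr_rep x b" using x B.M.gr_carrier_iff by blast
    have "gr_prod FR M F (smult M) (symbol p) x k =
        B.M.cls k (\<Oplus>j\<in>{d. \<Phi> (hpart \<omega> d p) \<notin> FR (d - 1)}. \<Phi> (hpart \<omega> j p) \<odot> b (k - j))"
      by (rule B.gr_prod_eval[OF symbol_rep b finite_symbol order_refl])
    moreover have "\<Phi> (hpart \<omega> j p) \<odot> b (k - j) \<in> F (k - 1)" for j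
      using p[rule_format, of "b (k - j)" "k - j" j] B.M.gr_rep_F[OF b] by simp
    ultimately show "gr_prod FR M F (smult M) (symbol p) x k = F (k - 1)"
      using B.M.cls_zero[OF B.M.finsum_F[OF finite_symbol]] by simp
  qed
  then show "p \<in> annihilator poly_ring gr" by (simp add: annihilator_def)
qed

end

section \<open>Independence of the good filtration\<close>

lemma (in left_mod) smult_zero_r [simp]: "a \<in> carrier R \<Longrightarrow> a \<odot> \<zero> = \<zero>"
proof -
  assume a: "a \<in> carrier R"
  then have "a \<odot> \<zero> \<oplus> a \<odot> \<zero> = a \<odot> \<zero>"
    using smult_r_distr[of a "\<zero>" "\<zero>"] by simp
  then show ?thesis using smult_closed[OF a, of "\<zero>"] by (metis M.add.r_cancel_one' M.zero_closed)
qed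

lemma (in left_mod) smult_zero_l [simp]: "x \<in> carrier M \<Longrightarrow> \<zero>\<^bsub>R\<^esub> \<odot> x = \<zero>"
proof -
  assume x: "x \<in> carrier M"
  then have "\<zero>\<^bsub>R\<^esub> \<odot> x \<oplus> \<zero>\<^bsub>R\<^esub> \<odot> x = \<zero>\<^bsub>R\<^esub> \<odot> x"
    using smult_l_distr[of "\<zero>\<^bsub>R\<^esub>" "\<zero>\<^bsub>R\<^esub>" x] by simp
  then show ?thesis using smult_closed[OF _ x, of "\<zero>\<^bsub>R\<^esub>"] by (metis M.add.r_cancel_one' R.zero_closed)
qed

context left_mod
begin

definition lincomb :: "nat \<Rightarrow> (nat \<Rightarrow> 'r) \<Rightarrow> (nat \<Rightarrow> 'm) \<Rightarrow> 'm" where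
  "lincomb n b m = (\<Oplus>l\<in>{..<n}. b l \<odot> m l)"

lemma lincomb_0: "lincomb 0 b m = \<zero>"
  by (simp add: lincomb_def)

lemma lincomb_Suc:
  assumes "\<And>l. b l \<in> carrier R" "\<And>l. l < Suc n \<Longrightarrow> m l \<in> carrier M"
  shows "lincomb (Suc n) b m = b n \<odot> m n \<oplus> lincomb n b m"
  unfolding lincomb_def lessThan_Suc by (rule M.finsum_insert) (simp_all add: assms)

lemma lincomb_closed:
  assumes "\<And>l. b l \<in> carrier R" "\<And>l. l < n \<Longrightarrow> m l \<in> carrier M"
  shows "lincomb n b m \<in> carrier M"
  unfolding lincomb_def by (rule M.finsum_closed) (simp add: assms)

lemma lincomb_add:
  assumes "\<And>l. b l \<in> carrier R" "\<And>l. c l \<in> carrier R" "\<And>l. l < n \<Longrightarrow> m l \<in> carrier M"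
  shows "lincomb n (\<lambda>l. b l \<oplus>\<^bsub>R\<^esub> c l) m = lincomb n b m \<oplus> lincomb n c m"
proof -
  have "lincomb n (\<lambda>l. b l \<oplus>\<^bsub>R\<^esub> c l) m = (\<Oplus>l\<in>{..<n}. b l \<odot> m l \<oplus> c l \<odot> m l)"
    unfolding lincomb_def by (rule M.finsum_cong'[OF refl]) (simp_all add: assms smult_l_distr)
  also have "\<dots> = lincomb n b m \<oplus> lincomb n c m"
    unfolding lincomb_def by (rule M.finsum_addf) (simp_all add: assms)
  finally show ?thesis .
qed

lemma lincomb_smult:
  assumes a: "a \<in> carrier R" and b: "\<And>l. b l \<in> carrier R" and m: "\<And>l. l < n \<Longrightarrow> m l \<in> carrier M"
  shows "a \<odot> lincomb n b m = lincomb n (\<lambda>l. a \<otimes>\<^bsub>R\<^esub> b l) m"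
  using m
proof (induction n)
  case 0
  then show ?case using a by (simp add: lincomb_0)
next
  case (Suc n)
  have "lincomb n b m \<in> carrier M" by (rule lincomb_closed[OF b]) (simp add: Suc.prems)
  then show ?case using a b Suc by (simp add: lincomb_Suc smult_r_distr smult_assoc)
qed

lemma lincomb_zero: "(\<And>l. l < n \<Longrightarrow> b l \<odot> m l = \<zero>) \<Longrightarrow> lincomb n b m = \<zero>"
  unfolding lincomb_def using M.finsum_cong'[OF refl, of "\<lambda>_. \<zero>" "{..<n}" "\<lambda>l. b l \<odot> m l"] by simp

end

lemma annihilator_ideal:
  assumes "left_mod poly_ring N"
  shows "poly_ideal (annihilator poly_ring N)"
proof -
  interpret left_mod poly_ring N by fact
  have "(p + q) \<odot>\<^bsub>N\<^esub> x = p \<odot>\<^bsub>N\<^esub> x \<oplus>\<^bsub>N\<^esub> q \<odot>\<^bsub>N\<^esub> x" "(p * q) \<odot>\<^bsub>N\<^esub> x = p \<odot>\<^bsub>N\<^esub> (q \<odot>\<^bsub>N\<^esub> x)"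
    "0 \<odot>\<^bsub>N\<^esub> x = \<zero>\<^bsub>N\<^esub>" if "x \<in> carrier N" for p q x
    using smult_l_distr[of p q x] smult_assoc[of p q x] smult_zero_l[of x] that by simp_all
  moreover have "p \<odot>\<^bsub>N\<^esub> \<zero>\<^bsub>N\<^esub> = \<zero>\<^bsub>N\<^esub>" for p using smult_zero_r[of p] by simp
  ultimately show ?thesis by (simp add: poly_ideal_def annihilator_def)
qed

context quant_module
begin

text \<open>
  \<open>\<Phi> (w ^ l)\<close> and the \<open>l\<close>-th power of \<open>\<Phi> w\<close> differ in lower degrees, but in the graded
  module both act in the same way.
\<close>

lemma power_homogeneous_rep:
  assumes w: "hpart \<omega> d w = w" and b: "B.M.gr_rep x b"
  shows "B.M.gr_rep (w ^ l \<odot>\<^bsub>gr\<^esub> x) (\<lambda>k. ((\<lambda>m. \<Phi> w \<odot> m) ^^ l) (b (k - int l * d)))"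
proof (induction l)
  case 0
  interpret N: left_mod poly_ring gr by (rule gr_left_mod)
  have "1 \<odot>\<^bsub>gr\<^esub> x = x" using N.smult_one[of x] b B.M.gr_carrier_iff by auto
  then show ?case using b by simp
next
  case (Suc l)
  have "\<Phi> w \<in> FR d" using hpart_in_fil[of \<omega> d w] by (simp add: Phi_mem w)
  from B.gr_prod_class[OF this Suc]
  have "B.M.gr_rep (w \<odot>\<^bsub>gr\<^esub> (w ^ l \<odot>\<^bsub>gr\<^esub> x)) (\<lambda>k. \<Phi> w \<odot> ((\<lambda>m. \<Phi> w \<odot> m) ^^ l) (b (k - d - int l * d)))"
    by (simp add: symbol_homogeneous[OF w])
  moreover have "w \<odot>\<^bsub>gr\<^esub> (w ^ l \<odot>\<^bsub>gr\<^esub> x) = w ^ Suc l \<odot>\<^bsub>gr\<^esub> x"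
  proof -
    have "x \<in> gr_carrier M F" using b B.M.gr_carrier_iff by blast
    from gr_assoc[OF this, of w "w ^ l"] show ?thesis by simp
  qed
  moreover have "k - d - int l * d = k - int (Suc l) * d" for k by (simp add: algebra_simps)
  ultimately show ?case by simp
qed

end

text \<open>
  If \<open>w\<close>, homogeneous of degree \<open>d\<close>, annihilates the graded module of \<open>F\<close>, then \<open>l\<close> applications of \<open>\<Phi> w\<close> raise
  \<open>F\<close>-degrees by at most \<open>l * d - l\<close>. Passing from \<open>F2\<close> to \<open>F\<close> and back costs at most \<open>2 * c\<close>, so for
  \<open>l = 2 * c + 1\<close> they still raise \<open>F2\<close>-degrees by less than \<open>l * d\<close>.
\<close>

lemma rad_annihilator_mono:
  assumes "quant_module R \<Phi> \<omega> FR M F" "quant_module R \<Phi> \<omega> FR M F2"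
    and c: "c \<ge> 0" "\<And>i. F i \<subseteq> F2 (i + c)" "\<And>i. F2 i \<subseteq> F (i + c)"
  shows "rad (annihilator poly_ring (quant_module.gr R \<Phi> \<omega> FR M F)) \<subseteq>
    rad (annihilator poly_ring (quant_module.gr R \<Phi> \<omega> FR M F2))"
proof
  interpret Q1: quant_module R \<Phi> \<omega> FR M F by fact
  interpret Q2: quant_module R \<Phi> \<omega> FR M F2 by fact
  fix p assume "p \<in> rad (annihilator poly_ring Q1.gr)"
  then obtain k where k: "p ^ k \<in> annihilator poly_ring Q1.gr" by (auto simp: rad_def)
  have ideal: "poly_ideal (annihilator poly_ring Q2.gr)" by (rule annihilator_ideal[OF Q2.gr_left_mod])
  have "hpart \<omega> d (p ^ k) \<in> rad (annihilator poly_ring Q2.gr)" for d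
  proof -
    define w where "w = hpart \<omega> d (p ^ k)"
    have w: "hpart \<omega> d w = w" by (simp add: w_def hpart_hpart)
    define T where "T = (\<lambda>m. \<Phi> w \<odot>\<^bsub>M\<^esub> m)"
    have T: "T m \<in> F (i + d - 1)" if "m \<in> F i" for m i
      using k that unfolding Q1.annihilator_gr T_def w_def by blast
    have Tl: "(T ^^ l) m \<in> F (i + int l * d - int l)" if "m \<in> F i" for m i l
      using that
    proof (induction l)
      case (Suc l)
      have "(T ^^ Suc l) m \<in> F (i + int l * d - int l + d - 1)" using T[OF Suc.IH[OF Suc.prems]] by simp
      moreover have "i + int l * d - int l + d - 1 = i + int (Suc l) * d - int (Suc l)" by (simp add: algebra_simps)
      ultimately show ?case by simp
    qed simp
    define l where "l = nat (2 * c + 1)"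
    have l: "int l = 2 * c + 1" using c(1) by (simp add: l_def)
    have "w ^ l \<odot>\<^bsub>Q2.gr\<^esub> x = \<zero>\<^bsub>Q2.gr\<^esub>" if x: "x \<in> carrier Q2.gr" for x
    proof -
      obtain b where b: "Q2.B.M.gr_rep x b" using x Q2.B.M.gr_carrier_iff by auto
      have "(T ^^ l) (b (k - int l * d)) \<in> F2 (k - 1)" for k
      proof -
        have "b (k - int l * d) \<in> F (k - int l * d + c)" using Q2.B.M.gr_rep_F[OF b] c(3) by blast
        from Tl[OF this, of l] have "(T ^^ l) (b (k - int l * d)) \<in> F (k - c - 1)"
          using l by (simp add: algebra_simps)
        then show ?thesis using c(2)[of "k - c - 1"] by (simp add: algebra_simps subset_iff)
      qed
      then have "Q2.B.M.cls k ((T ^^ l) (b (k - int l * d))) = F2 (k - 1)" for k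
        by (rule Q2.B.M.cls_zero)
      then show ?thesis
        using Q2.power_homogeneous_rep[OF w b, of l] unfolding Q2.B.M.gr_rep_def T_def by simp
    qed
    then have "w ^ l \<in> annihilator poly_ring Q2.gr" by (simp add: annihilator_def)
    then show ?thesis unfolding w_def rad_def by blast
  qed
  then have "p ^ k \<in> rad (annihilator poly_ring Q2.gr)" by (rule rad_hom[OF ideal])
  then show "p \<in> rad (annihilator poly_ring Q2.gr)" by (rule rad_power)
qed

text \<open>It suffices to compare the degrees of the finitely many generators.\<close>

lemma good_filtration_bound:
  assumes good: "good_filtration FR M F" and M: "abelian_group M" and F2: "filtration FR M F2"
  shows "\<exists>c\<ge>0. \<forall>i. F i \<subseteq> F2 (i + c)"
proof -
  interpret abelian_group M by fact
  interpret F2: filtered_group M F2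
    using F2 abelian_group_axioms
    by (intro filtered_group.intro filtered_group_axioms.intro) (simp_all add: filtration_def mono_def)
  obtain k and m :: "nat \<Rightarrow> _" and p where m: "\<forall>j<k. m j \<in> carrier M"
    and F: "\<And>i. F i = {(\<Oplus>\<^bsub>M\<^esub>j\<in>{..<k}. r j \<odot>\<^bsub>M\<^esub> m j) | r. \<forall>j<k. r j \<in> FR (i - p j)}"
    using good unfolding good_filtration_def by blast
  have "\<forall>j. \<exists>q. j < k \<longrightarrow> m j \<in> F2 q" using m F2 by (auto simp: filtration_def)
  then obtain q where q: "\<And>j. j < k \<Longrightarrow> m j \<in> F2 (q j)" by metis
  define c where "c = (\<Sum>j<k. \<bar>q j - p j\<bar>)"
  have "F i \<subseteq> F2 (i + c)" for i
  proof
    fix x assume "x \<in> F i"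
    then obtain r where r: "x = (\<Oplus>\<^bsub>M\<^esub>j\<in>{..<k}. r j \<odot>\<^bsub>M\<^esub> m j)" "\<And>j. j < k \<Longrightarrow> r j \<in> FR (i - p j)"
      unfolding F by blast
    have "r j \<odot>\<^bsub>M\<^esub> m j \<in> F2 (i + c)" if j: "j < k" for j
    proof -
      have "r j \<odot>\<^bsub>M\<^esub> m j \<in> F2 (i - p j + q j)" using F2 r(2)[OF j] q[OF j] unfolding filtration_def by blast
      moreover have "\<bar>q j - p j\<bar> \<le> c" unfolding c_def by (rule member_le_sum) (use j in auto)
      then have "i - p j + q j \<le> i + c" by linarith
      ultimately show ?thesis using F2.F_mono by blast
    qed
    then show "x \<in> F2 (i + c)" unfolding r(1) by (intro F2.finsum_F) auto
  qed
  moreover have "c \<ge> 0" unfolding c_def by (simp add: sum_nonneg)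
  ultimately show ?thesis by blast
qed

theorem rad_annihilator_gr_indep:
  assumes q: "quantization R \<Phi> \<omega> FR" and M: "left_mod R M"
    and good: "good_filtration FR M F" "good_filtration FR M F2"
  shows "rad (annihilator poly_ring (restrict_scalars (quantization.symbol R \<Phi> \<omega> FR) (gr_module FR M F))) =
    rad (annihilator poly_ring (restrict_scalars (quantization.symbol R \<Phi> \<omega> FR) (gr_module FR M F2)))"
proof -
  have fil: "filtration FR M F" "filtration FR M F2" using good by (auto simp: good_filtration_def)
  have Q: "quant_module R \<Phi> \<omega> FR M F" "quant_module R \<Phi> \<omega> FR M F2"
    using q M fil by (auto intro!: quant_module.intro quant_module_axioms.intro)
  have ag: "abelian_group M" using M by (simp add: left_mod_def)
  obtain c1 where c1: "c1 \<ge> 0" "\<And>i. F i \<subseteq> F2 (i + c1)"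
    using good_filtration_bound[OF good(1) ag fil(2)] by blast
  obtain c2 where c2: "c2 \<ge> 0" "\<And>i. F2 i \<subseteq> F (i + c2)"
    using good_filtration_bound[OF good(2) ag fil(1)] by blast
  define c where "c = max c1 c2"
  have mono: "mono F" "mono F2" using fil by (auto simp: filtration_def)
  have "F i \<subseteq> F2 (i + c)" "F2 i \<subseteq> F (i + c)" for i
    using c1(2)[of i] c2(2)[of i] monoD[OF mono(2), of "i + c1" "i + c"] monoD[OF mono(1), of "i + c2" "i + c"]
    by (auto simp: c_def)
  moreover have "c \<ge> 0" using c1 by (simp add: c_def)
  ultimately show ?thesis
    using rad_annihilator_mono[OF Q, of c] rad_annihilator_mono[OF Q(2,1), of c] by blast
qed

section \<open>Cyclic modules\<close>

locale quant_ideal = quantization R \<Phi> \<omega> FR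
  for R :: "'r ring" (structure) and \<Phi> :: "('k::field_char_0, 'v::finite) mpoly \<Rightarrow> 'r"
    and \<omega> :: "'v \<Rightarrow> nat" and FR :: "int \<Rightarrow> 'r set" +
  fixes L :: "'r set"
  assumes L: "left_ideal L R"
begin

sublocale Q: filtered_group R "\<lambda>_. L"
  using L by (intro filtered_group.intro filtered_group_axioms.intro R.abelian_group_axioms) (simp_all add: left_ideal_def)

abbreviation M where "M \<equiv> quot_module R L"

lemma quot_simps [simp]: "zero M = L" "add M = set_add R" "carrier M = a_rcosets L"
  by (simp_all add: quot_module_def)

lemma quot_carrier: "a_rcosets L = (\<lambda>a. L +> a) ` carrier R"
  by (auto simp: A_RCOSETS_def')

lemma L_mult: "r \<in> carrier R \<Longrightarrow> x \<in> L \<Longrightarrow> r \<otimes> x \<in> L"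
  using L by (simp add: left_ideal_def)

lemma quot_smult: "r \<in> carrier R \<Longrightarrow> a \<in> carrier R \<Longrightarrow> r \<odot>\<^bsub>M\<^esub> (L +> a) = L +> (r \<otimes> a)"
proof -
  assume r: "r \<in> carrier R" and a: "a \<in> carrier R"
  have "L +> (r \<otimes> a') = L +> (r \<otimes> a)" if a': "a' \<in> L +> a" for a'
  proof -
    obtain h where h: "h \<in> L" "a' = h \<oplus> a" using Q.mem_cls[OF a'] by blast
    then have "r \<otimes> a' = r \<otimes> h \<oplus> r \<otimes> a" using r a Q.F_carrier by (simp add: R.r_distr)
    then show ?thesis using Q.cls_absorb[OF L_mult[OF r h(1)]] r a by simp
  qed
  moreover have "a \<in> L +> a" using a by (rule Q.cls_self)
  ultimately have "(\<Union>a'\<in>L +> a. L +> (r \<otimes> a')) = L +> (r \<otimes> a)" by blast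
  then show ?thesis by (simp add: quot_module_def)
qed

lemma quot_left_mod: "left_mod R M"
proof -
  have ag: "abelian_group M"
  proof (rule abelian_groupI)
    fix x y z assume "x \<in> carrier M" "y \<in> carrier M" "z \<in> carrier M"
    then obtain a b c where c: "a \<in> carrier R" "b \<in> carrier R" "c \<in> carrier R"
      and eq: "x = L +> a" "y = L +> b" "z = L +> c" by (auto simp: quot_carrier)
    show "x \<oplus>\<^bsub>M\<^esub> y \<oplus>\<^bsub>M\<^esub> z = x \<oplus>\<^bsub>M\<^esub> (y \<oplus>\<^bsub>M\<^esub> z)" using c by (simp add: eq Q.cls_add R.a_assoc)
    show "x \<oplus>\<^bsub>M\<^esub> y = y \<oplus>\<^bsub>M\<^esub> x" using c by (simp add: eq Q.cls_add R.a_comm)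
    show "x \<oplus>\<^bsub>M\<^esub> y \<in> carrier M" using c by (simp add: eq Q.cls_add quot_carrier)
    have z: "L = L +> \<zero>" using Q.cls_zero[OF Q.F_zero] by simp
    have "L <+> (L +> a) = L +> a" using c by (subst z) (simp add: Q.cls_add)
    then show "\<zero>\<^bsub>M\<^esub> \<oplus>\<^bsub>M\<^esub> x = x" by (simp add: eq)
    have "(L +> \<ominus> a) \<oplus>\<^bsub>M\<^esub> x = \<zero>\<^bsub>M\<^esub>" using c by (simp add: eq Q.cls_add R.l_neg flip: z)
    moreover have "L +> \<ominus> a \<in> carrier M" using c by (simp add: quot_carrier)
    ultimately show "\<exists>y\<in>carrier M. y \<oplus>\<^bsub>M\<^esub> x = \<zero>\<^bsub>M\<^esub>" by (rule bexI)
  next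
    have "L = L +> \<zero>" using Q.cls_zero[OF Q.F_zero] by simp
    then show "\<zero>\<^bsub>M\<^esub> \<in> carrier M" unfolding quot_simps quot_carrier by (rule image_eqI) simp
  qed
  show ?thesis
  proof (intro left_mod.intro left_mod_axioms.intro ag R.ring_axioms)
    have ex: "\<exists>u\<in>carrier R. x = L +> u" if "x \<in> carrier M" for x
      using that by (auto simp: quot_carrier)
    fix x assume x: "x \<in> carrier M"
    obtain u where u: "u \<in> carrier R" "x = L +> u" using ex[OF x] by blast
    show "\<one> \<odot>\<^bsub>M\<^esub> x = x" using u by (simp add: quot_smult)
    fix a assume a: "a \<in> carrier R"
    show "a \<odot>\<^bsub>M\<^esub> x \<in> carrier M" using a u by (simp add: quot_smult quot_carrier)
    show "a \<odot>\<^bsub>M\<^esub> (x \<oplus>\<^bsub>M\<^esub> y) = a \<odot>\<^bsub>M\<^esub> x \<oplus>\<^bsub>M\<^esub> a \<odot>\<^bsub>M\<^esub> y" if y: "y \<in> carrier M" for y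
    proof -
      obtain v where "v \<in> carrier R" "y = L +> v" using ex[OF y] by blast
      then show ?thesis using a u by (simp add: quot_smult Q.cls_add R.r_distr)
    qed
    fix b assume b: "b \<in> carrier R"
    show "(a \<oplus> b) \<odot>\<^bsub>M\<^esub> x = a \<odot>\<^bsub>M\<^esub> x \<oplus>\<^bsub>M\<^esub> b \<odot>\<^bsub>M\<^esub> x"
      using a b u by (simp add: quot_smult Q.cls_add R.l_distr)
    show "(a \<otimes> b) \<odot>\<^bsub>M\<^esub> x = a \<odot>\<^bsub>M\<^esub> (b \<odot>\<^bsub>M\<^esub> x)"
      using a b u by (simp add: quot_smult R.m_assoc)
  qed
qed

text \<open>The filtration induced from the ring.\<close>

definition std_fil :: "int \<Rightarrow> 'r set set" where
  "std_fil i = (\<lambda>a. L +> a) ` FR i"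

lemma std_fil_filtration: "filtration FR M std_fil"
  unfolding filtration_def
proof (intro conjI allI ballI)
  interpret M: left_mod R M by (rule quot_left_mod)
  show "additive_subgroup (std_fil i) M" for i
  proof (rule additive_subgroupI, rule group.subgroupI[OF M.M.a_group])
    show "std_fil i \<subseteq> carrier (add_monoid M)"
      using G.F_carrier by (auto simp: std_fil_def quot_carrier)
    show "std_fil i \<noteq> {}" using G.F_zero by (auto simp: std_fil_def)
  next
    fix x assume "x \<in> std_fil i"
    then obtain a where a: "a \<in> FR i" "x = L +> a" by (auto simp: std_fil_def)
    then have c: "a \<in> carrier R" using G.F_carrier by blast
    have "(L +> \<ominus> a) \<oplus>\<^bsub>M\<^esub> x = \<zero>\<^bsub>M\<^esub>"
      using c Q.cls_zero[OF Q.F_zero] by (simp add: a Q.cls_add R.l_neg)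
    then have "\<ominus>\<^bsub>M\<^esub> x = L +> \<ominus> a"
      by (rule M.M.minus_equality) (use c in \<open>simp_all add: a quot_carrier\<close>)
    then show "inv\<^bsub>add_monoid M\<^esub> x \<in> std_fil i"
      using G.F_uminus[OF a(1)] by (simp add: std_fil_def a_inv_def)
  next
    fix x y assume "x \<in> std_fil i" "y \<in> std_fil i"
    then obtain a b where a: "a \<in> FR i" "x = L +> a" "b \<in> FR i" "y = L +> b" by (auto simp: std_fil_def)
    then have "x \<oplus>\<^bsub>M\<^esub> y = L +> (a \<oplus> b)" using G.F_carrier by (simp add: Q.cls_add)
    then show "x \<otimes>\<^bsub>add_monoid M\<^esub> y \<in> std_fil i" using G.F_add[OF a(1,3)] by (simp add: std_fil_def)
  qed
  show "mono std_fil" unfolding mono_def std_fil_def using G.F_mono by (simp add: image_mono)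
  have "carrier R = (\<Union>i. FR i)" 
  proof -
    have "\<exists>i. p \<in> poly_fil \<omega> i" for p by (rule poly_fil_exhaustive)
    then have "\<Phi> p \<in> (\<Union>i. FR i)" for p using Phi_mem by auto
    then have "range \<Phi> \<subseteq> (\<Union>i. FR i)" by blast
    moreover have "(\<Union>i. FR i) \<subseteq> carrier R" using G.F_carrier by blast
    ultimately show ?thesis using Phi_range by simp
  qed
  then show "(\<Union>i. std_fil i) = carrier M" by (simp add: std_fil_def quot_carrier image_UN)
  show "r \<odot>\<^bsub>M\<^esub> m \<in> std_fil (i + j)" if r: "r \<in> FR i" and m: "m \<in> std_fil j" for i j r m
  proof -
    obtain a where a: "a \<in> FR j" "m = L +> a" using m by (auto simp: std_fil_def)
    then have "r \<odot>\<^bsub>M\<^esub> m = L +> (r \<otimes> a)" using r G.F_carrier by (simp add: quot_smult)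
    then show ?thesis using FR_mult[OF r a(1)] by (simp add: std_fil_def)
  qed
qed

lemma std_fil_good: "good_filtration FR M std_fil"
  unfolding good_filtration_def
proof (intro conjI exI allI)
  interpret M: left_mod R M by (rule quot_left_mod)
  let ?m = "\<lambda>_::nat. L +> \<one>"
  show "filtration FR M std_fil" by (rule std_fil_filtration)
  show "j < 1 \<longrightarrow> ?m j \<in> carrier M" for j :: nat by (simp add: quot_carrier)
  have sm: "r \<odot>\<^bsub>M\<^esub> (L +> \<one>) = L +> r" if "r \<in> carrier R" for r using that by (simp add: quot_smult)
  have fs: "(\<Oplus>\<^bsub>M\<^esub>j\<in>{..<1::nat}. r j \<odot>\<^bsub>M\<^esub> ?m j) = L +> r 0" if "r 0 \<in> carrier R" for r
  proof -
    have "{..<1::nat} = {0}" by auto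
    moreover have "r 0 \<odot>\<^bsub>M\<^esub> (L +> \<one>) \<in> carrier M" using that by (simp add: sm quot_carrier)
    ultimately show ?thesis using sm[OF that] by (simp add: M.M.finsum_insert del: quot_simps)
  qed
  show "std_fil i = {(\<Oplus>\<^bsub>M\<^esub>j\<in>{..<1::nat}. r j \<odot>\<^bsub>M\<^esub> ?m j) | r. \<forall>j<1. r j \<in> FR (i - (\<lambda>_. 0) j)}" for i
  proof (intro equalityI subsetI)
    fix x assume "x \<in> std_fil i"
    then obtain a where a: "a \<in> FR i" "x = L +> a" by (auto simp: std_fil_def)
    then show "x \<in> {(\<Oplus>\<^bsub>M\<^esub>j\<in>{..<1::nat}. r j \<odot>\<^bsub>M\<^esub> ?m j) | r. \<forall>j<1. r j \<in> FR (i - (\<lambda>_. 0) j)}"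
      using fs[of "\<lambda>_. a"] G.F_carrier by (intro CollectI exI[of _ "\<lambda>_. a"]) simp
  next
    fix x assume "x \<in> {(\<Oplus>\<^bsub>M\<^esub>j\<in>{..<1::nat}. r j \<odot>\<^bsub>M\<^esub> ?m j) | r. \<forall>j<1. r j \<in> FR (i - (\<lambda>_. 0) j)}"
    then obtain r where r: "x = (\<Oplus>\<^bsub>M\<^esub>j\<in>{..<1::nat}. r j \<odot>\<^bsub>M\<^esub> ?m j)" "r 0 \<in> FR i" by auto
    then have "x = L +> r 0" using fs G.F_carrier by blast
    then show "x \<in> std_fil i" using r(2) by (simp add: std_fil_def)
  qed
qed

sublocale S: quant_module R \<Phi> \<omega> FR M std_fil
  by (intro quant_module.intro quant_module_axioms.intro quantization_axioms quot_left_mod std_fil_filtration)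

text \<open>
  For the inclusion from left to right, apply the operator to the generator \<open>L +> \<one>\<close>. For the other one, the
  operator \<open>\<Phi> p\<close> must be moved to the right of \<open>\<Phi> w\<close> before \<open>L\<close> absorbs it, which is
  possible in the highest degree because the graded ring is commutative.
\<close>

theorem annihilator_std_fil: "annihilator poly_ring S.gr = ini \<omega> {x. \<Phi> x \<in> L}"
proof (intro equalityI subsetI)
  fix p assume "p \<in> annihilator poly_ring S.gr"
  then have p: "\<And>d i m. m \<in> std_fil i \<Longrightarrow> \<Phi> (hpart \<omega> d p) \<odot>\<^bsub>M\<^esub> m \<in> std_fil (i + d - 1)"
    unfolding S.annihilator_gr by blast
  have "\<exists>x\<in>{x. \<Phi> x \<in> L}. x - hpart \<omega> d p \<in> poly_fil \<omega> (d - 1)" for d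
  proof -
    have "L +> \<one> \<in> std_fil 0"
    proof -
      have "\<one> \<in> FR 0" using Phi_mem[of 1 0] poly_fil_one[of \<omega>] by (simp add: Phi_one)
      then show ?thesis unfolding std_fil_def by (rule imageI)
    qed
    from p[OF this, of d] have "L +> \<Phi> (hpart \<omega> d p) \<in> std_fil (d - 1)" by (simp add: quot_smult)
    then obtain y where y: "y \<in> poly_fil \<omega> (d - 1)" "L +> \<Phi> (hpart \<omega> d p) = L +> \<Phi> y"
      unfolding std_fil_def FR_eq by blast
    have "\<Phi> (hpart \<omega> d p) \<in> L +> \<Phi> y" using Q.cls_self[OF Phi_closed] y(2) by blast
    then obtain h where h: "h \<in> L" "\<Phi> (hpart \<omega> d p) = h \<oplus> \<Phi> y" using Q.mem_cls by blast
    obtain x where x: "h = \<Phi> x" using h(1) Q.F_carrier Phi_range by blast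
    have "\<Phi> (hpart \<omega> d p) = \<Phi> (x + y)" using h x by (simp add: Phi_add)
    then have "hpart \<omega> d p = x + y" using Phi_inj by (rule injD[rotated])
    then show ?thesis using h(1) x y(1) by (intro bexI[of _ x]) auto
  qed
  then show "p \<in> ini \<omega> {x. \<Phi> x \<in> L}" unfolding ini_def by blast
next
  fix p assume p: "p \<in> ini \<omega> {x. \<Phi> x \<in> L}"
  show "p \<in> annihilator poly_ring S.gr"
    unfolding S.annihilator_gr
  proof (intro allI ballI)
    fix d i m assume "m \<in> std_fil i"
    then obtain w where w: "w \<in> poly_fil \<omega> i" "m = L +> \<Phi> w" unfolding std_fil_def FR_eq by blast
    let ?p = "hpart \<omega> d p"
    obtain x where x: "\<Phi> x \<in> L" "x - ?p \<in> poly_fil \<omega> (d - 1)" using p unfolding ini_def by blast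
    let ?y = "?p - x"
    have y: "?y \<in> poly_fil \<omega> (d - 1)" using x(2) poly_fil_uminus[of "x - ?p"] by simp
    obtain r where r: "r \<in> poly_fil \<omega> (d + i - 1)" "\<Phi> ?p \<otimes> \<Phi> w = \<Phi> (?p * w) \<oplus> \<Phi> r"
      using Phi_mult[OF hpart_in_fil w(1)] by blast
    obtain r' where r': "r' \<in> poly_fil \<omega> (i + d - 1)" "\<Phi> w \<otimes> \<Phi> ?p = \<Phi> (w * ?p) \<oplus> \<Phi> r'"
      using Phi_mult[OF w(1) hpart_in_fil] by blast
    have wy: "\<Phi> w \<otimes> \<Phi> ?y \<in> FR (i + d - 1)"
      using FR_mult[of "\<Phi> w" i "\<Phi> ?y" "d - 1"] w(1) y by (simp add: Phi_mem algebra_simps)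
    have rr: "\<Phi> (r - r') \<in> FR (i + d - 1)"
      using r(1) r'(1) poly_fil_diff by (simp add: Phi_mem add.commute)
    have "\<Phi> ?p \<otimes> \<Phi> w = \<Phi> w \<otimes> \<Phi> ?p \<oplus> \<Phi> (r - r')"
    proof -
      have "\<Phi> w \<otimes> \<Phi> ?p \<oplus> \<Phi> (r - r') = \<Phi> (w * ?p + r' + (r - r'))" by (simp only: r'(2) Phi_add)
      also have "\<dots> = \<Phi> ?p \<otimes> \<Phi> w" by (simp add: r(2) mult.commute flip: Phi_add)
      finally show ?thesis by simp
    qed
    also have "\<Phi> w \<otimes> \<Phi> ?p = \<Phi> w \<otimes> \<Phi> x \<oplus> \<Phi> w \<otimes> \<Phi> ?y"
      using Phi_add[of x ?y] by (simp flip: R.r_distr)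
    finally have eq: "\<Phi> ?p \<otimes> \<Phi> w = \<Phi> w \<otimes> \<Phi> x \<oplus> (\<Phi> w \<otimes> \<Phi> ?y \<oplus> \<Phi> (r - r'))"
      by (simp add: R.a_assoc)
    have "\<Phi> ?p \<odot>\<^bsub>M\<^esub> m = L +> (\<Phi> w \<otimes> \<Phi> x \<oplus> (\<Phi> w \<otimes> \<Phi> ?y \<oplus> \<Phi> (r - r')))"
      unfolding w(2) by (subst quot_smult) (simp_all add: eq)
    also have "\<dots> = L +> (\<Phi> w \<otimes> \<Phi> ?y \<oplus> \<Phi> (r - r'))"
      by (rule Q.cls_absorb) (simp_all add: L_mult x(1))
    finally show "\<Phi> ?p \<odot>\<^bsub>M\<^esub> m \<in> std_fil (i + d - 1)"
      using G.F_add[OF wy rr] by (simp add: std_fil_def)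
  qed
qed

end

section \<open>Graded modules over the polynomial ring\<close>

text \<open>
  A form of the Cayley-Hamilton theorem with degrees: \<open>s\<close> gives the degrees of the generators \<open>m\<close>, and
  \<open>q\<close> maps each generator to a combination of generators whose degree is lower than expected. The
  determinant of \<open>q - a\<close> would serve as \<open>z\<close>, with \<open>k = r\<close>; eliminating one generator after the other
  avoids determinants, at the cost of a larger \<open>k\<close>.
\<close>

lemma eliminate_generators:
  fixes N :: "(('k::field_char_0, 'v::finite) mpoly, 'm) module" (structure)
    and m :: "nat \<Rightarrow> 'm" and s :: "nat \<Rightarrow> int"
  assumes N: "left_mod poly_ring N" and m: "\<And>j. j < r \<Longrightarrow> m j \<in> carrier N"
    and q: "q \<in> poly_fil \<nu> d"
    and rel: "\<And>j. j < r \<Longrightarrow> q \<odot> m j = left_mod.lincomb N r (a j) m"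
    and a: "\<And>j l. j < r \<Longrightarrow> l < r \<Longrightarrow> a j l \<in> poly_fil \<nu> (d + s j - s l - 1)"
  shows "\<exists>z k. z - q ^ k \<in> poly_fil \<nu> (int k * d - 1) \<and> (\<forall>j<r. z \<odot> m j = \<zero>)"
  using m q rel a
proof (induction r arbitrary: q d a)
  case 0
  then show ?case by (intro exI[of _ 1] exI[of _ 0]) simp
next
  case (Suc r)
  interpret left_mod poly_ring N by (rule N)
  note mod = smult_closed[simplified] smult_l_distr[simplified] smult_r_distr[simplified] smult_assoc[simplified]
  have mc: "m j \<in> carrier N" if "j < Suc r" for j using Suc.prems(1) that by blast
  note LC_closed = lincomb_closed[of _ r m, simplified]
  note LC_Suc = lincomb_Suc[of _ r m, simplified, OF mc]
  note LC_add = lincomb_add[of _ _ r m, simplified]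
  note LC_smult = lincomb_smult[of _ _ r m, simplified]
  have c: "m l \<in> carrier N" if "l < r" for l using mc that by simp
  define t where "t = q - a r r"
  have arr: "a r r \<in> poly_fil \<nu> (d - 1)" using Suc.prems(4)[of r r] by simp
  have t: "t \<in> poly_fil \<nu> d"
    unfolding t_def using Suc.prems(2) arr poly_fil_mono[of "d - 1" d \<nu>] by (intro poly_fil_diff) auto
  \<comment> \<open>the last relation solved for the last generator\<close>
  have tm: "t \<odot> m r = lincomb r (a r) m"
  proof -
    have "a r r \<odot> m r \<oplus> t \<odot> m r = q \<odot> m r" using mod(2)[of "m r" "a r r" t] mc by (simp add: t_def)
    also have "\<dots> = a r r \<odot> m r \<oplus> lincomb r (a r) m" using Suc.prems(3)[of r] LC_Suc[of "a r"] by simp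
    finally have "\<ominus> (a r r \<odot> m r) \<oplus> (a r r \<odot> m r \<oplus> t \<odot> m r) =
      \<ominus> (a r r \<odot> m r) \<oplus> (a r r \<odot> m r \<oplus> lincomb r (a r) m)" by simp
    then show ?thesis using mod(1) mc LC_closed[OF c] by (simp add: M.r_neg1)
  qed
  \<comment> \<open>multiplying the other relations by \<open>t\<close> removes the last generator from them\<close>
  define a' where "a' j l = t * a j l + a j r * a r l" for j l
  have rel': "(t * q) \<odot> m j = lincomb r (a' j) m" if j: "j < r" for j
  proof -
    have "(t * q) \<odot> m j = t \<odot> (a j r \<odot> m r \<oplus> lincomb r (a j) m)"
      using Suc.prems(3)[of j] LC_Suc[of "a j"] j mc by (simp add: mod(4))
    also have "\<dots> = t \<odot> (a j r \<odot> m r) \<oplus> t \<odot> lincomb r (a j) m"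
      by (rule mod(3)) (simp_all add: mod(1) mc LC_closed c)
    also have "t \<odot> (a j r \<odot> m r) = a j r \<odot> (t \<odot> m r)"
      using mod(4)[of "m r" t "a j r"] mod(4)[of "m r" "a j r" t] mc by (simp add: mult.commute)
    also have "\<dots> = lincomb r (\<lambda>l. a j r * a r l) m" unfolding tm by (rule LC_smult) (rule c)
    also have "t \<odot> lincomb r (a j) m = lincomb r (\<lambda>l. t * a j l) m" by (rule LC_smult) (rule c)
    also have "lincomb r (\<lambda>l. a j r * a r l) m \<oplus> lincomb r (\<lambda>l. t * a j l) m = lincomb r (a' j) m"
      using LC_add[OF c, of "\<lambda>l. a j r * a r l" "\<lambda>l. t * a j l"] by (simp add: a'_def[abs_def] add.commute)
    finally show ?thesis .
  qed
  have q': "t * q \<in> poly_fil \<nu> (2 * d)" using poly_fil_mult[OF t Suc.prems(2)] by simp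
  have a': "a' j l \<in> poly_fil \<nu> (2 * d + s j - s l - 1)" if "j < r" "l < r" for j l
  proof -
    have "t * a j l \<in> poly_fil \<nu> (d + (d + s j - s l - 1))"
      by (intro poly_fil_mult t Suc.prems(4)) (use that in auto)
    moreover have "a j r * a r l \<in> poly_fil \<nu> ((d + s j - s r - 1) + (d + s r - s l - 1))"
      by (intro poly_fil_mult Suc.prems(4)) (use that in auto)
    then have "a j r * a r l \<in> poly_fil \<nu> (2 * d + s j - s l - 1)"
      by (rule subsetD[OF poly_fil_mono, rotated]) simp
    ultimately show ?thesis unfolding a'_def by (intro poly_fil_add) (simp_all add: algebra_simps)
  qed
  obtain z k where z: "z - (t * q) ^ k \<in> poly_fil \<nu> (int k * (2 * d) - 1)" "\<And>j. j < r \<Longrightarrow> z \<odot> m j = \<zero>"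
    using Suc.IH[OF _ q' rel' a'] mc by auto
  \<comment> \<open>\<open>z * t\<close> kills all generators, and agrees with \<open>q ^ (2 * k + 1)\<close> in top degree\<close>
  have tq: "t - q \<in> poly_fil \<nu> (d - 1)" using arr by (simp add: t_def)
  have "(t - q) * q \<in> poly_fil \<nu> (d - 1 + d)" by (rule poly_fil_mult[OF tq Suc.prems(2)])
  then have "t * q - q ^ 2 \<in> poly_fil \<nu> (2 * d - 1)" by (simp add: power2_eq_square left_diff_distrib)
  moreover have q2: "q ^ 2 \<in> poly_fil \<nu> (2 * d)" using poly_fil_power[OF Suc.prems(2), of 2] by simp
  ultimately have "(t * q) ^ k - (q ^ 2) ^ k \<in> poly_fil \<nu> (int k * (2 * d) - 1)" by (rule poly_fil_power_diff)
  from poly_fil_add[OF z(1) this] have z1: "z - q ^ (2 * k) \<in> poly_fil \<nu> (int k * (2 * d) - 1)"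
    by (simp add: power_mult)
  have "(z - q ^ (2 * k)) * t \<in> poly_fil \<nu> (int k * (2 * d) - 1 + d)" by (rule poly_fil_mult[OF z1 t])
  moreover have "q ^ (2 * k) * (t - q) \<in> poly_fil \<nu> (int (2 * k) * d + (d - 1))"
    by (rule poly_fil_mult[OF poly_fil_power[OF Suc.prems(2)] tq])
  ultimately have "(z - q ^ (2 * k)) * t + q ^ (2 * k) * (t - q) \<in> poly_fil \<nu> (int (Suc (2 * k)) * d - 1)"
    by (intro poly_fil_add) (simp_all add: algebra_simps)
  moreover have "(z - q ^ (2 * k)) * t + q ^ (2 * k) * (t - q) = z * t - q ^ Suc (2 * k)"
    by (simp add: left_diff_distrib right_diff_distrib mult.commute)
  ultimately have fil: "z * t - q ^ Suc (2 * k) \<in> poly_fil \<nu> (int (Suc (2 * k)) * d - 1)" by simp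
  have "(z * t) \<odot> m j = \<zero>" if "j < Suc r" for j
  proof (cases "j = r")
    case True
    have "(z * t) \<odot> m r = lincomb r (\<lambda>l. z * a r l) m"
      using LC_smult[OF c, of z "a r"] mc by (simp add: mod(4) tm)
    also have "\<dots> = \<zero>"
    proof (rule lincomb_zero)
      show "(z * a r l) \<odot> m l = \<zero>" if "l < r" for l
        using mod(4)[OF c[OF that], of "a r l" z] z(2)[OF that] smult_zero_r by (simp add: mult.commute)
    qed
    finally show ?thesis using True by simp
  next
    case False
    have "(t * z) \<odot> m j = \<zero>" using False that mc z(2) smult_zero_r by (simp add: mod(4))
    then show ?thesis by (simp add: mult.commute)
  qed
  then show ?case using fil by blast
qed

lemma quantization_poly: "quantization poly_ring (\<lambda>p. p) \<nu> (poly_fil \<nu>)"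
  by (intro quantization.intro quantization_axioms.intro ring_poly) (auto intro!: bexI[of _ 0])

text \<open>
  A leading form of an element that kills \<open>N\<close> kills the graded module. Conversely, a homogeneous \<open>q\<close> that
  kills the graded module raises the degrees of the generators of \<open>N\<close> by less than its own degree, and the
  elimination above provides an element of the annihilator of \<open>N\<close> with leading form \<open>q ^ n\<close>.
\<close>

theorem rad_annihilator_poly_gr:
  fixes N :: "(('k::field_char_0, 'v::finite) mpoly, 'm) module" (structure)
  assumes N: "left_mod poly_ring N" and good: "good_filtration (poly_fil \<nu>) N F"
  shows "rad (annihilator poly_ring (restrict_scalars (quantization.symbol poly_ring (\<lambda>p. p) \<nu> (poly_fil \<nu>)) (gr_module (poly_fil \<nu>) N F))) =
    rad (ini \<nu> (annihilator poly_ring N))"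
proof -
  have fil: "filtration (poly_fil \<nu>) N F" using good by (simp add: good_filtration_def)
  interpret quant_module poly_ring "\<lambda>p. p" \<nu> "poly_fil \<nu>" N F
    by (intro quant_module.intro quant_module_axioms.intro quantization_poly N fil)
  let ?J = "annihilator poly_ring N"
  have ideal: "poly_ideal ?J" by (rule annihilator_ideal[OF N])
  have "ini \<nu> ?J \<subseteq> annihilator poly_ring gr"
  proof
    fix p assume p: "p \<in> ini \<nu> ?J"
    show "p \<in> annihilator poly_ring gr"
      unfolding annihilator_gr
    proof (intro allI ballI)
      fix d i m assume m: "m \<in> F i"
      then have mc: "m \<in> carrier N" by (rule B.M.F_carrier)
      obtain x where x: "x \<in> ?J" "x - hpart \<nu> d p \<in> poly_fil \<nu> (d - 1)" using p unfolding ini_def by blast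
      have "hpart \<nu> d p - x \<in> poly_fil \<nu> (d - 1)" using x(2) poly_fil_uminus[of "x - hpart \<nu> d p"] by simp
      then have "(hpart \<nu> d p - x) \<odot> m \<in> F (i + d - 1)"
        using B.f_fil[OF _ m, of "hpart \<nu> d p - x" "d - 1"] by (simp add: add.commute[of i] diff_add_eq)
      moreover have "hpart \<nu> d p \<odot> m = (hpart \<nu> d p - x) \<odot> m \<oplus> x \<odot> m"
        using smult_l_distr[of "hpart \<nu> d p - x" x m] mc by simp
      moreover have "x \<odot> m = \<zero>" using x(1) mc by (simp add: annihilator_def)
      ultimately show "hpart \<nu> d p \<odot> m \<in> F (i + d - 1)"
        using smult_closed[of "hpart \<nu> d p - x" m] mc by simp
    qed
  qed
  moreover have "annihilator poly_ring gr \<subseteq> rad (ini \<nu> ?J)"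
  proof
    fix p assume p: "p \<in> annihilator poly_ring gr"
    obtain k and m :: "nat \<Rightarrow> 'm" and s where m: "\<And>j. j < k \<Longrightarrow> m j \<in> carrier N"
      and F: "\<And>i. F i = {lincomb k r m | r. \<forall>j<k. r j \<in> poly_fil \<nu> (i - s j)}"
      using good unfolding good_filtration_def lincomb_def by blast
    have mF: "m j \<in> F (s j)" if j: "j < k" for j
    proof -
      let ?r = "\<lambda>l. if j = l then 1 else 0 :: ('k, 'v) mpoly"
      have "lincomb k ?r m = (\<Oplus>l\<in>{..<k}. if j = l then m l else \<zero>)"
        unfolding lincomb_def by (rule M.finsum_cong'[OF refl]) (use m smult_one smult_zero_l in auto)
      also have "\<dots> = m j" by (rule M.finsum_singleton) (use m j in auto)
      finally have "m j = lincomb k ?r m" by simp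
      moreover have "\<forall>l<k. ?r l \<in> poly_fil \<nu> (s j - s l)" by (simp add: poly_fil_one)
      ultimately show ?thesis unfolding F by (intro CollectI exI[of _ ?r] conjI)
    qed
    have "hpart \<nu> d p \<in> rad (ini \<nu> ?J)" for d
    proof -
      let ?q = "hpart \<nu> d p"
      have "\<forall>j\<in>{..<k}. \<exists>a. ?q \<odot> m j = lincomb k a m \<and>
          (\<forall>l<k. a l \<in> poly_fil \<nu> (s j + d - 1 - s l))"
      proof
        fix j assume "j \<in> {..<k}"
        then have "m j \<in> F (s j)" using mF by simp
        then have "?q \<odot> m j \<in> F (s j + d - 1)" using p unfolding annihilator_gr by blast
        then show "\<exists>a. ?q \<odot> m j = lincomb k a m \<and>
          (\<forall>l<k. a l \<in> poly_fil \<nu> (s j + d - 1 - s l))" unfolding F by blast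
      qed
      from bchoice[OF this] obtain a where "\<forall>j\<in>{..<k}. ?q \<odot> m j = lincomb k (a j) m \<and>
          (\<forall>l<k. a j l \<in> poly_fil \<nu> (s j + d - 1 - s l))" ..
      then have a: "\<And>j. j < k \<Longrightarrow> ?q \<odot> m j = lincomb k (a j) m"
        "\<And>j l. j < k \<Longrightarrow> l < k \<Longrightarrow> a j l \<in> poly_fil \<nu> (s j + d - 1 - s l)" by simp_all
      have a2: "a j l \<in> poly_fil \<nu> (d + s j - s l - 1)" if "j < k" "l < k" for j l
        using a(2)[OF that] by (simp add: algebra_simps)
      obtain z n where z: "z - ?q ^ n \<in> poly_fil \<nu> (int n * d - 1)" "\<forall>j<k. z \<odot> m j = \<zero>"
        using eliminate_generators[OF N m hpart_in_fil a(1) a2] by blast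
      have "z \<odot> x = \<zero>" if x: "x \<in> carrier N" for x
      proof -
        obtain i where "x \<in> F i" using x fil unfolding filtration_def by blast
        then obtain r where "x = lincomb k r m" unfolding F by blast
        then have "z \<odot> x = lincomb k (\<lambda>l. z * r l) m" using lincomb_smult[of z r k m] m by simp
        also have "\<dots> = \<zero>"
        proof (rule lincomb_zero)
          show "(z * r l) \<odot> m l = \<zero>" if "l < k" for l
            using smult_assoc[of "r l" z "m l"] m[OF that] z(2) that smult_zero_r by (simp add: mult.commute)
        qed
        finally show ?thesis .
      qed
      then have "z \<in> ?J" by (simp add: annihilator_def)
      moreover have "hpart \<nu> (int n * d) (?q ^ n) = ?q ^ n" by (rule hpart_power) (simp add: hpart_hpart)
      ultimately have "?q ^ n \<in> ini \<nu> ?J" using z(1) ideal by (intro ini_homI) (auto simp: poly_ideal_def)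
      then show ?thesis by (auto simp: rad_def)
    qed
    then show "p \<in> rad (ini \<nu> ?J)" by (rule rad_hom[OF ini_ideal[OF ideal]])
  qed
  ultimately show ?thesis
  proof (intro equalityI subsetI)
    fix p assume sub: "annihilator poly_ring gr \<subseteq> rad (ini \<nu> ?J)" and "p \<in> rad (annihilator poly_ring gr)"
    then obtain k where "p ^ k \<in> annihilator poly_ring gr" by (auto simp: rad_def)
    then show "p \<in> rad (ini \<nu> ?J)" using sub rad_power by blast
  next
    fix p assume "ini \<nu> ?J \<subseteq> annihilator poly_ring gr" and "p \<in> rad (ini \<nu> ?J)"
    then show "p \<in> rad (annihilator poly_ring gr)" by (auto simp: rad_def)
  qed
qed

section \<open>Normal orderings\<close>

locale normal_order =
  fixes r :: "('v::finite expo \<times> 'v expo) set"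
  assumes normal: "normal_ordering r"
begin

lemma refl [simp]: "(a, a) \<in> r"
  using normal by (auto simp: normal_ordering_def order_on_defs refl_on_def)

lemma trans: "(a, b) \<in> r \<Longrightarrow> (b, c) \<in> r \<Longrightarrow> (a, c) \<in> r"
  using normal by (auto simp: normal_ordering_def order_on_defs dest: transD)

lemma antisym: "(a, b) \<in> r \<Longrightarrow> (b, a) \<in> r \<Longrightarrow> a = b"
  using normal by (auto simp: normal_ordering_def order_on_defs dest: antisymD)

lemma total: "(a, b) \<in> r \<or> (b, a) \<in> r"
  using normal refl by (cases "a = b") (auto simp: normal_ordering_def order_on_defs total_on_def)

lemma add_mono: "(a, b) \<in> r \<Longrightarrow> (c + a, c + b) \<in> r"
  using normal by (auto simp: normal_ordering_def add.commute)

lemma add_right: "(a, a + h) \<in> r"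
proof -
  have "(0, h) \<in> r" using normal by (simp add: normal_ordering_def)
  then show ?thesis using add_mono[of 0 h a] by simp
qed

text \<open>A normal ordering refines divisibility, so an infinite descent would contradict Dickson's lemma.\<close>

lemma wf_strict: "wf (r - Id)"
proof (rule ccontr)
  assume "\<not> wf (r - Id)"
  then obtain e where e: "\<And>i. (e (Suc i), e i) \<in> r - Id" unfolding wf_iff_no_infinite_down_chain by blast
  have dec: "(e j, e i) \<in> r" if "i \<le> j" for i j
    using that by (induction j rule: dec_induct) (use e trans in auto)
  obtain i j h where ij: "i < j" "e j = e i + h" using dickson_seq[of e] by blast
  have "(e i, e j) \<in> r" unfolding ij(2) by (rule add_right)
  then have "(e i, e (Suc i)) \<in> r" using dec[of "Suc i" j] ij(1) trans by auto
  then have "e (Suc i) = e i" using e[of i] antisym by auto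
  then show False using e[of i] by simp
qed

lemma greatest_ex:
  assumes "finite K" "K \<noteq> {}"
  shows "\<exists>t\<in>K. \<forall>e\<in>K. (e, t) \<in> r"
  using assms
proof (induction K rule: finite_ne_induct)
  case (insert x K)
  then obtain t where t: "t \<in> K" "\<forall>e\<in>K. (e, t) \<in> r" by blast
  show ?case
  proof (cases "(x, t) \<in> r")
    case True
    then show ?thesis using t by (intro bexI[of _ t]) auto
  next
    case False
    then have "(t, x) \<in> r" using total by blast
    then show ?thesis using t trans by (intro bexI[of _ x]) auto
  qed
qed simp

end

definition lead :: "('v expo \<times> 'v expo) set \<Rightarrow> ('k::field_char_0, 'v) mpoly \<Rightarrow> 'v expo" where
  "lead r p = (THE e. e \<in> keys p \<and> (\<forall>e'\<in>keys p. (e', e) \<in> r))"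

lemma (in normal_order) lead:
  assumes "p \<noteq> 0"
  shows "lead r p \<in> keys p" "e \<in> keys p \<Longrightarrow> (e, lead r p) \<in> r"
proof -
  have "keys p \<noteq> {}" using assms by simp
  then obtain t where t: "t \<in> keys p" "\<forall>e\<in>keys p. (e, t) \<in> r" using greatest_ex[of "keys p"] by auto
  have "lead r p = t" unfolding lead_def
    by (rule the_equality) (use t antisym in auto)
  then show "lead r p \<in> keys p" "e \<in> keys p \<Longrightarrow> (e, lead r p) \<in> r" using t by auto
qed

lemma LM_Phi: "LM r (Phi p) = single (lead r p) 1"
  by (simp add: LM_def lead_def supp_def)

section \<open>Normal orderings refining weights\<close>

text \<open>The weights are compared in turn; lists are ordered lexicographically.\<close>

definition weight_order :: "('v \<Rightarrow> nat) list \<Rightarrow> ('v::finite expo \<times> 'v expo) set" where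
  "weight_order ws = {(a, b). map (\<lambda>w. wdot w a) ws \<le> map (\<lambda>w. wdot w b) ws}"

lemma weight_order_normal:
  assumes sep: "\<And>a b. (\<And>w. w \<in> set ws \<Longrightarrow> wdot w a = wdot w b) \<Longrightarrow> a = b"
  shows "normal_ordering (weight_order ws)"
proof -
  have "linear_order (weight_order ws)"
  proof (unfold order_on_defs, intro conjI)
    show "antisym (weight_order ws)"
    proof (rule antisymI)
      fix a b assume "(a, b) \<in> weight_order ws" "(b, a) \<in> weight_order ws"
      then have "map (\<lambda>w. wdot w a) ws = map (\<lambda>w. wdot w b) ws" by (auto simp: weight_order_def)
      then show "a = b" by (intro sep) simp
    qed
  qed (auto simp: weight_order_def refl_on_def total_on_def intro!: transI)
  moreover have "(0, e) \<in> weight_order ws" for e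
    unfolding weight_order_def by (induction ws) auto
  moreover have "(a + c, b + c) \<in> weight_order ws" if "(a, b) \<in> weight_order ws" for a b c
    using that unfolding weight_order_def by (induction ws) (auto simp: wdot_add)
  ultimately show ?thesis by (simp add: normal_ordering_def)
qed

text \<open>The coordinate functions as weights, in some order; they serve to break ties.\<close>

definition coords :: "('v::finite \<Rightarrow> nat) list" where
  "coords = (SOME ws. set ws = (\<lambda>v u. if u = v then 1 else 0) ` UNIV)"

lemma set_coords: "set (coords :: ('v::finite \<Rightarrow> nat) list) = (\<lambda>v u. if u = v then 1 else 0) ` UNIV"
proof -
  have "finite ((\<lambda>v u. if u = v then 1 else 0 :: nat) ` (UNIV :: 'v set))" by simp
  from finite_list[OF this] show ?thesis unfolding coords_def by (rule someI_ex)
qed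

definition lex_order :: "('v::finite \<Rightarrow> nat) \<Rightarrow> ('v \<Rightarrow> nat) \<Rightarrow> ('v expo \<times> 'v expo) set" where
  "lex_order \<alpha> \<beta> = weight_order (\<alpha> # \<beta> # coords)"

lemma lex_order_normal:
  fixes \<alpha> \<beta> :: "'v::finite \<Rightarrow> nat"
  shows "normal_ordering (lex_order \<alpha> \<beta>)"
  unfolding lex_order_def
proof (rule weight_order_normal)
  fix a b :: "'v expo"
  assume w: "\<And>w. w \<in> set (\<alpha> # \<beta> # coords) \<Longrightarrow> wdot w a = wdot w b"
  show "a = b"
  proof (rule poly_mapping_eqI)
    fix v :: 'v
    let ?w = "\<lambda>u::'v. if u = v then 1 else 0 :: nat"
    have c: "wdot ?w e = lookup e v" for e :: "'v expo"
    proof -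
      have "wdot ?w e = (\<Sum>u\<in>UNIV. if u = v then lookup e u else 0)"
        unfolding wdot_def by (intro sum.cong) auto
      then show ?thesis by simp
    qed
    have "?w \<in> set (\<alpha> # \<beta> # coords)" by (simp add: set_coords)
    from w[OF this] show "lookup a v = lookup b v" by (simp add: c)
  qed
qed

lemma lex_orderD:
  assumes "(a, b) \<in> lex_order \<alpha> \<beta>"
  shows "wdot \<alpha> a \<le> wdot \<alpha> b" "wdot \<alpha> a = wdot \<alpha> b \<Longrightarrow> wdot \<beta> a \<le> wdot \<beta> b"
  using assms by (auto simp: lex_order_def weight_order_def)

section \<open>Division in the Weyl algebra\<close>

lemma below_wdot:
  assumes "\<omega> \<in> Omega" "below g e"
  shows "wdot \<omega> g < wdot \<omega> e"
proof -
  obtain h where h: "h \<noteq> 0" "\<And>i. lookup h (Inl i) = lookup h (Inr i)" "e = g + h"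
    using assms(2) by (auto simp: below_def)
  have "wdot \<omega> h \<noteq> 0"
  proof
    assume "wdot \<omega> h = 0"
    then have z: "\<omega> v * lookup h v = 0" for v by (simp add: wdot_def)
    have l: "lookup h (Inl i) = 0" for i
    proof -
      have "\<omega> (Inl i) > 0 \<or> \<omega> (Inr i) > 0" using assms(1) by (auto simp: Omega_def)
      then show ?thesis using z[of "Inl i"] z[of "Inr i"] h(2)[of i] by auto
    qed
    have "lookup h v = 0" for v using l h(2) by (cases v) auto
    then have "h = 0" by (intro poly_mapping_eqI) simp
    then show False using h(1) by simp
  qed
  then show ?thesis by (simp add: h(3) wdot_add)
qed

lemma below_less: "normal_order r \<Longrightarrow> below g e \<Longrightarrow> (g, e) \<in> r \<and> g \<noteq> e"
  using normal_order.add_right by (auto simp: below_def)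

lemma lookup_single_times: "lookup (single m c * u) (m + f) = c * lookup (u :: ('k::field_char_0, 'v) mpoly) f"
proof (induction u rule: poly_add_induct)
  case (1 e a)
  then show ?case by (simp add: mult_single lookup_single when_def)
next
  case (2 p q)
  then show ?case by (simp add: distrib_left lookup_add)
qed

locale weyl_ideal =
  fixes L :: "('k::field_char_0, 'n::finite) endo set"
  assumes L: "left_ideal L weyl"
begin

text \<open>The left ideal, seen in the polynomial ring.\<close>

definition \<Lambda> :: "('k, 'n + 'n) mpoly set" where "\<Lambda> = {x. Phi x \<in> L}"

lemma L_add: "x \<in> L \<Longrightarrow> y \<in> L \<Longrightarrow> (\<lambda>p. x p + y p) \<in> L"
  using L additive_subgroup.a_closed[of L weyl x y] by (simp add: left_ideal_def)

lemma L_comp: "w \<in> weyl_set \<Longrightarrow> x \<in> L \<Longrightarrow> w \<circ> x \<in> L"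
  using L by (simp add: left_ideal_def)

lemma L_zero: "(\<lambda>_. 0) \<in> L"
  using L additive_subgroup.zero_closed[of L weyl] by (simp add: left_ideal_def)

lemma L_subset: "L \<subseteq> weyl_set"
  using L additive_subgroup.a_subset[of L weyl] by (simp add: left_ideal_def)

lemma L_eq: "L = Phi ` \<Lambda>"
  using L_subset unfolding weyl_set_eq \<Lambda>_def by auto

lemma \<Lambda>_zero: "0 \<in> \<Lambda>"
proof -
  have "Phi 0 = (\<lambda>_. 0 :: ('k, 'n) mpoly)" by (rule ext) simp
  then show ?thesis using L_zero by (simp add: \<Lambda>_def)
qed

lemma \<Lambda>_add: "x \<in> \<Lambda> \<Longrightarrow> y \<in> \<Lambda> \<Longrightarrow> x + y \<in> \<Lambda>"
proof -
  assume "x \<in> \<Lambda>" "y \<in> \<Lambda>"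
  moreover have "Phi (x + y) = (\<lambda>p. Phi x p + Phi y p)" by (rule ext) (rule Phi_add)
  ultimately show ?thesis using L_add by (simp add: \<Lambda>_def)
qed

lemma \<Lambda>_uminus: "x \<in> \<Lambda> \<Longrightarrow> - x \<in> \<Lambda>"
proof -
  assume x: "x \<in> \<Lambda>"
  have eq: "- x = Const (- 1) * x" by (simp add: Const_def single_uminus)
  have "Phi (- x) = Phi (Const (- 1)) \<circ> Phi x"
    by (rule ext) (simp only: eq Phi_scale Phi_Const o_apply)
  then show ?thesis using L_comp[OF weyl_set_Phi] x by (simp add: \<Lambda>_def)
qed

lemma \<Lambda>_diff: "x \<in> \<Lambda> \<Longrightarrow> y \<in> \<Lambda> \<Longrightarrow> x - y \<in> \<Lambda>"
  using \<Lambda>_add[of x "- y"] \<Lambda>_uminus by simp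

lemma monomial_multiple:
  fixes u :: "('k, 'n + 'n) mpoly"
  shows "\<exists>t. Phi (single m c) \<circ> Phi u = Phi (single m c * u + t) \<and> (\<forall>g\<in>keys t. \<exists>f\<in>keys u. below g (m + f))"
proof -
  obtain t where t: "\<And>p. Phi (single m c) (Phi u p) = Phi (single m c * u + t) p"
    "\<forall>g\<in>keys t. \<exists>e\<in>keys (single m c). \<exists>f\<in>keys u. below g (e + f)" using Phi_mult by blast
  have "Phi (single m c) \<circ> Phi u = Phi (single m c * u + t)" by (rule ext) (simp only: t o_apply)
  moreover have "\<forall>g\<in>keys t. \<exists>f\<in>keys u. below g (m + f)" using t(2) by (auto split: if_splits)
  ultimately show ?thesis by blast
qed

text \<open>
  A term \<open>t\<close> of \<open>p\<close> that is divisible by the leading monomial of \<open>u\<close> is removed by subtracting a left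
  multiple of \<open>u\<close>. Nothing above \<open>t\<close> changes, since the correction \<open>z\<close> caused by
  noncommutativity lies strictly below \<open>t\<close>.
\<close>

lemma cancel_term:
  fixes u p :: "('k, 'n + 'n) mpoly"
  assumes r: "normal_order r" and u: "u \<noteq> 0" and t: "t = m + lead r u" "t \<in> keys p"
  shows "\<exists>c z. Phi (single m c) \<circ> Phi u = Phi (single m c * u + z) \<and>
    (\<forall>g\<in>keys z. \<exists>f\<in>keys u. below g (m + f)) \<and>
    (\<forall>e\<in>keys (single m c * u + z). (e, t) \<in> r) \<and> lookup (p - (single m c * u + z)) t = 0"
proof -
  interpret normal_order r by (rule r)
  define c where "c = lookup p t / lookup u (lead r u)"
  obtain z where z: "Phi (single m c) \<circ> Phi u = Phi (single m c * u + z)"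
    "\<forall>g\<in>keys z. \<exists>f\<in>keys u. below g (m + f)" using monomial_multiple by blast
  have le: "(m + f, t) \<in> r" if "f \<in> keys u" for f
    unfolding t(1) by (rule add_mono[OF lead(2)[OF u that]])
  have zl: "(g, t) \<in> r \<and> g \<noteq> t" if "g \<in> keys z" for g
  proof -
    obtain f where f: "f \<in> keys u" "below g (m + f)" using z(2) \<open>g \<in> keys z\<close> by blast
    then show ?thesis using below_less[OF r f(2)] le[OF f(1)] trans antisym by blast
  qed
  have "(e, t) \<in> r" if e: "e \<in> keys (single m c * u + z)" for e
  proof -
    consider "e \<in> keys (single m c * u)" | "e \<in> keys z" using e keys_add[of "single m c * u" z] by blast
    then show ?thesis
    proof cases
      case 1
      then obtain f where "f \<in> keys u" "e = m + f"
        using keys_mult[of "single m c" u] by (auto split: if_splits)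
      then show ?thesis using le by simp
    qed (use zl in blast)
  qed
  moreover have "lookup (p - (single m c * u + z)) t = 0"
  proof -
    have "lookup z t = 0" using zl[of t] by (auto simp: in_keys_iff)
    moreover have "lookup (single m c * u) t = c * lookup u (lead r u)" unfolding t(1) by (rule lookup_single_times)
    moreover have "lookup u (lead r u) \<noteq> 0" using lead(1)[OF u] by (simp add: in_keys_iff)
    ultimately show ?thesis by (simp add: lookup_minus lookup_add c_def)
  qed
  ultimately show ?thesis using z by blast
qed

text \<open>
  The condition on leading monomials alone. Generation of the left ideal follows from it by
  division (\<open>span_groebner\<close>).
\<close>

definition is_groebner :: "(('n + 'n) expo \<times> ('n + 'n) expo) set \<Rightarrow> ('k, 'n + 'n) mpoly set \<Rightarrow> bool" where
  "is_groebner r B \<longleftrightarrow> (\<forall>p\<in>\<Lambda>. p \<noteq> 0 \<longrightarrow> (\<exists>u\<in>B. u \<noteq> 0 \<and> (\<exists>m. lead r p = m + lead r u)))"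

lemma divide_step:
  assumes r: "normal_order r" and B: "is_groebner r B" "B \<subseteq> \<Lambda>" and p: "p \<in> \<Lambda>" "p \<noteq> 0"
  shows "\<exists>u\<in>B. \<exists>m c z. u \<noteq> 0 \<and> lead r p = m + lead r u \<and>
    Phi (single m c) \<circ> Phi u = Phi (single m c * u + z) \<and>
    (\<forall>g\<in>keys z. \<exists>f\<in>keys u. below g (m + f)) \<and>
    p - (single m c * u + z) \<in> \<Lambda> \<and>
    (\<forall>e\<in>keys (p - (single m c * u + z)). (e, lead r p) \<in> r - Id)"
proof -
  interpret normal_order r by (rule r)
  obtain u m where u: "u \<in> B" "u \<noteq> 0" "lead r p = m + lead r u" using B p unfolding is_groebner_def by blast
  obtain c z where z: "Phi (single m c) \<circ> Phi u = Phi (single m c * u + z)"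
    "\<forall>g\<in>keys z. \<exists>f\<in>keys u. below g (m + f)" "\<forall>e\<in>keys (single m c * u + z). (e, lead r p) \<in> r"
    "lookup (p - (single m c * u + z)) (lead r p) = 0"
    using cancel_term[OF r u(2,3) lead(1)[OF p(2)]] by blast
  have "Phi u \<in> L" using u(1) B(2) by (auto simp: \<Lambda>_def)
  then have "single m c * u + z \<in> \<Lambda>" using L_comp[OF weyl_set_Phi] z(1) by (metis \<Lambda>_def mem_Collect_eq)
  then have "p - (single m c * u + z) \<in> \<Lambda>" by (rule \<Lambda>_diff[OF p(1)])
  moreover have "(e, lead r p) \<in> r - Id" if e: "e \<in> keys (p - (single m c * u + z))" for e
  proof -
    have "(e, lead r p) \<in> r" using keys_diff'[of p "single m c * u + z"] e z(3) lead(2)[OF p(2)] by blast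
    moreover have "e \<noteq> lead r p" using e z(4) by (auto simp: in_keys_iff)
    ultimately show ?thesis by simp
  qed
  ultimately show ?thesis using u z by blast
qed

section \<open>Groebner bases\<close>

lemma lead_less:
  assumes "normal_order r" "q \<noteq> 0" "\<forall>e\<in>keys q. (e, t) \<in> r - Id"
  shows "(lead r q, t) \<in> r - Id"
  using normal_order.lead(1)[OF assms(1,2)] assms(3) by blast

lemma span_groebner:
  assumes r: "normal_order r" and B: "is_groebner r B" "B \<subseteq> \<Lambda>"
    and S0: "(\<lambda>_. 0) \<in> S" and Sadd: "\<And>x y. x \<in> S \<Longrightarrow> y \<in> S \<Longrightarrow> (\<lambda>p. x p + y p) \<in> S"
    and Smult: "\<And>w u. w \<in> weyl_set \<Longrightarrow> u \<in> B \<Longrightarrow> w \<circ> Phi u \<in> S"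
  shows "p \<in> \<Lambda> \<Longrightarrow> Phi p \<in> S"
proof -
  interpret normal_order r by (rule r)
  have Phi0: "Phi 0 \<in> S"
  proof -
    have "Phi 0 = (\<lambda>_. 0 :: ('k, 'n) mpoly)" by (rule ext) simp
    then show ?thesis using S0 by simp
  qed
  have "\<forall>p\<in>\<Lambda>. p \<noteq> 0 \<longrightarrow> lead r p = e \<longrightarrow> Phi p \<in> S" for e
    using wf_strict
  proof (induction e rule: wf_induct_rule)
    case (less e)
    show ?case
    proof (intro ballI impI)
      fix p assume p: "p \<in> \<Lambda>" "p \<noteq> 0" "lead r p = e"
      obtain u m c z where u: "u \<in> B" "Phi (single m c) \<circ> Phi u = Phi (single m c * u + z)"
        "p - (single m c * u + z) \<in> \<Lambda>" "\<forall>e\<in>keys (p - (single m c * u + z)). (e, lead r p) \<in> r - Id"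
        using divide_step[OF r B p(1,2)] by blast
      let ?q = "p - (single m c * u + z)"
      have q: "Phi ?q \<in> S"
      proof (cases "?q = 0")
        case True
        show ?thesis unfolding True by (rule Phi0)
      next
        case False
        have "(lead r ?q, e) \<in> r - Id" using lead_less[OF r False u(4)] p(3) by simp
        then show ?thesis using less u(3) False by blast
      qed
      have "Phi (single m c * u + z) \<in> S" using Smult[OF weyl_set_Phi u(1)] u(2) by metis
      from Sadd[OF q this] have "(\<lambda>x. Phi ?q x + Phi (single m c * u + z) x) \<in> S" .
      moreover have "(\<lambda>x. Phi ?q x + Phi (single m c * u + z) x) = Phi p"
        by (rule ext) (simp only: diff_add_cancel flip: Phi_add)
      ultimately show "Phi p \<in> S" by simp
    qed
  qed
  then show "p \<in> \<Lambda> \<Longrightarrow> Phi p \<in> S" using Phi0 by (cases "p = 0") blast+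
qed

text \<open>The monomial ideal generated by \<open>E\<close>, described by the supports of its elements.\<close>

definition divides_ideal :: "('n + 'n) expo set \<Rightarrow> ('k, 'n + 'n) mpoly set" where
  "divides_ideal E = {q. \<forall>e\<in>keys q. \<exists>t\<in>E. \<exists>m. e = m + t}"

lemma divides_ideal: "ideal (divides_ideal E) poly_ring"
proof (rule idealI[OF ring_poly])
  interpret P: ring "poly_ring :: ('k, 'n + 'n) mpoly ring" by (rule ring_poly)
  have mult: "x * a \<in> divides_ideal E" if "a \<in> divides_ideal E" for a x
    unfolding divides_ideal_def
  proof (intro CollectI ballI)
    fix e assume "e \<in> keys (x * a)"
    then obtain f g where fg: "e = f + g" "g \<in> keys a" using keys_mult[of x a] by blast
    then obtain t m where "t \<in> E" "g = m + t" using \<open>a \<in> divides_ideal E\<close> by (auto simp: divides_ideal_def)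
    then show "\<exists>t\<in>E. \<exists>m. e = m + t" using fg by (metis add.assoc)
  qed
  show "subgroup (divides_ideal E) (add_monoid poly_ring)"
  proof (rule group.subgroupI[OF P.a_group])
    fix a b assume a: "a \<in> divides_ideal E" and b: "b \<in> divides_ideal E"
    show "a \<otimes>\<^bsub>add_monoid poly_ring\<^esub> b \<in> divides_ideal E"
      using a b keys_add[of a b] by (auto simp: divides_ideal_def)
  next
    fix a assume a: "a \<in> divides_ideal E"
    have "\<ominus>\<^bsub>poly_ring\<^esub> a = - a" by (rule P.minus_equality) simp_all
    then show "inv\<^bsub>add_monoid poly_ring\<^esub> a \<in> divides_ideal E"
      using a by (simp add: divides_ideal_def a_inv_def)
  next
    have "0 \<in> divides_ideal E" by (simp add: divides_ideal_def)
    then show "divides_ideal E \<noteq> {}" by blast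
  qed simp
  show "x \<otimes>\<^bsub>poly_ring\<^esub> a \<in> divides_ideal E" if "a \<in> divides_ideal E" for a x using mult that by simp
  show "a \<otimes>\<^bsub>poly_ring\<^esub> x \<in> divides_ideal E" if "a \<in> divides_ideal E" for a x using mult[OF that, of x] by (simp add: mult.commute)
qed

lemma Phi_eq_zero: "Phi p = (\<lambda>_. 0) \<longleftrightarrow> p = 0"
proof
  assume "Phi p = (\<lambda>_. 0)"
  then have "Phi p x = 0" for x by simp
  then show "p = 0" using Phi_nonzero by blast
next
  show "p = 0 \<Longrightarrow> Phi p = (\<lambda>_. 0)" by (rule ext) simp
qed

lemma groebner_basisD:
  assumes gb: "groebner_basis r L U"
  shows "is_groebner r {u. Phi u \<in> U}"
  unfolding is_groebner_def
proof (intro ballI impI)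
  interpret P: ring "poly_ring :: ('k, 'n + 'n) mpoly ring" by (rule ring_poly)
  fix p assume p: "p \<in> \<Lambda>" "p \<noteq> 0"
  have U: "U \<subseteq> L" and eq: "Idl\<^bsub>poly_ring\<^esub> (LM r ` (L - {\<lambda>_. 0})) = Idl\<^bsub>poly_ring\<^esub> (LM r ` (U - {\<lambda>_. 0}))"
    using gb unfolding groebner_basis_def weyl_simps by - (elim conjE, assumption)+
  let ?E = "lead r ` {u. Phi u \<in> U \<and> u \<noteq> 0}"
  have "Phi p \<in> L - {\<lambda>_. 0}" using p by (simp add: \<Lambda>_def Phi_eq_zero)
  then have "LM r (Phi p) \<in> LM r ` (L - {\<lambda>_. 0})" by (rule imageI)
  also have "\<dots> \<subseteq> Idl\<^bsub>poly_ring\<^esub> (LM r ` (L - {\<lambda>_. 0}))" by (rule P.genideal_self) simp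
  also have "\<dots> = Idl\<^bsub>poly_ring\<^esub> (LM r ` (U - {\<lambda>_. 0}))" by (rule eq)
  also have "\<dots> \<subseteq> divides_ideal ?E"
  proof (rule P.genideal_minimal[OF divides_ideal], rule subsetI)
    fix q assume "q \<in> LM r ` (U - {\<lambda>_. 0})"
    then obtain w where w: "w \<in> U" "w \<noteq> (\<lambda>_. 0)" "q = LM r w" by blast
    then obtain u where u: "w = Phi u" using U L_eq by blast
    then have "u \<noteq> 0" using w(2) by (simp add: Phi_eq_zero)
    then have E: "lead r u \<in> ?E" using w(1) u by blast
    show "q \<in> divides_ideal ?E" unfolding w(3) u LM_Phi divides_ideal_def
    proof (intro CollectI ballI)
      fix e assume "e \<in> keys (single (lead r u) (1 :: 'k))"
      then have "e = 0 + lead r u" by simp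
      then show "\<exists>t\<in>?E. \<exists>m. e = m + t" using E by blast
    qed
  qed
  finally have "single (lead r p) 1 \<in> divides_ideal ?E" unfolding LM_Phi .
  then obtain t m where t: "t \<in> ?E" "lead r p = m + t" by (auto simp: divides_ideal_def)
  then show "\<exists>u\<in>{u. Phi u \<in> U}. u \<noteq> 0 \<and> (\<exists>m. lead r p = m + lead r u)" by blast
qed

lemma groebner_basisI:
  assumes r: "normal_ordering r" and B: "finite B" "B \<subseteq> \<Lambda>" "is_groebner r B"
  shows "groebner_basis r L (Phi ` B)"
proof -
  have ro: "normal_order r" by (rule normal_order.intro[OF r])
  interpret P: ring "poly_ring :: ('k, 'n + 'n) mpoly ring" by (rule ring_poly)
  interpret W: ring "weyl :: ('k, 'n) endo ring" by (rule ring_weyl)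
  have sub: "Phi ` B \<subseteq> L" using B(2) L_eq by blast
  have fin: "finite (Phi ` B)" using B(1) by simp
  let ?S = "{(\<Oplus>\<^bsub>weyl\<^esub>b\<in>Phi ` B. a b \<otimes>\<^bsub>weyl\<^esub> b) | a. \<forall>b\<in>Phi ` B. a b \<in> carrier weyl}"
  have fc: "(\<lambda>b. a b \<otimes>\<^bsub>weyl\<^esub> b) \<in> Phi ` B \<rightarrow> carrier weyl" if "\<forall>b\<in>Phi ` B. a b \<in> carrier weyl" for a
  proof (rule Pi_I)
    fix b assume b: "b \<in> Phi ` B"
    then have "b \<in> weyl_set" "a b \<in> weyl_set" using that sub L_subset by auto
    then show "a b \<otimes>\<^bsub>weyl\<^esub> b \<in> carrier weyl" by (simp add: weyl_set.comp)
  qed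
  have "L \<subseteq> ?S"
  proof
    fix x assume "x \<in> L"
    then obtain p where p: "p \<in> \<Lambda>" "x = Phi p" using L_eq by blast
    show "x \<in> ?S"
      unfolding p(2)
    proof (rule span_groebner[OF ro B(3,2) _ _ _ p(1)])
      have zw: "\<zero>\<^bsub>weyl\<^esub> \<in> carrier (weyl :: ('k, 'n) endo ring)" by (rule W.zero_closed)
      have "(\<Oplus>\<^bsub>weyl\<^esub>b\<in>Phi ` B. \<zero>\<^bsub>weyl\<^esub> \<otimes>\<^bsub>weyl\<^esub> b) = (\<Oplus>\<^bsub>weyl\<^esub>b\<in>Phi ` B. \<zero>\<^bsub>weyl\<^esub>)"
        by (rule W.finsum_cong') (use sub L_subset zw W.l_null in auto)
      then have "(\<Oplus>\<^bsub>weyl\<^esub>b\<in>Phi ` B. \<zero>\<^bsub>weyl\<^esub> \<otimes>\<^bsub>weyl\<^esub> b) = \<zero>\<^bsub>weyl\<^esub>" by (simp only: W.finsum_zero)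
      then have "\<zero>\<^bsub>weyl\<^esub> \<in> ?S" using zw by (intro CollectI exI[of _ "\<lambda>_. \<zero>\<^bsub>weyl\<^esub>"]) simp
      then show "(\<lambda>_. 0) \<in> ?S" by simp
    next
      fix x y assume "x \<in> ?S" "y \<in> ?S"
      then obtain a a' where a: "x = (\<Oplus>\<^bsub>weyl\<^esub>b\<in>Phi ` B. a b \<otimes>\<^bsub>weyl\<^esub> b)" "\<forall>b\<in>Phi ` B. a b \<in> carrier weyl"
        and a': "y = (\<Oplus>\<^bsub>weyl\<^esub>b\<in>Phi ` B. a' b \<otimes>\<^bsub>weyl\<^esub> b)" "\<forall>b\<in>Phi ` B. a' b \<in> carrier weyl" by blast
      let ?a = "\<lambda>b. a b \<oplus>\<^bsub>weyl\<^esub> a' b"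
      have c: "\<forall>b\<in>Phi ` B. ?a b \<in> carrier weyl" using a(2) a'(2) W.a_closed by blast
      have "x \<oplus>\<^bsub>weyl\<^esub> y = (\<Oplus>\<^bsub>weyl\<^esub>b\<in>Phi ` B. a b \<otimes>\<^bsub>weyl\<^esub> b \<oplus>\<^bsub>weyl\<^esub> a' b \<otimes>\<^bsub>weyl\<^esub> b)"
        unfolding a(1) a'(1) by (rule W.finsum_addf[OF fc[OF a(2)] fc[OF a'(2)], symmetric])
      also have "\<dots> = (\<Oplus>\<^bsub>weyl\<^esub>b\<in>Phi ` B. ?a b \<otimes>\<^bsub>weyl\<^esub> b)"
      proof (rule W.finsum_cong'[OF refl fc[OF c]])
        fix b assume b: "b \<in> Phi ` B"
        have "b \<in> carrier weyl" using b sub L_subset by auto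
        then show "a b \<otimes>\<^bsub>weyl\<^esub> b \<oplus>\<^bsub>weyl\<^esub> a' b \<otimes>\<^bsub>weyl\<^esub> b = ?a b \<otimes>\<^bsub>weyl\<^esub> b"
          using W.l_distr a(2) a'(2) b by metis
      qed
      finally have "x \<oplus>\<^bsub>weyl\<^esub> y \<in> ?S" using c by (intro CollectI exI[of _ ?a] conjI)
      then show "(\<lambda>p. x p + y p) \<in> ?S" by simp
    next
      fix w :: "('k, 'n) endo" and u assume w: "w \<in> weyl_set" and u: "u \<in> B"
      have uc: "Phi u \<in> carrier weyl" by (simp add: weyl_set_Phi)
      let ?a = "\<lambda>b. if Phi u = b then w else \<zero>\<^bsub>weyl\<^esub>"
      have c: "\<forall>b\<in>Phi ` B. ?a b \<in> carrier weyl" using w W.zero_closed by simp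
      have "(\<Oplus>\<^bsub>weyl\<^esub>b\<in>Phi ` B. ?a b \<otimes>\<^bsub>weyl\<^esub> b) = (\<Oplus>\<^bsub>weyl\<^esub>b\<in>Phi ` B. if Phi u = b then w \<otimes>\<^bsub>weyl\<^esub> b else \<zero>\<^bsub>weyl\<^esub>)"
      proof (rule W.finsum_cong'[OF refl])
        have wb: "w \<otimes>\<^bsub>weyl\<^esub> b \<in> carrier weyl" "\<zero>\<^bsub>weyl\<^esub> \<otimes>\<^bsub>weyl\<^esub> b = \<zero>\<^bsub>weyl\<^esub>" if b: "b \<in> Phi ` B" for b
        proof -
          have "b \<in> carrier weyl" using b sub L_subset by auto
          then show "w \<otimes>\<^bsub>weyl\<^esub> b \<in> carrier weyl" "\<zero>\<^bsub>weyl\<^esub> \<otimes>\<^bsub>weyl\<^esub> b = \<zero>\<^bsub>weyl\<^esub>"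
            using W.m_closed[of w b] W.l_null[of b] w by simp_all
        qed
        show "(\<lambda>b. if Phi u = b then w \<otimes>\<^bsub>weyl\<^esub> b else \<zero>\<^bsub>weyl\<^esub>) \<in> Phi ` B \<rightarrow> carrier weyl"
          using wb(1) W.zero_closed by (intro Pi_I) presburger
        show "?a b \<otimes>\<^bsub>weyl\<^esub> b = (if Phi u = b then w \<otimes>\<^bsub>weyl\<^esub> b else \<zero>\<^bsub>weyl\<^esub>)" if "b \<in> Phi ` B" for b
          using wb(2)[OF that] by (cases "Phi u = b") simp_all
      qed
      also have "\<dots> = w \<otimes>\<^bsub>weyl\<^esub> Phi u"
      proof (rule W.finsum_singleton)
        show "Phi u \<in> Phi ` B" using u by simp
        show "(\<lambda>b. w \<otimes>\<^bsub>weyl\<^esub> b) \<in> Phi ` B \<rightarrow> carrier weyl" using fc[of "\<lambda>_. w"] w by simp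
      qed (rule fin)
      finally have "w \<otimes>\<^bsub>weyl\<^esub> Phi u \<in> ?S" using c by (intro CollectI exI[of _ ?a] conjI) simp_all
      then show "w \<circ> Phi u \<in> ?S" by simp
    qed
  qed
  moreover have "?S \<subseteq> L"
  proof
    fix x assume "x \<in> ?S"
    then obtain a where a: "x = (\<Oplus>\<^bsub>weyl\<^esub>b\<in>Phi ` B. a b \<otimes>\<^bsub>weyl\<^esub> b)" "\<forall>b\<in>Phi ` B. a b \<in> carrier weyl" by blast
    interpret Q: filtered_group weyl "\<lambda>_. L"
      using L W.abelian_group_axioms
      by (intro filtered_group.intro filtered_group_axioms.intro) (simp_all add: left_ideal_def)
    show "x \<in> L" unfolding a(1) by (rule Q.finsum_F[OF fin]) (use a(2) L_comp sub in auto)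
  qed
  ultimately have span: "L = ?S" by (rule equalityI)
  let ?I = "Idl\<^bsub>poly_ring\<^esub> (LM r ` (Phi ` B - {\<lambda>_. 0}))"
  have idl: "ideal ?I poly_ring" by (rule P.genideal_ideal) simp
  have "Idl\<^bsub>poly_ring\<^esub> (LM r ` (L - {\<lambda>_. 0})) = ?I"
  proof (rule equalityI)
    show "Idl\<^bsub>poly_ring\<^esub> (LM r ` (L - {\<lambda>_. 0})) \<subseteq> ?I"
    proof (rule P.genideal_minimal[OF idl], rule subsetI)
      fix q assume "q \<in> LM r ` (L - {\<lambda>_. 0})"
      then obtain w where w: "w \<in> L" "w \<noteq> (\<lambda>_. 0)" "q = LM r w" by blast
      then obtain p where p: "p \<in> \<Lambda>" "w = Phi p" using L_eq by blast
      then have "p \<noteq> 0" using w(2) by (simp add: Phi_eq_zero)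
      then obtain u m where u: "u \<in> B" "u \<noteq> 0" "lead r p = m + lead r u" using B(3) p(1) unfolding is_groebner_def by blast
      have "LM r (Phi u) \<in> LM r ` (Phi ` B - {\<lambda>_. 0})" using u by (simp add: Phi_eq_zero)
      then have "LM r (Phi u) \<in> ?I" using P.genideal_self[of "LM r ` (Phi ` B - {\<lambda>_. 0})"] by auto
      then have "single m 1 \<otimes>\<^bsub>poly_ring\<^esub> LM r (Phi u) \<in> ?I" by (rule ideal.I_l_closed[OF idl]) simp
      then show "q \<in> ?I" unfolding w(3) p(2) LM_Phi u(3) by (simp add: mult_single)
    qed
    show "?I \<subseteq> Idl\<^bsub>poly_ring\<^esub> (LM r ` (L - {\<lambda>_. 0}))"
    proof (rule P.genideal_minimal)
      show "ideal (Idl\<^bsub>poly_ring\<^esub> (LM r ` (L - {\<lambda>_. 0}))) poly_ring" by (rule P.genideal_ideal) simp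
      have "LM r ` (Phi ` B - {\<lambda>_. 0}) \<subseteq> LM r ` (L - {\<lambda>_. 0})" using sub by blast
      also have "\<dots> \<subseteq> Idl\<^bsub>poly_ring\<^esub> (LM r ` (L - {\<lambda>_. 0}))" by (rule P.genideal_self) simp
      finally show "LM r ` (Phi ` B - {\<lambda>_. 0}) \<subseteq> Idl\<^bsub>poly_ring\<^esub> (LM r ` (L - {\<lambda>_. 0}))" .
    qed
  qed
  then show ?thesis using fin sub span by (simp add: groebner_basis_def)
qed

end

section \<open>Existence of universal Groebner bases\<close>

lemma Omega_comb:
  assumes "\<omega> \<in> Omega" "s > 0"
  shows "(\<lambda>i. \<nu> i + s * \<omega> i) \<in> Omega"
  unfolding Omega_def
proof (intro CollectI allI)
  fix i
  have "\<omega> (Inl i) + \<omega> (Inr i) > 0" using assms(1) by (simp add: Omega_def)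
  then have "s * (\<omega> (Inl i) + \<omega> (Inr i)) > 0" using assms(2) by simp
  then show "\<nu> (Inl i) + s * \<omega> (Inl i) + (\<nu> (Inr i) + s * \<omega> (Inr i)) > 0"
    by (simp only: distrib_left)
qed

context weyl_ideal
begin

definition multiples :: "('n + 'n) expo set \<Rightarrow> ('n + 'n) expo set" where
  "multiples E = {m + t | m t. t \<in> E}"

lemma multiples_self: "E \<subseteq> multiples E"
  by (force simp: multiples_def intro: exI[of _ 0])

lemma multiples_add: "e \<in> multiples E \<Longrightarrow> e + h \<in> multiples E"
proof -
  assume "e \<in> multiples E"
  then obtain m t where "t \<in> E" "e = m + t" by (auto simp: multiples_def)
  then have "e + h = (m + h) + t" "t \<in> E" by (simp_all add: ac_simps)
  then show ?thesis unfolding multiples_def by blast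
qed

lemma wf_multiples: "wf {(E', E). multiples E \<subset> multiples E'}"
proof (rule ccontr)
  assume "\<not> wf {(E', E). multiples E \<subset> multiples E'}"
  then obtain E where E: "\<And>i. multiples (E i) \<subset> multiples (E (Suc i))"
    unfolding wf_iff_no_infinite_down_chain by blast
  then have "\<forall>i. \<exists>e. e \<in> multiples (E (Suc i)) - multiples (E i)" by blast
  then obtain e where e: "\<And>i. e i \<in> multiples (E (Suc i)) - multiples (E i)" by metis
  obtain i j h where ij: "i < j" "e j = e i + h" using dickson_seq[of e] by blast
  have mono: "multiples (E i) \<subseteq> multiples (E j)" if "i \<le> j" for i j
    using that by (induction j rule: dec_induct) (use E in blast)+
  have "e j \<in> multiples (E (Suc i))" using e[of i] multiples_add unfolding ij(2) by blast
  then have "e j \<in> multiples (E j)" using mono[of "Suc i" j] ij(1) by auto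
  then show False using e[of j] by blast
qed

text \<open>
  Full reduction of \<open>p\<close> by \<open>F\<close>. The leading term of \<open>p\<close> is never touched, so the result is nonzero. The
  greatest reducible term decreases in each step.
\<close>

lemma reduced_element:
  assumes r: "normal_order r" and F: "F \<subseteq> \<Lambda>" "0 \<notin> F" and p: "p \<in> \<Lambda>" "p \<noteq> 0"
    and nd: "lead r p \<notin> multiples (lead r ` F)"
  shows "\<exists>y\<in>\<Lambda>. y \<noteq> 0 \<and> keys y \<inter> multiples (lead r ` F) = {}"
proof -
  interpret normal_order r by (rule r)
  let ?M = "multiples (lead r ` F)" and ?e = "lead r p"
  have step: "\<forall>q\<in>\<Lambda>. ?e \<in> keys q \<longrightarrow> (\<forall>e\<in>keys q. (e, ?e) \<in> r) \<longrightarrow> t \<in> keys q \<inter> ?M \<longrightarrow>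
      (\<forall>e\<in>keys q \<inter> ?M. (e, t) \<in> r) \<longrightarrow> (\<exists>y\<in>\<Lambda>. y \<noteq> 0 \<and> keys y \<inter> ?M = {})" for t
    using wf_strict
  proof (induction t rule: wf_induct_rule)
    case (less t)
    show ?case
    proof (intro ballI impI)
      fix q assume q: "q \<in> \<Lambda>" "?e \<in> keys q" "\<forall>e\<in>keys q. (e, ?e) \<in> r" "t \<in> keys q \<inter> ?M"
        "\<forall>e\<in>keys q \<inter> ?M. (e, t) \<in> r"
      obtain u m where u: "u \<in> F" "t = m + lead r u" using q(4) unfolding multiples_def by blast
      have u0: "u \<noteq> 0" using u(1) F(2) by blast
      have tq: "t \<in> keys q" using q(4) by blast
      obtain c z where z: "Phi (single m c) \<circ> Phi u = Phi (single m c * u + z)"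
        "\<forall>e\<in>keys (single m c * u + z). (e, t) \<in> r" "lookup (q - (single m c * u + z)) t = 0"
        using cancel_term[OF r u0 u(2) tq] by blast
      let ?x = "single m c * u + z" and ?q = "q - (single m c * u + z)"
      have "Phi u \<in> L" using u(1) F(1) by (auto simp: \<Lambda>_def)
      then have "?x \<in> \<Lambda>" using L_comp[OF weyl_set_Phi] z(1) by (metis \<Lambda>_def mem_Collect_eq)
      then have q': "?q \<in> \<Lambda>" by (rule \<Lambda>_diff[OF q(1)])
      have te: "(t, ?e) \<in> r" "t \<noteq> ?e" using q(3,4) nd by auto
      have "?e \<notin> keys ?x"
      proof
        assume "?e \<in> keys ?x"
        then have "(?e, t) \<in> r" using z(2) by blast
        then show False using te antisym by blast
      qed
      then have e': "?e \<in> keys ?q" using q(2) by (simp add: in_keys_iff lookup_minus)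
      have k: "keys ?q \<subseteq> keys q \<union> keys ?x" by (rule keys_diff')
      have le: "\<forall>e\<in>keys ?q. (e, ?e) \<in> r"
      proof
        fix e assume "e \<in> keys ?q"
        then consider "e \<in> keys q" | "e \<in> keys ?x" using k by blast
        then show "(e, ?e) \<in> r" by cases (use q(3) z(2) te(1) trans in blast)+
      qed
      have lt: "\<forall>e\<in>keys ?q \<inter> ?M. (e, t) \<in> r - Id"
      proof
        fix e assume e: "e \<in> keys ?q \<inter> ?M"
        then consider "e \<in> keys q \<inter> ?M" | "e \<in> keys ?x" using k by blast
        then have "(e, t) \<in> r" by cases (use q(5) z(2) in blast)+
        moreover have "e \<noteq> t" using e z(3) by (auto simp: in_keys_iff)
        ultimately show "(e, t) \<in> r - Id" by simp
      qed
      show "\<exists>y\<in>\<Lambda>. y \<noteq> 0 \<and> keys y \<inter> ?M = {}"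
      proof (cases "keys ?q \<inter> ?M = {}")
        case True
        moreover have "?q \<noteq> 0"
        proof
          assume "?q = 0"
          then have "keys ?q = {}" by (simp only: keys_zero)
          then show False using e' by blast
        qed
        ultimately show ?thesis using q' by blast
      next
        case False
        have "finite (keys ?q \<inter> ?M)" by simp
        then obtain t' where t': "t' \<in> keys ?q \<inter> ?M" "\<forall>e\<in>keys ?q \<inter> ?M. (e, t') \<in> r"
          using greatest_ex[OF _ False] by blast
        have "(t', t) \<in> r - Id" using lt t'(1) by blast
        from less[OF this] show ?thesis using q' e' le t' by blast
      qed
    qed
  qed
  show ?thesis
  proof (cases "keys p \<inter> ?M = {}")
    case True
    then show ?thesis using p by blast
  next
    case False
    have "finite (keys p \<inter> ?M)" by simp
    then obtain t where t: "t \<in> keys p \<inter> ?M" "\<forall>e\<in>keys p \<inter> ?M. (e, t) \<in> r"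
      using greatest_ex[OF _ False] by blast
    show ?thesis using step[of t] p(1) lead[OF p(2)] t by blast
  qed
qed

lemma is_groebner_mono: "is_groebner r B \<Longrightarrow> B \<subseteq> B' \<Longrightarrow> is_groebner r B'"
  unfolding is_groebner_def by blast

text \<open>
  All orderings in \<open>S\<close> agree on the leading monomials \<open>E\<close> of \<open>F\<close>. If \<open>F\<close> is not a Groebner basis for one
  of them, there is a nonzero \<open>y\<close> in the left ideal none of whose finitely many monomials is a
  multiple of \<open>E\<close>. Split \<open>S\<close> according to the leading monomial of \<open>y\<close>: in each part, adding \<open>y\<close> to \<open>F\<close>
  enlarges the monomial ideal, whichever monomial of \<open>y\<close> leads. By Dickson's lemma this recursion
  ends, and as each split is finite, the union of all resulting bases is finite.
\<close>

lemma finitely_many_orders_suffice: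
  "\<forall>S F. finite F \<longrightarrow> F \<subseteq> \<Lambda> \<longrightarrow> 0 \<notin> F \<longrightarrow> (\<forall>r\<in>S. normal_order r \<and> lead r ` F = E) \<longrightarrow>
    (\<exists>U. finite U \<and> U \<subseteq> \<Lambda> \<and> (\<forall>r\<in>S. is_groebner r U))"
  using wf_multiples
proof (induction E rule: wf_induct_rule)
  case (less E)
  show ?case
  proof (intro allI impI)
    fix S F assume F: "finite F" "F \<subseteq> \<Lambda>" "0 \<notin> F" and S: "\<forall>r\<in>S. normal_order r \<and> lead r ` F = E"
    show "\<exists>U. finite U \<and> U \<subseteq> \<Lambda> \<and> (\<forall>r\<in>S. is_groebner r U)"
    proof (cases "\<forall>r\<in>S. is_groebner r F")
      case True
      then show ?thesis using F by blast
    next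
      case False
      then obtain r where r: "r \<in> S" "\<not> is_groebner r F" by blast
      then have ro: "normal_order r" "lead r ` F = E" using S by auto
      obtain p where p: "p \<in> \<Lambda>" "p \<noteq> 0" "\<And>u m. u \<in> F \<Longrightarrow> u \<noteq> 0 \<Longrightarrow> lead r p \<noteq> m + lead r u"
        using r(2) unfolding is_groebner_def by blast
      have "lead r p \<notin> multiples (lead r ` F)"
      proof
        assume "lead r p \<in> multiples (lead r ` F)"
        then obtain u m where u: "u \<in> F" "lead r p = m + lead r u" unfolding multiples_def by blast
        then have "u \<noteq> 0" using F(3) by metis
        then show False using p(3)[OF u(1)] u(2) by blast
      qed
      from reduced_element[OF ro(1) F(2,3) p(1,2) this]
      obtain y where y: "y \<in> \<Lambda>" "y \<noteq> 0" "keys y \<inter> multiples E = {}" unfolding ro(2) by blast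
      have "\<exists>U. finite U \<and> U \<subseteq> \<Lambda> \<and> (\<forall>r\<in>{r \<in> S. lead r y = e}. is_groebner r U)" if e: "e \<in> keys y" for e
      proof -
        have "e \<notin> multiples E" using e y(3) by blast
        moreover have "e \<in> multiples (insert e E)" using multiples_self by blast
        moreover have "multiples E \<subseteq> multiples (insert e E)" unfolding multiples_def by blast
        ultimately have "(insert e E, E) \<in> {(E', E). multiples E \<subset> multiples E'}" by blast
        from less[OF this, rule_format, of "insert y F" "{r \<in> S. lead r y = e}"]
        show ?thesis using F y S by auto
      qed
      then have "\<forall>e\<in>keys y. \<exists>U. finite U \<and> U \<subseteq> \<Lambda> \<and> (\<forall>r\<in>{r \<in> S. lead r y = e}. is_groebner r U)" by blast
      from bchoice[OF this] obtain U where
        U: "\<forall>e\<in>keys y. finite (U e) \<and> U e \<subseteq> \<Lambda> \<and> (\<forall>r\<in>{r \<in> S. lead r y = e}. is_groebner r (U e))" ..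
      have "is_groebner r (\<Union>e\<in>keys y. U e)" if r': "r \<in> S" for r
      proof -
        have "lead r y \<in> keys y" using S r' normal_order.lead(1)[OF _ y(2)] by blast
        then have "is_groebner r (U (lead r y))" "U (lead r y) \<subseteq> (\<Union>e\<in>keys y. U e)" using U r' by auto
        then show ?thesis by (rule is_groebner_mono)
      qed
      moreover have "finite (\<Union>e\<in>keys y. U e)" using U by simp
      moreover have "(\<Union>e\<in>keys y. U e) \<subseteq> \<Lambda>" using U by blast
      ultimately show ?thesis by blast
    qed
  qed
qed

theorem universal_groebner_basis_exists: "\<exists>U. universal_groebner_basis L U"
proof -
  have "\<exists>U. finite U \<and> U \<subseteq> \<Lambda> \<and> (\<forall>r\<in>{r. normal_ordering r}. is_groebner r U)"
    using finitely_many_orders_suffice[of "{}", rule_format, of "{}" "{r. normal_ordering r}"]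
    by (simp add: normal_order.intro)
  then obtain U where U: "finite U" "U \<subseteq> \<Lambda>" "\<And>r. normal_ordering r \<Longrightarrow> is_groebner r U" by blast
  have "universal_groebner_basis L (Phi ` U)"
    unfolding universal_groebner_basis_def
    using U L_eq groebner_basisI by blast
  then show ?thesis by blast
qed

section \<open>Initial ideals for iterated weights\<close>

text \<open>
  The lexicographically leading form of \<open>l\<close> for the pair of weights \<open>\<alpha>\<close>, \<open>\<beta>\<close> is changed, in a division
  step, by a multiple of the leading form of some \<open>u \<in> U\<close>. The noncommutative correction does not
  contribute, since it has smaller \<open>\<alpha>\<close>-degree.
\<close>

lemma initial_transfer:
  assumes I: "poly_ideal I" and \<alpha>: "\<alpha> \<in> Omega" and U: "is_groebner (lex_order \<alpha> \<beta>) U" "U \<subseteq> \<Lambda>"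
    and top: "\<And>u. u \<in> U \<Longrightarrow> u \<noteq> 0 \<Longrightarrow> hpart \<beta> (int (wdot \<beta> (lead (lex_order \<alpha> \<beta>) u)))
      (hpart \<alpha> (int (wdot \<alpha> (lead (lex_order \<alpha> \<beta>) u))) u) \<in> I"
    and l: "l \<in> \<Lambda>" "l \<in> poly_fil \<alpha> a" "hpart \<alpha> a l \<in> poly_fil \<beta> b"
  shows "hpart \<beta> b (hpart \<alpha> a l) \<in> I"
proof -
  let ?r = "lex_order \<alpha> \<beta>"
  have ro: "normal_order ?r" by (rule normal_order.intro[OF lex_order_normal])
  interpret normal_order ?r by (rule ro)
  have I0: "0 \<in> I" using I by (simp add: poly_ideal_def)
  have "\<forall>l\<in>\<Lambda>. l \<noteq> 0 \<longrightarrow> lead ?r l = e \<longrightarrow> l \<in> poly_fil \<alpha> a \<longrightarrow> hpart \<alpha> a l \<in> poly_fil \<beta> b \<longrightarrow>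
    hpart \<beta> b (hpart \<alpha> a l) \<in> I" for e
    using wf_strict
  proof (induction e rule: wf_induct_rule)
    case (less e)
    show ?case
    proof (intro ballI impI)
      fix l assume l: "l \<in> \<Lambda>" "l \<noteq> 0" "lead ?r l = e" "l \<in> poly_fil \<alpha> a" "hpart \<alpha> a l \<in> poly_fil \<beta> b"
      show "hpart \<beta> b (hpart \<alpha> a l) \<in> I"
      proof (cases "hpart \<beta> b (hpart \<alpha> a l) = 0")
        case False
        then have "keys (hpart \<beta> b (hpart \<alpha> a l)) \<noteq> {}" by (simp del: keys_hpart)
        then obtain f where f: "f \<in> keys l" "int (wdot \<alpha> f) = a" "int (wdot \<beta> f) = b" by auto
        have ek: "e \<in> keys l" using lead(1)[OF l(2)] l(3) by simp
        have fe: "(f, e) \<in> ?r" using lead(2)[OF l(2) f(1)] l(3) by simp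
        have ea: "int (wdot \<alpha> e) = a"
          using lex_orderD(1)[OF fe] f(2) l(4) ek unfolding mem_poly_fil by force
        then have "e \<in> keys (hpart \<alpha> a l)" using ek by simp
        then have "int (wdot \<beta> e) \<le> b" using l(5) unfolding mem_poly_fil by blast
        moreover have "wdot \<beta> f \<le> wdot \<beta> e" using lex_orderD(2)[OF fe] ea f(2) by simp
        ultimately have eb: "int (wdot \<beta> e) = b" using f(3) by simp
        obtain u m c z where u: "u \<in> U" "u \<noteq> 0" "lead ?r l = m + lead ?r u"
          "\<forall>g\<in>keys z. \<exists>f\<in>keys u. below g (m + f)" "l - (single m c * u + z) \<in> \<Lambda>"
          "\<forall>f\<in>keys (l - (single m c * u + z)). (f, lead ?r l) \<in> ?r - Id"
          using divide_step[OF ro U l(1,2)] by blast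
        let ?l = "l - (single m c * u + z)"
        have d: "(f, e) \<in> ?r" if "f \<in> keys ?l" for f using u(6) that l(3) by blast
        have l1: "?l \<in> poly_fil \<alpha> a" unfolding mem_poly_fil
        proof
          fix f assume "f \<in> keys ?l"
          then show "int (wdot \<alpha> f) \<le> a" using lex_orderD(1)[OF d] ea by force
        qed
        have l2: "hpart \<alpha> a ?l \<in> poly_fil \<beta> b" unfolding mem_poly_fil
        proof
          fix f assume "f \<in> keys (hpart \<alpha> a ?l)"
          then have "f \<in> keys ?l" "int (wdot \<alpha> f) = a" by simp_all
          then show "int (wdot \<beta> f) \<le> b" using lex_orderD(2)[OF d] ea eb by force
        qed
        have 1: "hpart \<beta> b (hpart \<alpha> a ?l) \<in> I"
        proof (cases "?l = 0")
          case True
          show ?thesis unfolding True using I0 by simp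
        next
          case False
          have "(lead ?r ?l, e) \<in> ?r - Id" using lead_less[OF ro False u(6)] l(3) by simp
          from less[OF this] show ?thesis using u(5) False l1 l2 by blast
        qed
        have "z \<in> poly_fil \<alpha> (a - 1)" unfolding mem_poly_fil
        proof
          fix g assume "g \<in> keys z"
          then obtain f where f: "f \<in> keys u" "below g (m + f)" using u(4) by blast
          have "(m + f, e) \<in> ?r" using add_mono[OF lead(2)[OF u(2) f(1)], of m] u(3) l(3) by simp
          then have "wdot \<alpha> g < wdot \<alpha> e" using below_wdot[OF \<alpha> f(2)] lex_orderD(1) by fastforce
          then show "int (wdot \<alpha> g) \<le> a - 1" using ea by simp
        qed
        then have 2: "hpart \<alpha> a z = 0" by (rule hpart_eq_0) simp
        have "a - int (wdot \<alpha> m) = int (wdot \<alpha> (lead ?r u))" "b - int (wdot \<beta> m) = int (wdot \<beta> (lead ?r u))"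
          using ea eb u(3) l(3) by (auto simp: wdot_add)
        then have "hpart \<beta> b (hpart \<alpha> a (single m c * u)) =
          single m c * hpart \<beta> (int (wdot \<beta> (lead ?r u))) (hpart \<alpha> (int (wdot \<alpha> (lead ?r u))) u)"
          by (simp add: hpart_mult_single)
        then have 3: "hpart \<beta> b (hpart \<alpha> a (single m c * u)) \<in> I"
          using top[OF u(1,2)] I unfolding poly_ideal_def by simp
        have "hpart \<beta> b (hpart \<alpha> a l) = hpart \<beta> b (hpart \<alpha> a (?l + (single m c * u + z)))" by simp
        also have "\<dots> = hpart \<beta> b (hpart \<alpha> a ?l) + hpart \<beta> b (hpart \<alpha> a (single m c * u))"
          by (simp only: hpart_add 2 hpart_zero add_0_right)
        finally show ?thesis using 1 3 I unfolding poly_ideal_def by simp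
      qed (simp add: I0)
    qed
  qed
  then show ?thesis using l I0 by (cases "l = 0") auto
qed

lemma hpart_commute: "hpart \<alpha> a (hpart \<beta> b p) = hpart \<beta> b (hpart \<alpha> a p)"
  by (rule poly_mapping_eqI) (simp add: hpart_def lookup_filter when_def)

lemma fil_of_top:
  assumes "x - hpart \<omega> d p \<in> poly_fil \<omega> (d - 1)"
  shows "x \<in> poly_fil \<omega> d" "hpart \<omega> d x = hpart \<omega> d p"
proof -
  have "x - hpart \<omega> d p \<in> poly_fil \<omega> d" using assms poly_fil_mono[of "d - 1" d \<omega>] by auto
  from poly_fil_add[OF this hpart_in_fil[of \<omega> d p]] show "x \<in> poly_fil \<omega> d" by simp
  have "hpart \<omega> d (x - hpart \<omega> d p) = 0" by (rule hpart_eq_0[OF assms]) simp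
  then show "hpart \<omega> d x = hpart \<omega> d p" by (simp add: hpart_diff hpart_hpart)
qed

text \<open>
  Both inclusions are instances of \<open>initial_transfer\<close>: the weights \<open>\<omega>\<close>, \<open>\<nu>\<close> describe iterated leading
  forms, and \<open>\<tau>\<close> with the zero weight describes simple ones.
\<close>

theorem ini_ini_weights:
  fixes \<nu> \<omega> :: "'n + 'n \<Rightarrow> nat" and s :: nat
  defines "\<tau> \<equiv> (\<lambda>i. \<nu> i + s * \<omega> i)"
  assumes \<omega>: "\<omega> \<in> Omega" and ideal: "poly_ideal (ini \<omega> \<Lambda>)" "poly_ideal (ini \<tau> \<Lambda>)"
    and U: "\<And>r. normal_ordering r \<Longrightarrow> is_groebner r U" "U \<subseteq> \<Lambda>"
    and s: "s > 0" "\<And>u e. u \<in> U \<Longrightarrow> e \<in> keys u \<Longrightarrow> wdot \<nu> e < s"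
  shows "ini \<nu> (ini \<omega> \<Lambda>) = ini \<tau> \<Lambda>"
proof -
  have \<tau>: "\<tau> \<in> Omega" unfolding \<tau>_def by (rule Omega_comb[OF \<omega> s(1)])
  have wt: "wdot \<tau> e = wdot \<nu> e + s * wdot \<omega> e" for e unfolding \<tau>_def by (rule wdot_comb)
  \<comment> \<open>one unit of \<open>\<omega>\<close>-degree outweighs every difference of \<open>\<nu>\<close>-degrees within the support of a basis element\<close>
  have gap: "wdot \<tau> f < wdot \<tau> e" if "wdot \<omega> f < wdot \<omega> e" "wdot \<nu> f < s" for e f
  proof -
    have "s * Suc (wdot \<omega> f) \<le> s * wdot \<omega> e" using that(1) by (intro mult_le_mono2) simp
    then show ?thesis using that(2) by (simp add: wt)
  qed
  have cmp: "wdot \<tau> f \<le> wdot \<tau> e \<longleftrightarrow> wdot \<omega> f < wdot \<omega> e \<or> wdot \<omega> f = wdot \<omega> e \<and> wdot \<nu> f \<le> wdot \<nu> e"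
    if "u \<in> U" "f \<in> keys u" "e \<in> keys u" for u e f
    using gap[of f e] gap[of e f] s(2)[OF that(1,2)] s(2)[OF that(1,3)] wt[of e] wt[of f]
    by (cases "wdot \<omega> f" "wdot \<omega> e" rule: linorder_cases) auto
  have top: "hpart \<tau> (int (wdot \<tau> e)) u = hpart \<nu> (int (wdot \<nu> e)) (hpart \<omega> (int (wdot \<omega> e)) u)"
    if "u \<in> U" "e \<in> keys u" for u e
  proof (rule poly_mapping_eqI)
    fix f
    show "lookup (hpart \<tau> (int (wdot \<tau> e)) u) f = lookup (hpart \<nu> (int (wdot \<nu> e)) (hpart \<omega> (int (wdot \<omega> e)) u)) f"
    proof (cases "f \<in> keys u")
      case True
      have "wdot \<tau> f = wdot \<tau> e \<longleftrightarrow> wdot \<omega> f = wdot \<omega> e \<and> wdot \<nu> f = wdot \<nu> e"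
      proof
        assume eq: "wdot \<tau> f = wdot \<tau> e"
        have "wdot \<tau> f \<le> wdot \<tau> e" "wdot \<tau> e \<le> wdot \<tau> f" using eq by simp_all
        then show "wdot \<omega> f = wdot \<omega> e \<and> wdot \<nu> f = wdot \<nu> e"
          unfolding cmp[OF that(1) True that(2)] cmp[OF that True] by linarith
      qed (simp add: wt)
      then show ?thesis by (auto simp: hpart_def lookup_filter when_def)
    qed (simp add: hpart_def lookup_filter when_def in_keys_iff)
  qed
  have ideal2: "poly_ideal (ini \<nu> (ini \<omega> \<Lambda>))" by (rule ini_ideal[OF ideal(1)])
  have J0: "0 \<in> ini \<omega> \<Lambda>" using ideal(1) by (simp add: poly_ideal_def)
  show ?thesis
  proof (intro equalityI subsetI)
    fix p assume p: "p \<in> ini \<nu> (ini \<omega> \<Lambda>)"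
    have topI: "hpart \<nu> (int (wdot \<nu> (lead (lex_order \<omega> \<nu>) u))) (hpart \<omega> (int (wdot \<omega> (lead (lex_order \<omega> \<nu>) u))) u) \<in> ini \<tau> \<Lambda>"
      if u: "u \<in> U" "u \<noteq> 0" for u
    proof -
      interpret normal_order "lex_order \<omega> \<nu>" by (rule normal_order.intro[OF lex_order_normal])
      let ?e = "lead (lex_order \<omega> \<nu>) u"
      have e: "?e \<in> keys u" by (rule lead(1)[OF u(2)])
      have "u \<in> poly_fil \<tau> (int (wdot \<tau> ?e))" unfolding mem_poly_fil
      proof
        fix f assume f: "f \<in> keys u"
        have "(f, ?e) \<in> lex_order \<omega> \<nu>" by (rule lead(2)[OF u(2) f])
        then have "wdot \<tau> f \<le> wdot \<tau> ?e"
          using lex_orderD[of f ?e] unfolding cmp[OF u(1) f e] by fastforce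
        then show "int (wdot \<tau> f) \<le> int (wdot \<tau> ?e)" by simp
      qed
      then have "u - hpart \<tau> (int (wdot \<tau> ?e)) u \<in> poly_fil \<tau> (int (wdot \<tau> ?e) - 1)" by (rule diff_hpart_fil)
      then have "hpart \<tau> (int (wdot \<tau> ?e)) u \<in> ini \<tau> \<Lambda>"
        using u(1) U(2) \<Lambda>_zero by (intro ini_homI[of _ u]) (auto simp: hpart_hpart)
      then show ?thesis using top[OF u(1) e] by simp
    qed
    have add: "\<And>x y. x \<in> ini \<tau> \<Lambda> \<Longrightarrow> y \<in> ini \<tau> \<Lambda> \<Longrightarrow> x + y \<in> ini \<tau> \<Lambda>" and zero: "0 \<in> ini \<tau> \<Lambda>"
      using ideal(2) by (auto simp: poly_ideal_def)
    have h: "hpart \<nu> d p \<in> ini \<tau> \<Lambda>" for d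
    proof -
      obtain x where x: "x \<in> ini \<omega> \<Lambda>" "x - hpart \<nu> d p \<in> poly_fil \<nu> (d - 1)" using p unfolding ini_def[of \<nu>] by blast
      note xt = fil_of_top[OF x(2)]
      have h: "hpart \<omega> a (hpart \<nu> d x) \<in> ini \<tau> \<Lambda>" for a
      proof -
        obtain l where l: "l \<in> \<Lambda>" "l - hpart \<omega> a x \<in> poly_fil \<omega> (a - 1)" using x(1) unfolding ini_def by blast
        note lt = fil_of_top[OF l(2)]
        have "hpart \<omega> a l \<in> poly_fil \<nu> d" unfolding lt(2) by (rule hpart_fil[OF xt(1)])
        from initial_transfer[OF ideal(2) \<omega> U(1)[OF lex_order_normal] U(2) topI l(1) lt(1) this]
        show ?thesis by (simp add: lt(2) hpart_commute)
      qed
      have "hpart \<nu> d x \<in> ini \<tau> \<Lambda>" by (rule hpart_decomp[where P = "\<lambda>x. x \<in> ini \<tau> \<Lambda>", OF zero _ h]) (rule add)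
      then show ?thesis by (simp add: xt(2))
    qed
    show "p \<in> ini \<tau> \<Lambda>" by (rule hpart_decomp[where P = "\<lambda>x. x \<in> ini \<tau> \<Lambda>", OF zero _ h]) (rule add)
  next
    fix p assume p: "p \<in> ini \<tau> \<Lambda>"
    let ?z = "\<lambda>_ :: 'n + 'n. 0 :: nat"
    have z0: "wdot ?z e = 0" for e by (simp add: wdot_def)
    have hz: "hpart ?z 0 q = q" for q by (rule hpart_eq_self) (simp add: z0)
    have topI: "hpart ?z (int (wdot ?z (lead (lex_order \<tau> ?z) u))) (hpart \<tau> (int (wdot \<tau> (lead (lex_order \<tau> ?z) u))) u)
        \<in> ini \<nu> (ini \<omega> \<Lambda>)" if u: "u \<in> U" "u \<noteq> 0" for u
    proof -
      interpret normal_order "lex_order \<tau> ?z" by (rule normal_order.intro[OF lex_order_normal])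
      let ?e = "lead (lex_order \<tau> ?z) u"
      have e: "?e \<in> keys u" by (rule lead(1)[OF u(2)])
      have le: "wdot \<omega> f < wdot \<omega> ?e \<or> wdot \<omega> f = wdot \<omega> ?e \<and> wdot \<nu> f \<le> wdot \<nu> ?e" if f: "f \<in> keys u" for f
        using lex_orderD(1)[OF lead(2)[OF u(2) f]] unfolding cmp[OF u(1) f e] .
      let ?x = "hpart \<omega> (int (wdot \<omega> ?e)) u"
      have "u \<in> poly_fil \<omega> (int (wdot \<omega> ?e))" unfolding mem_poly_fil using le by force
      then have "u - ?x \<in> poly_fil \<omega> (int (wdot \<omega> ?e) - 1)" by (rule diff_hpart_fil)
      then have x: "?x \<in> ini \<omega> \<Lambda>"
        using u(1) U(2) \<Lambda>_zero by (intro ini_homI[of _ u]) (auto simp: hpart_hpart)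
      have "?x \<in> poly_fil \<nu> (int (wdot \<nu> ?e))" unfolding mem_poly_fil using le by force
      then have "?x - hpart \<nu> (int (wdot \<nu> ?e)) ?x \<in> poly_fil \<nu> (int (wdot \<nu> ?e) - 1)" by (rule diff_hpart_fil)
      then have "hpart \<nu> (int (wdot \<nu> ?e)) ?x \<in> ini \<nu> (ini \<omega> \<Lambda>)"
        by (rule ini_homI[OF J0 x]) (simp add: hpart_hpart)
      then show ?thesis using top[OF u(1) e] by (simp add: z0 hz)
    qed
    have add: "\<And>x y. x \<in> ini \<nu> (ini \<omega> \<Lambda>) \<Longrightarrow> y \<in> ini \<nu> (ini \<omega> \<Lambda>) \<Longrightarrow> x + y \<in> ini \<nu> (ini \<omega> \<Lambda>)"
      and zero: "0 \<in> ini \<nu> (ini \<omega> \<Lambda>)"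
      using ideal2 by (auto simp: poly_ideal_def)
    have h: "hpart \<tau> d p \<in> ini \<nu> (ini \<omega> \<Lambda>)" for d
    proof -
      obtain l where l: "l \<in> \<Lambda>" "l - hpart \<tau> d p \<in> poly_fil \<tau> (d - 1)" using p unfolding ini_def[of \<tau>] by blast
      note lt = fil_of_top[OF l(2)]
      have "hpart \<tau> d l \<in> poly_fil ?z 0" by (simp add: mem_poly_fil z0)
      from initial_transfer[OF ideal2 \<tau> U(1)[OF lex_order_normal] U(2) topI l(1) lt(1) this]
      show ?thesis by (simp add: lt(2) hz)
    qed
    show "p \<in> ini \<nu> (ini \<omega> \<Lambda>)" by (rule hpart_decomp[where P = "\<lambda>x. x \<in> ini \<nu> (ini \<omega> \<Lambda>)", OF zero _ h]) (rule add)
  qed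
qed

end

section \<open>The bound\<close>

lemma quantization_weyl:
  assumes "\<omega> \<in> Omega"
  shows "quantization (weyl :: ('k::field_char_0, 'n::finite) endo ring) Phi \<omega> (weyl_fil \<omega>)"
proof (intro quantization.intro quantization_axioms.intro ring_weyl)
  show "range Phi = carrier (weyl :: ('k, 'n) endo ring)" by (simp add: weyl_set_eq)
  show "inj (Phi :: ('k, 'n + 'n) mpoly \<Rightarrow> ('k, 'n) endo)" by (rule inj_Phi)
  show "Phi (p + q) = Phi p \<oplus>\<^bsub>weyl\<^esub> Phi q" for p q :: "('k, 'n + 'n) mpoly"
    unfolding weyl_simps by (rule ext) (rule Phi_add)
  show "Phi 1 = \<one>\<^bsub>weyl :: ('k, 'n) endo ring\<^esub>" by (simp add: Phi_one)
  show "weyl_fil \<omega> i = (Phi :: ('k, 'n + 'n) mpoly \<Rightarrow> ('k, 'n) endo) ` poly_fil \<omega> i" for i by (rule weyl_fil_eq)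
  fix p q :: "('k, 'n + 'n) mpoly" and i j
  assume pq: "p \<in> poly_fil \<omega> i" "q \<in> poly_fil \<omega> j"
  obtain r where r: "\<And>x. Phi p (Phi q x) = Phi (p * q + r) x"
    "\<forall>g\<in>keys r. \<exists>e\<in>keys p. \<exists>f\<in>keys q. below g (e + f)" using Phi_mult by blast
  have "r \<in> poly_fil \<omega> (i + j - 1)" unfolding mem_poly_fil
  proof
    fix g assume "g \<in> keys r"
    then obtain e f where ef: "e \<in> keys p" "f \<in> keys q" "below g (e + f)" using r(2) by blast
    have "int (wdot \<omega> e) \<le> i" "int (wdot \<omega> f) \<le> j" using pq ef unfolding mem_poly_fil by auto
    then show "int (wdot \<omega> g) \<le> i + j - 1" using below_wdot[OF assms ef(3)] by (simp add: wdot_add)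
  qed
  moreover have "Phi p \<otimes>\<^bsub>weyl\<^esub> Phi q = Phi (p * q) \<oplus>\<^bsub>weyl\<^esub> Phi r"
    unfolding weyl_simps by (rule ext) (simp only: o_apply r(1) Phi_add)
  ultimately show "\<exists>r\<in>poly_fil \<omega> (i + j - 1). Phi p \<otimes>\<^bsub>weyl\<^esub> Phi q = Phi (p * q) \<oplus>\<^bsub>weyl\<^esub> Phi r" by blast
qed

lemma weyl_gr_iso_symbol:
  fixes \<omega> :: "'n::finite + 'n \<Rightarrow> nat"
  assumes "\<omega> \<in> Omega"
  shows "(weyl_gr_iso \<omega> :: ('k::field_char_0, 'n + 'n) mpoly \<Rightarrow> _) = quantization.symbol weyl Phi \<omega> (weyl_fil \<omega>)"
proof -
  interpret quantization weyl Phi \<omega> "weyl_fil \<omega> :: int \<Rightarrow> ('k, 'n) endo set" by (rule quantization_weyl[OF assms])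
  show ?thesis
    unfolding weyl_gr_iso_def
  proof (rule the_equality)
    show "symbol \<in> ring_hom poly_ring (gr_ring weyl (weyl_fil \<omega>)) \<and>
     (\<forall>c. symbol (Const c) = gr_class weyl (weyl_fil \<omega>) 0 (\<lambda>p. Const c * p)) \<and>
     (\<forall>i. symbol (Var (Inl i)) = gr_class weyl (weyl_fil \<omega>) (int (\<omega> (Inl i))) (xi i)) \<and>
     (\<forall>i. symbol (Var (Inr i)) = gr_class weyl (weyl_fil \<omega>) (int (\<omega> (Inr i))) (partial i))"
      by (simp add: symbol_ring_hom symbol_Const symbol_Var Phi_Const Phi_xi Phi_partial)
  next
    fix h :: "('k, 'n + 'n) mpoly \<Rightarrow> int \<Rightarrow> ('k, 'n) endo set"
    assume h: "h \<in> ring_hom poly_ring (gr_ring weyl (weyl_fil \<omega>)) \<and>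
     (\<forall>c. h (Const c) = gr_class weyl (weyl_fil \<omega>) 0 (\<lambda>p. Const c * p)) \<and>
     (\<forall>i. h (Var (Inl i)) = gr_class weyl (weyl_fil \<omega>) (int (\<omega> (Inl i))) (xi i)) \<and>
     (\<forall>i. h (Var (Inr i)) = gr_class weyl (weyl_fil \<omega>) (int (\<omega> (Inr i))) (partial i))"
    show "h = symbol"
    proof (rule symbol_unique)
      show "h (Var v) = symbol (Var v)" for v
        using h by (cases v) (simp_all add: symbol_Var Phi_xi Phi_partial)
    qed (use h in \<open>simp_all add: symbol_Const Phi_Const\<close>)
  qed
qed

lemma poly_gr_iso_symbol:
  fixes \<nu> :: "'v::finite \<Rightarrow> nat"
  shows "(poly_gr_iso \<nu> :: ('k::field_char_0, 'v) mpoly \<Rightarrow> _) = quantization.symbol poly_ring (\<lambda>p. p) \<nu> (poly_fil \<nu>)"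
proof -
  interpret quantization poly_ring "\<lambda>p. p" \<nu> "poly_fil \<nu> :: int \<Rightarrow> ('k, 'v) mpoly set" by (rule quantization_poly)
  show ?thesis
    unfolding poly_gr_iso_def
    by (rule the_equality) (auto simp: symbol_ring_hom symbol_Const symbol_Var intro: symbol_unique)
qed

context weyl_ideal
begin

lemma rad_annihilator_weyl_gr:
  assumes \<omega>: "\<omega> \<in> Omega" and good: "good_filtration (weyl_fil \<omega>) (quot_module weyl L) F"
  shows "rad (annihilator poly_ring (weyl_gr \<omega> (quot_module weyl L) F)) = rad (ini \<omega> \<Lambda>)"
    and "left_mod poly_ring (weyl_gr \<omega> (quot_module weyl L) F)"
    and "poly_ideal (ini \<omega> \<Lambda>)"
proof -
  interpret quant_ideal weyl Phi \<omega> "weyl_fil \<omega>" L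
    by (intro quant_ideal.intro quant_ideal_axioms.intro quantization_weyl \<omega> L)
  have gr: "weyl_gr \<omega> (quot_module weyl L) F = restrict_scalars symbol (gr_module (weyl_fil \<omega>) (quot_module weyl L) F)" for F
    by (simp add: weyl_gr_def weyl_gr_iso_symbol[OF \<omega>])
  interpret F: quant_module weyl Phi \<omega> "weyl_fil \<omega>" "quot_module weyl L" F
    using good by (intro quant_module.intro quant_module_axioms.intro quantization_axioms quot_left_mod)
      (simp add: good_filtration_def)
  have std: "annihilator poly_ring S.gr = ini \<omega> \<Lambda>" unfolding \<Lambda>_def by (rule annihilator_std_fil)
  show "rad (annihilator poly_ring (weyl_gr \<omega> (quot_module weyl L) F)) = rad (ini \<omega> \<Lambda>)"
    unfolding gr std[symmetric]
    by (rule rad_annihilator_gr_indep[OF quantization_axioms quot_left_mod good std_fil_good])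
  show "left_mod poly_ring (weyl_gr \<omega> (quot_module weyl L) F)"
    unfolding gr by (rule F.gr_left_mod)
  show "poly_ideal (ini \<omega> \<Lambda>)" unfolding std[symmetric] by (rule annihilator_ideal[OF S.gr_left_mod])
qed

lemma ini_poly_ideal: "\<omega> \<in> Omega \<Longrightarrow> poly_ideal (ini \<omega> \<Lambda>)"
proof -
  assume \<omega>: "\<omega> \<in> Omega"
  interpret quant_ideal weyl Phi \<omega> "weyl_fil \<omega>" L
    by (intro quant_ideal.intro quant_ideal_axioms.intro quantization_weyl \<omega> L)
  show ?thesis by (rule rad_annihilator_weyl_gr(3)[OF \<omega> std_fil_good])
qed

text \<open>
  The infimum of a nonempty set of natural numbers is a minimum, and the supremum over a finite basis
  is a maximum. Here the existence of a universal Groebner basis is essential.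
\<close>

lemma gamma_attained:
  "\<exists>U. universal_groebner_basis L U \<and> (\<forall>u\<in>U. \<forall>e\<in>supp u. wdot \<nu> e \<le> gamma \<nu> L)"
proof -
  let ?D = "\<lambda>U. {d::nat. \<exists>u\<in>U - {\<zero>\<^bsub>weyl\<^esub>}. weyl_deg \<nu> u = ereal (real d)}"
  have "(\<lambda>U. Sup (?D U)) ` {U. universal_groebner_basis L U} \<noteq> {}"
    using universal_groebner_basis_exists by blast
  then have "gamma \<nu> L \<in> (\<lambda>U. Sup (?D U)) ` {U. universal_groebner_basis L U}"
    unfolding gamma_def by (rule Inf_nat_def1)
  then obtain U where U: "universal_groebner_basis L U" "gamma \<nu> L = Sup (?D U)" by blast
  have "wdot \<nu> e \<le> gamma \<nu> L" if u: "u \<in> U" and e: "e \<in> supp u" for u e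
  proof -
    have "\<exists>m\<in>supp u. \<forall>e\<in>supp u. wdot \<nu> e \<le> wdot \<nu> m"
    proof -
      have f: "finite (wdot \<nu> ` supp u)" "wdot \<nu> ` supp u \<noteq> {}" using e by (auto simp: supp_def)
      from Max_in[OF f] obtain m where m: "m \<in> supp u" "wdot \<nu> m = Max (wdot \<nu> ` supp u)" by force
      then show ?thesis using Max_ge[OF f(1)] by (intro bexI[of _ m]) auto
    qed
    then obtain m where m: "m \<in> supp u" "\<And>e. e \<in> supp u \<Longrightarrow> wdot \<nu> e \<le> wdot \<nu> m" by blast
    have deg: "weyl_deg \<nu> u = ereal (real (wdot \<nu> m))"
      unfolding weyl_deg_def
    proof (rule antisym)
      show "(SUP e\<in>supp u. ereal (real (wdot \<nu> e))) \<le> ereal (real (wdot \<nu> m))"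
        by (rule SUP_least) (use m(2) in simp)
      show "ereal (real (wdot \<nu> m)) \<le> (SUP e\<in>supp u. ereal (real (wdot \<nu> e)))"
        by (rule SUP_upper[OF m(1)])
    qed
    have "u \<noteq> \<zero>\<^bsub>weyl\<^esub>"
    proof
      assume u0: "u = \<zero>\<^bsub>weyl\<^esub>"
      have "u = Phi 0" unfolding u0 weyl_simps by (rule ext) simp
      then have "supp u = {}" by (simp add: supp_def)
      then show False using e by simp
    qed
    then have mem: "wdot \<nu> m \<in> ?D U" using u deg by blast
    have "?D U \<subseteq> (\<lambda>u. THE d::nat. weyl_deg \<nu> u = ereal (real d)) ` U"
    proof
      fix d assume "d \<in> ?D U"
      then obtain w where w: "w \<in> U" "weyl_deg \<nu> w = ereal (real d)" by blast
      then have "(THE d::nat. weyl_deg \<nu> w = ereal (real d)) = d" by (intro the_equality) auto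
      then show "d \<in> (\<lambda>u. THE d::nat. weyl_deg \<nu> u = ereal (real d)) ` U" using w(1) by force
    qed
    moreover have "finite U" using U(1) by (simp add: universal_groebner_basis_def)
    ultimately have "finite (?D U)" using finite_subset finite_imageI by blast
    then have "wdot \<nu> m \<le> Sup (?D U)" using mem by (intro cSup_upper) (auto simp: bdd_above_nat)
    then show ?thesis using m(2)[OF e] U(2) by simp
  qed
  then show ?thesis using U(1) by blast
qed

theorem kappa_le_gamma: "kappa \<nu> (quot_module weyl L) \<le> gamma \<nu> L"
  unfolding kappa_def
proof (rule Least_le, intro ballI allI impI)
  fix \<omega> :: "'n + 'n \<Rightarrow> nat" and s F F' F''
  let ?M = "quot_module weyl L" and ?\<tau> = "\<lambda>i. \<nu> i + s * \<omega> i"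
  assume \<omega>: "\<omega> \<in> Omega" and s: "gamma \<nu> L < s"
    and F: "good_filtration (weyl_fil \<omega>) ?M F"
    and F': "good_filtration (poly_fil \<nu>) (weyl_gr \<omega> ?M F) F'"
    and F'': "good_filtration (weyl_fil ?\<tau>) ?M F''"
  have \<tau>: "?\<tau> \<in> Omega" by (rule Omega_comb[OF \<omega>]) (use s in simp)
  note W = rad_annihilator_weyl_gr[OF \<omega> F]
  let ?J = "annihilator poly_ring (weyl_gr \<omega> ?M F)"
  obtain U where U: "universal_groebner_basis L U" "\<And>u e. u \<in> U \<Longrightarrow> e \<in> supp u \<Longrightarrow> wdot \<nu> e \<le> gamma \<nu> L"
    using gamma_attained by blast
  have ini: "ini \<nu> (ini \<omega> \<Lambda>) = ini ?\<tau> \<Lambda>"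
  proof (rule ini_ini_weights[OF \<omega> W(3) ini_poly_ideal[OF \<tau>]])
    show "is_groebner r {u. Phi u \<in> U}" if "normal_ordering r" for r
      using U(1) that groebner_basisD by (auto simp: universal_groebner_basis_def)
    show "{u. Phi u \<in> U} \<subseteq> \<Lambda>" using U(1) by (auto simp: universal_groebner_basis_def \<Lambda>_def)
    show "s > 0" using s by simp
    show "wdot \<nu> e < s" if "u \<in> {u. Phi u \<in> U}" "e \<in> keys u" for u e
      using U(2)[of "Phi u" e] that s by (simp add: supp_def)
  qed
  have J: "poly_ideal ?J" by (rule annihilator_ideal[OF W(2)])
  have "rad (annihilator poly_ring (poly_gr \<nu> (weyl_gr \<omega> ?M F) F')) = rad (ini \<nu> ?J)"
    unfolding poly_gr_def poly_gr_iso_symbol by (rule rad_annihilator_poly_gr[OF W(2) F'])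
  also have "\<dots> = rad (ini \<nu> (ini \<omega> \<Lambda>))"
  proof (rule equalityI)
    show "rad (ini \<nu> ?J) \<subseteq> rad (ini \<nu> (ini \<omega> \<Lambda>))"
      by (rule rad_ini_mono[OF J W(3)]) (use W(1) rad_superset in blast)
    show "rad (ini \<nu> (ini \<omega> \<Lambda>)) \<subseteq> rad (ini \<nu> ?J)"
      by (rule rad_ini_mono[OF W(3) J]) (use W(1) rad_superset in blast)
  qed
  also have "\<dots> = rad (ini ?\<tau> \<Lambda>)" by (simp only: ini)
  also have "\<dots> = rad (annihilator poly_ring (weyl_gr ?\<tau> ?M F''))"
    by (rule rad_annihilator_weyl_gr(1)[OF \<tau> F'', symmetric])
  finally show "rad (annihilator poly_ring (poly_gr \<nu> (weyl_gr \<omega> ?M F) F')) =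
    rad (annihilator poly_ring (weyl_gr ?\<tau> ?M F''))" .
qed

end

theorem mainTheorem2:
  fixes L :: "('k::field_char_0, 'n::finite) endo set"
    and \<nu> :: "'n + 'n \<Rightarrow> nat"
  assumes "left_ideal L weyl"
  shows "kappa \<nu> (quot_module weyl L) \<le> gamma \<nu> L"
  by (rule weyl_ideal.kappa_le_gamma[OF weyl_ideal.intro[OF assms]])

end
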